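(* Let $N\ge3$ be odd, $K>0$, and let $z$ be in the interior of $\mathcal A_{\mathrm{regular}}$. Suppose that, for small $\kappa>0$, the leafwise measure $m_z=m^\kappa_{z,\mathrm{KKS}}$ (the invariant measure on $\mathcal O^*(z)$ of the fast process, see context) is a tilt of the normalized KKS measure $m_{z,\mathrm{KKS}}$: $$dm^\kappa_{z,\mathrm{KKS}}(\Omega)=\big(1+\kappa q(\Omega)+O(\kappa^2)\big)\,dm_{z,\mathrm{KKS}}(\Omega),$$ where $q\in C^2(\mathcal O^*(z);\mathbb R)$ is not identically $0$, $\int_{\mathcal O^*(z)}q\,dm_{z,\mathrm{KKS}}=0$, and the remainder $O(\kappa^2)$ is uniform on $\mathcal O^*(z)$. Then the averaged fluxes $\overline\Pi_{\mathcal E}(K;z)=\int_{\mathcal O^*(z)}\Pi_{\mathcal E}(K;\Omega)dm^\kappa_{z,\mathrm{KKS}}(\Omega)$ and $\overline\Pi_{\mathcal Z}(K;z)=\int_{\mathcal O^*(z)}\Pi_{\mathcal Z}(K;\Omega)dm^\kappa_{z,\mathrm{KKS}}(\Omega)$ satisfy $$\overline\Pi_{\mathcal E}(K;z)=\kappa\int_{\mathcal O^*(z)}\Pi_{\mathcal E}(K;\Omega)q(\Omega)\,dm_{z,\mathrm{KKS}}(\Omega)+O(\kappa^2),$$ $$\overline\Pi_{\mathcal Z}(K;z)=\kappa\int_{\mathcal O^*(z)}\Pi_{\mathcal Z}(K;\Omega)q(\Omega)\,dm_{z,\mathrm{KKS}}(\Omega)+O(\kappa^2).$$ In particular, if the integral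 in the first (resp. second) formula is nonzero, then $\overline\Pi_{\mathcal E}(K;z)$ (resp. $\overline\Pi_{\mathcal Z}(K;z)$) is nonzero for all small enough $\kappa>0$.
   Context: $\mathfrak{su}(N)$ is the real Lie algebra of trace-zero anti-Hermitian complex $N\times N$ matrices, $[A,B]=AB-BA$, with inner product $(A,B)=-\operatorname{tr}(AB)$. Put $\omega_N=e^{-4\pi i/N}$, $F=\mathrm{diag}(1,\omega_N,\dots,\omega_N^{N-1})$, and $H$ the matrix with $H_{j,j+1}=1$ ($1\le j\le N-1$), $H_{N,1}=1$, other entries $0$. $\mathcal K_N=(\mathbb Z/N\mathbb Z)^2\setminus\{(0,0)\}$; each $k\in\mathcal K_N$ is identified with its representative with $k_1,k_2\in\{-\frac{N-1}2,\dots,\frac{N-1}2\}$ and $|k|$ is its Euclidean norm. $J_k=\omega_N^{k_1k_2/2}F^{k_1}H^{k_2}$ (with $k_1k_2/2:=2^{-1}k_1k_2$ in $\mathbb Z/N\mathbb Z$), $L_{k,N}=\frac{N}{4\pi i}J_k$, a basis of the complexification of $\mathfrak{su}(N)$. Every $\Omega\in\mathfrak{su}(N)$ is $\Omega=\sum_{k\in\mathcal K_N}\Omega_kL_{k,N}$ with $\Omega_k\in\mathbb C$. The operator $A$, $AL_{k,N}=|k|^2L_{k,N}$, preserves $\mathfrak{su}(N)$; $\Psi=-A^{-1}\Omega$. $\pi(\Omega)=(\operatorname{tr}\Omega^2,\dots,\operatorname{tr}\Omega^N)$, $\mathcal A=\pi(\mathfrak{su}(N))$ (a subset of a real vector space of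 dimension $N-1$, since $\operatorname{tr}\Omega^k\in i^k\mathbb R$); for $z\in\mathcal A$, $\mathcal O^*(z)=\pi^{-1}(z)$ is a single coadjoint orbit $\{g\Lambda g^{-1}:g\in SU(N)\}$. $\mathcal A_{\mathrm{regular}}$ is the set of $z\in\mathcal A$ for which elements of $\mathcal O^*(z)$ have $N$ distinct eigenvalues. The KKS symplectic form on the orbit is $\omega_{\mathrm{KKS}}([X,\Omega],[Y,\Omega])=(\Omega,[X,Y])$; $m_{z,\mathrm{KKS}}$ is the associated Liouville volume normalized to a probability measure. Fast process: $d\Omega^X_t=\sum_{j=1}^mX_j(\Omega^X_t)\circ dW^{(j)}_t$ (Stratonovich, independent 1-d Brownian motions $W^{(j)}$), where the smooth vector fields $X_j$ (depending on $\kappa$) are tangent to coadjoint orbits and their generated Lie algebra spans the tangent space of $\mathcal O^*(z)$ at each point, so that the process on $\mathcal O^*(z)$ has a unique invariant probability measure; this measure is $m^\kappa_{z,\mathrm{KKS}}$. $\mathcal E_{\le K}(\Omega)=\frac12\sum_{k\in\mathcal K_N,|k|\le K}\frac{|\Omega_k|^2}{|k|^2}$, $\mathcal Z_{\le K}(\Omega)=\frac12\sum_{k\in\mathcal K_N,|k|\le K}|\Omega_k|^2$; with $D$ the Fréchet derivative, $\Pi_{\mathcal E}(K;\Omega)=-[D\mathcal E_{\le K}(\Omega)]([\Psi,\Omega])$ and $\Pi_{\mathcal Z}(K;\Omega)=-[D\mathcal Z_{\le K}(\Omega)]([\Psi,\Omega])$. *)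

theory Defs
  imports "HOL-Probability.Probability" "HOL-Library.Landau_Symbols"
begin

type_synonym 'n cmat = "complex^'n^'n"

section \<open>Matrices and the Lie algebra su(N), where N = CARD('n)\<close>

text \<open>0-based position in the linear order of a finite type; rows and columns \<open>1, \<dots>, N\<close> of the
  mathematical text are the elements of \<open>'n\<close> at positions \<open>0, \<dots>, N - 1\<close>.\<close>

definition pos :: "'a::{finite,linorder} \<Rightarrow> nat" where
  "pos i = card {j. j < i}"

definition nth_elem :: "nat \<Rightarrow> 'a::{finite,linorder}" where
  "nth_elem = the_inv pos"

definition cscale :: "complex \<Rightarrow> 'n cmat \<Rightarrow> 'n::finite cmat" where
  "cscale c A = (\<chi> i j. c * A $ i $ j)"

definition mat_pow :: "'n::finite cmat \<Rightarrow> nat \<Rightarrow> 'n cmat" where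
  "mat_pow A n = (((**) A) ^^ n) (mat 1)"

definition mat_powi :: "'n::finite cmat \<Rightarrow> int \<Rightarrow> 'n cmat" where
  "mat_powi A k = (if k \<ge> 0 then mat_pow A (nat k) else mat_pow (matrix_inv A) (nat (- k)))"

definition comm :: "'n::finite cmat \<Rightarrow> 'n cmat \<Rightarrow> 'n cmat" where
  "comm A B = A ** B - B ** A"

definition su :: "('n::finite cmat) set" where
  "su = {A. trace A = 0 \<and> (\<forall>i j. A $ j $ i = - cnj (A $ i $ j))}"

text \<open>On \<^const>\<open>su\<close> the number \<open>- tr (A B)\<close> is real, so taking the real part only changes the type.\<close>

definition su_inner :: "'n::finite cmat \<Rightarrow> 'n cmat \<Rightarrow> real" where
  "su_inner A B = Re (- trace (A ** B))"

definition eigenvalues :: "'n::finite cmat \<Rightarrow> complex set" where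
  "eigenvalues A = {c. \<exists>v. v \<noteq> 0 \<and> A *v v = c *s v}"

section \<open>The basis L, the operator A and the fluxes\<close>

definition omega :: "nat \<Rightarrow> complex" where
  "omega N = exp (- (4 * of_real pi * \<i>) / of_nat N)"

definition clock_mat :: "'n::{finite,linorder} cmat" where
  "clock_mat = (\<chi> i j. if i = j then omega CARD('n) ^ pos i else 0)"

definition shift_mat :: "'n::{finite,linorder} cmat" where
  "shift_mat = (\<chi> i j. if pos j = (pos i + 1) mod CARD('n) then 1 else 0)"

definition modes :: "nat \<Rightarrow> (int \<times> int) set" where
  "modes N = {(a, b). \<bar>a\<bar> \<le> (int N - 1) div 2 \<and> \<bar>b\<bar> \<le> (int N - 1) div 2} - {(0, 0)}"

definition knorm :: "int \<times> int \<Rightarrow> real" where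
  "knorm k = norm (real_of_int (fst k), real_of_int (snd k))"

text \<open>For odd \<open>N\<close>, \<open>(N + 1) div 2\<close> represents the inverse of 2 modulo \<open>N\<close>; the power of
  \<^term>\<open>omega N\<close> depends only on the exponent modulo \<open>N\<close>.\<close>

definition Jmat :: "int \<times> int \<Rightarrow> 'n::{finite,linorder} cmat" where
  "Jmat k = cscale (omega CARD('n) powi (((int CARD('n) + 1) div 2) * fst k * snd k))
              (mat_powi clock_mat (fst k) ** mat_powi shift_mat (snd k))"

definition Lmat :: "int \<times> int \<Rightarrow> 'n::{finite,linorder} cmat" where
  "Lmat k = cscale (of_nat CARD('n) / (4 * of_real pi * \<i>)) (Jmat k)"

definition coeff_L :: "'n::{finite,linorder} cmat \<Rightarrow> int \<times> int \<Rightarrow> complex" where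
  "coeff_L \<Omega> = (THE c. (\<forall>k. k \<notin> modes CARD('n) \<longrightarrow> c k = 0) \<and>
                      \<Omega> = (\<Sum>k\<in>modes CARD('n). cscale (c k) (Lmat k)))"

definition A_op :: "'n::{finite,linorder} cmat \<Rightarrow> 'n cmat" where
  "A_op \<Omega> = (\<Sum>k\<in>modes CARD('n). cscale (of_real ((knorm k)\<^sup>2) * coeff_L \<Omega> k) (Lmat k))"

definition stream_fun :: "'n::{finite,linorder} cmat \<Rightarrow> 'n cmat" where
  "stream_fun \<Omega> = - inv_into su A_op \<Omega>"

definition energy_le :: "real \<Rightarrow> 'n::{finite,linorder} cmat \<Rightarrow> real" where
  "energy_le K \<Omega> = 1/2 * (\<Sum>k\<in>{k \<in> modes CARD('n). knorm k \<le> K}. (cmod (coeff_L \<Omega> k))\<^sup>2 / (knorm k)\<^sup>2)"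

definition enstrophy_le :: "real \<Rightarrow> 'n::{finite,linorder} cmat \<Rightarrow> real" where
  "enstrophy_le K \<Omega> = 1/2 * (\<Sum>k\<in>{k \<in> modes CARD('n). knorm k \<le> K}. (cmod (coeff_L \<Omega> k))\<^sup>2)"

text \<open>The functionals live on \<^const>\<open>su\<close>, hence the derivative is taken within \<^const>\<open>su\<close>. It is
  applied to a vector of this linear subspace only, where its value is uniquely determined.\<close>

definition flux_E :: "real \<Rightarrow> 'n::{finite,linorder} cmat \<Rightarrow> real" where
  "flux_E K \<Omega> = - frechet_derivative (energy_le K) (at \<Omega> within su) (comm (stream_fun \<Omega>) \<Omega>)"

definition flux_Z :: "real \<Rightarrow> 'n::{finite,linorder} cmat \<Rightarrow> real" where
  "flux_Z K \<Omega> = - frechet_derivative (enstrophy_le K) (at \<Omega> within su) (comm (stream_fun \<Omega>) \<Omega>)"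

section \<open>Casimirs and coadjoint orbits\<close>

text \<open>A point \<open>(tr \<Omega>\<^sup>2, \<dots>, tr \<Omega>\<^sup>N)\<close> is a function on \<open>nat\<close> that vanishes off \<open>{2..N}\<close>.\<close>

definition casimirs :: "'n::finite cmat \<Rightarrow> nat \<Rightarrow> complex" where
  "casimirs \<Omega> = (\<lambda>k. if k \<in> {2..CARD('n)} then trace (mat_pow \<Omega> k) else 0)"

text \<open>The real vector space of dimension \<open>N - 1\<close> that contains all values of the Casimirs; the
  product topology induces its usual topology.\<close>

definition casimir_space :: "nat \<Rightarrow> (nat \<Rightarrow> complex) set" where
  "casimir_space N = {w. (\<forall>k\<in>{2..N}. \<exists>r::real. w k = \<i> ^ k * of_real r) \<and> (\<forall>k. k \<notin> {2..N} \<longrightarrow> w k = 0)}"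

definition orbit :: "(nat \<Rightarrow> complex) \<Rightarrow> ('n::finite cmat) set" where
  "orbit z = {\<Omega> \<in> su. casimirs \<Omega> = z}"

definition A_regular :: "'n::finite itself \<Rightarrow> (nat \<Rightarrow> complex) set" where
  "A_regular _ = {z \<in> casimirs ` (su :: 'n cmat set).
                    \<forall>\<Omega>\<in>(orbit z :: 'n cmat set). card (eigenvalues \<Omega>) = CARD('n)}"

definition tangent :: "'n::finite cmat \<Rightarrow> 'n cmat set" where
  "tangent \<Omega> = {comm X \<Omega> | X. X \<in> su}"

section \<open>The KKS form and its Liouville measure\<close>

definition kks :: "'n::finite cmat \<Rightarrow> 'n cmat \<Rightarrow> 'n cmat \<Rightarrow> real" where
  "kks \<Omega> u v = (THE r. \<exists>X\<in>su. \<exists>Y\<in>su. u = comm X \<Omega> \<and> v = comm Y \<Omega> \<and> r = su_inner \<Omega> (comm X Y))"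

text \<open>For a bilinear form \<open>w\<close>, alternating on the span of the vectors \<open>v i\<close>, and \<open>2 d = CARD('d)\<close>,
  this is the value of the top form \<open>w\<^sup>d / d!\<close> (exterior power) on the frame \<open>v\<close>.\<close>

definition wedge_top :: "('v \<Rightarrow> 'v \<Rightarrow> real) \<Rightarrow> ('d::{finite,linorder} \<Rightarrow> 'v) \<Rightarrow> real" where
  "wedge_top w v = (let d = CARD('d) div 2 in
     (\<Sum>p | p permutes (UNIV :: 'd set). of_int (sign p) *
        (\<Prod>i<d. w (v (p (nth_elem (2 * i)))) (v (p (nth_elem (2 * i + 1)))))) / (2 ^ d * fact d))"

text \<open>Local parametrizations of a submanifold \<open>S\<close> of dimension \<open>CARD('d)\<close>: by the inverse function
  theorem an injective immersion of this dimension into \<open>S\<close> is a diffeomorphism onto an open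
  subset of \<open>S\<close>.\<close>

definition parametrization ::
  "('v::euclidean_space) set \<Rightarrow> (real^'d) set \<Rightarrow> (real^'d \<Rightarrow> 'v) \<Rightarrow> (real^'d \<Rightarrow> real^'d \<Rightarrow> 'v) \<Rightarrow> bool" where
  "parametrization S U \<phi> \<phi>' \<longleftrightarrow>
     open U \<and> \<phi> ` U \<subseteq> S \<and> inj_on \<phi> U \<and>
     (\<forall>x\<in>U. (\<phi> has_derivative \<phi>' x) (at x) \<and> inj (\<phi>' x)) \<and>
     (\<forall>h. continuous_on U (\<lambda>x. \<phi>' x h))"

text \<open>In every local parametrization the Liouville volume is integration of the absolute value of
  the coordinate density of \<open>w\<^sup>d / d!\<close>. The argument \<open>'d\<close> fixes the dimension \<open>2 d\<close> of the orbit.\<close>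

definition liouville_measure ::
  "'d::{finite,linorder} itself \<Rightarrow> (nat \<Rightarrow> complex) \<Rightarrow> ('n::finite cmat) measure \<Rightarrow> bool" where
  "liouville_measure _ z \<mu> \<longleftrightarrow>
     sets \<mu> = sets (restrict_space borel (orbit z)) \<and>
     (\<forall>(U :: (real, 'd) vec set) \<phi> \<phi>'. parametrization (orbit z) U \<phi> \<phi>' \<longrightarrow>
        (\<forall>B\<in>sets \<mu>. emeasure \<mu> (B \<inter> \<phi> ` U) =
           (\<integral>\<^sup>+x\<in>U. ennreal \<bar>wedge_top (kks (\<phi> x)) (\<lambda>i. \<phi>' x (axis i 1))\<bar> * indicator B (\<phi> x) \<partial>lborel)))"

definition kks_probability ::
  "'d::{finite,linorder} itself \<Rightarrow> (nat \<Rightarrow> complex) \<Rightarrow> ('n::finite cmat) measure \<Rightarrow> bool" where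
  "kks_probability T z m \<longleftrightarrow> prob_space m \<and>
     (\<exists>\<mu>. liouville_measure T z \<mu> \<and> m = scale_measure (inverse (emeasure \<mu> (space \<mu>))) \<mu>)"

section \<open>Differentiability classes\<close>

primrec C_open :: "nat \<Rightarrow> ('a::euclidean_space) set \<Rightarrow> ('a \<Rightarrow> 'b::euclidean_space) \<Rightarrow> bool" where
  "C_open 0 V f = continuous_on V f"
| "C_open (Suc k) V f =
     (\<exists>f'. (\<forall>x\<in>V. (f has_derivative f' x) (at x)) \<and> (\<forall>h. C_open k V (\<lambda>x. f' x h)))"

text \<open>\<open>C\<^sup>k\<close> functions on a submanifold: those that extend locally to a \<open>C\<^sup>k\<close> function of the
  ambient space.\<close>

definition C_on :: "nat \<Rightarrow> ('a::euclidean_space) set \<Rightarrow> ('a \<Rightarrow> 'b::euclidean_space) \<Rightarrow> bool" where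
  "C_on k S f \<longleftrightarrow> (\<forall>x\<in>S. \<exists>V g. open V \<and> x \<in> V \<and> C_open k V g \<and> (\<forall>y\<in>V \<inter> S. g y = f y))"

definition smooth_on :: "('a::euclidean_space) set \<Rightarrow> ('a \<Rightarrow> 'b::euclidean_space) \<Rightarrow> bool" where
  "smooth_on S f \<longleftrightarrow> (\<forall>k. C_on k S f)"

section \<open>Stochastic processes\<close>

text \<open>All processes are indexed by \<open>real\<close>; only times \<open>t \<ge> 0\<close> matter.\<close>

definition filtered_prob_space :: "'w measure \<Rightarrow> (real \<Rightarrow> 'w measure) \<Rightarrow> bool" where
  "filtered_prob_space M F \<longleftrightarrow> prob_space M \<and> filtration (space M) F \<and> (\<forall>t. sets (F t) \<subseteq> sets M)"

definition indep_brownian_motions ::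
  "'w measure \<Rightarrow> (real \<Rightarrow> 'w measure) \<Rightarrow> nat \<Rightarrow> (nat \<Rightarrow> real \<Rightarrow> 'w \<Rightarrow> real) \<Rightarrow> bool" where
  "indep_brownian_motions M F m W \<longleftrightarrow>
     (\<forall>j<m. (\<forall>w\<in>space M. W j 0 w = 0 \<and> continuous_on {0..} (\<lambda>t. W j t w)) \<and>
            (\<forall>t\<ge>0. W j t \<in> borel_measurable (F t))) \<and>
     (\<forall>s t. 0 \<le> s \<and> s < t \<longrightarrow>
        (\<forall>j<m. distributed M lborel (\<lambda>w. W j t w - W j s w) (normal_density 0 (sqrt (t - s)))) \<and>
        prob_space.indep_sets M
          (\<lambda>i. case i of 0 \<Rightarrow> sets (F s)
               | Suc j \<Rightarrow> {(\<lambda>w. W j t w - W j s w) -` B \<inter> space M | B. B \<in> sets borel}) {..m})"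

definition is_martingale :: "'w measure \<Rightarrow> (real \<Rightarrow> 'w measure) \<Rightarrow> (real \<Rightarrow> 'w \<Rightarrow> real) \<Rightarrow> bool" where
  "is_martingale M F Y \<longleftrightarrow>
     (\<forall>t\<ge>0. integrable M (Y t) \<and> Y t \<in> borel_measurable (F t)) \<and>
     (\<forall>s t. 0 \<le> s \<and> s \<le> t \<longrightarrow> (AE w in M. real_cond_exp M (F s) (Y t) w = Y s w))"

definition local_martingale :: "'w measure \<Rightarrow> (real \<Rightarrow> 'w measure) \<Rightarrow> (real \<Rightarrow> 'w \<Rightarrow> real) \<Rightarrow> bool" where
  "local_martingale M F Y \<longleftrightarrow>
     (\<forall>t\<ge>0. Y t \<in> borel_measurable (F t)) \<and>
     (\<exists>\<tau> :: nat \<Rightarrow> 'w \<Rightarrow> real.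
        (\<forall>n. stopping_time F (\<tau> n) \<and> (\<forall>w\<in>space M. 0 \<le> \<tau> n w)) \<and>
        (AE w in M. incseq (\<lambda>n. \<tau> n w) \<and> filterlim (\<lambda>n. \<tau> n w) at_top sequentially) \<and>
        (\<forall>n. is_martingale M F (\<lambda>t w. Y (min t (\<tau> n w)) w - Y 0 w)))"

definition partition_of :: "real \<Rightarrow> nat \<Rightarrow> (nat \<Rightarrow> real) \<Rightarrow> bool" where
  "partition_of t n p \<longleftrightarrow> p 0 = 0 \<and> p n = t \<and> (\<forall>i<n. p i \<le> p (Suc i))"

definition finite_variation :: "(real \<Rightarrow> real) \<Rightarrow> bool" where
  "finite_variation f \<longleftrightarrow>
     (\<forall>t\<ge>0. bdd_above {(\<Sum>i<n. \<bar>f (p (Suc i)) - f (p i)\<bar>) | n p. partition_of t n p})"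

definition continuous_semimartingale ::
  "'w measure \<Rightarrow> (real \<Rightarrow> 'w measure) \<Rightarrow> (real \<Rightarrow> 'w \<Rightarrow> real) \<Rightarrow> bool" where
  "continuous_semimartingale M F Y \<longleftrightarrow>
     (\<exists>Y1 Y2. local_martingale M F Y1 \<and> (\<forall>t\<ge>0. Y2 t \<in> borel_measurable (F t)) \<and>
        (\<forall>w\<in>space M. continuous_on {0..} (\<lambda>t. Y1 t w) \<and> continuous_on {0..} (\<lambda>t. Y2 t w) \<and>
            finite_variation (\<lambda>t. Y2 t w)) \<and>
        (\<forall>t\<ge>0. \<forall>w\<in>space M. Y t w = Y1 t w + Y2 t w))"

text \<open>\<open>I\<close> is the Stratonovich integral of the semimartingale \<open>Y\<close> against \<open>V\<close> over \<open>[0, t]\<close>: the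
  limit in probability of the trapezoidal sums as the mesh of the partition tends to 0.\<close>

definition stratonovich_integral ::
  "'w measure \<Rightarrow> (real \<Rightarrow> 'w \<Rightarrow> 'v::euclidean_space) \<Rightarrow> (real \<Rightarrow> 'w \<Rightarrow> real) \<Rightarrow> real \<Rightarrow> ('w \<Rightarrow> 'v) \<Rightarrow> bool" where
  "stratonovich_integral M Y V t I \<longleftrightarrow> I \<in> borel_measurable M \<and>
     (\<forall>\<epsilon>>0. \<exists>\<delta>>0. \<forall>n p. partition_of t n p \<and> (\<forall>i<n. p (Suc i) - p i < \<delta>) \<longrightarrow>
        measure M {w \<in> space M. norm ((\<Sum>i<n. (V (p (Suc i)) w - V (p i) w) *\<^sub>R
            ((1/2) *\<^sub>R (Y (p i) w + Y (p (Suc i)) w))) - I w) > \<epsilon>} < \<epsilon>)"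

text \<open>\<open>Z\<close> solves \<open>dZ = \<Sum>j<m. X j (Z) \<circ> dW j\<close> with \<open>Z 0 = x\<close>.\<close>

definition stratonovich_solution ::
  "'w measure \<Rightarrow> (real \<Rightarrow> 'w measure) \<Rightarrow> nat \<Rightarrow> (nat \<Rightarrow> real \<Rightarrow> 'w \<Rightarrow> real) \<Rightarrow>
   (nat \<Rightarrow> 'n cmat \<Rightarrow> 'n cmat) \<Rightarrow> 'n::finite cmat \<Rightarrow> (real \<Rightarrow> 'w \<Rightarrow> 'n cmat) \<Rightarrow> bool" where
  "stratonovich_solution M F m W X x Z \<longleftrightarrow>
     (\<forall>t\<ge>0. Z t \<in> borel_measurable (F t)) \<and>
     (\<forall>w\<in>space M. Z 0 w = x \<and> (\<forall>t\<ge>0. Z t w \<in> su) \<and> continuous_on {0..} (\<lambda>t. Z t w)) \<and>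
     (\<forall>b\<in>Basis. continuous_semimartingale M F (\<lambda>t w. Z t w \<bullet> b)) \<and>
     (\<forall>t\<ge>0. \<exists>I. (\<forall>j<m. stratonovich_integral M (\<lambda>s w. X j (Z s w)) (W j) t (I j)) \<and>
                (AE w in M. Z t w = x + (\<Sum>j<m. I j w)))"

text \<open>The Lie algebra of vector fields on \<^const>\<open>su\<close> generated by \<open>G\<close>.\<close>

inductive_set lie_algebra_generated :: "('n::finite cmat \<Rightarrow> 'n cmat) set \<Rightarrow> ('n cmat \<Rightarrow> 'n cmat) set"
  for G where
  base: "U \<in> G \<Longrightarrow> U \<in> lie_algebra_generated G"
| add: "U \<in> lie_algebra_generated G \<Longrightarrow> V \<in> lie_algebra_generated G \<Longrightarrow>
    (\<lambda>\<Omega>. U \<Omega> + V \<Omega>) \<in> lie_algebra_generated G"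
| scale: "U \<in> lie_algebra_generated G \<Longrightarrow> (\<lambda>\<Omega>. c *\<^sub>R U \<Omega>) \<in> lie_algebra_generated G"
| bracket: "U \<in> lie_algebra_generated G \<Longrightarrow> V \<in> lie_algebra_generated G \<Longrightarrow>
    (\<lambda>\<Omega>. frechet_derivative V (at \<Omega> within su) (U \<Omega>) - frechet_derivative U (at \<Omega> within su) (V \<Omega>))
      \<in> lie_algebra_generated G"

text \<open>The fast process on the orbit over \<open>z\<close>: \<open>Z x\<close> is the solution started at \<open>x\<close>.\<close>

definition fast_process ::
  "'w measure \<Rightarrow> (real \<Rightarrow> 'w measure) \<Rightarrow> nat \<Rightarrow> (nat \<Rightarrow> real \<Rightarrow> 'w \<Rightarrow> real) \<Rightarrow>
   (nat \<Rightarrow> 'n cmat \<Rightarrow> 'n cmat) \<Rightarrow> (nat \<Rightarrow> complex) \<Rightarrow> ('n::finite cmat \<Rightarrow> real \<Rightarrow> 'w \<Rightarrow> 'n cmat) \<Rightarrow> bool" where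
  "fast_process M F m W X z Z \<longleftrightarrow>
     (\<forall>j<m. smooth_on su (X j) \<and> (\<forall>\<Omega>\<in>su. X j \<Omega> \<in> tangent \<Omega>)) \<and>
     (\<forall>\<Omega>\<in>orbit z. {U \<Omega> | U. U \<in> lie_algebra_generated (X ` {..<m})} = tangent \<Omega>) \<and>
     (\<forall>x\<in>orbit z. stratonovich_solution M F m W X x (Z x))"

definition invariant_probability ::
  "'w measure \<Rightarrow> (nat \<Rightarrow> complex) \<Rightarrow> ('n::finite cmat \<Rightarrow> real \<Rightarrow> 'w \<Rightarrow> 'n cmat) \<Rightarrow> ('n cmat) measure \<Rightarrow> bool" where
  "invariant_probability M z Z \<mu> \<longleftrightarrow>
     prob_space \<mu> \<and> sets \<mu> = sets (restrict_space borel (orbit z)) \<and>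
     (\<forall>t\<ge>0. \<forall>B\<in>sets \<mu>. emeasure \<mu> B = (\<integral>\<^sup>+x. emeasure M {w \<in> space M. Z x t w \<in> B} \<partial>\<mu>))"

end

theory Submission
  imports Defs "HOL-Computational_Algebra.Polynomial"
begin

text \<open>Expanding the density, everything reduces to the vanishing of the mean fluxes under the KKS
  measure. Transposition is an anti-automorphism of \<open>su(N)\<close> that preserves all Casimirs, hence every
  orbit, and sends \<open>L\<close> at \<open>(a, b)\<close> to \<open>L\<close> at \<open>(a, - b)\<close>. Both fluxes are quadratic forms in the mode
  coefficients paired with one commutator, so they are odd under it. The KKS form changes its sign on
  tangent vectors, so the Liouville measure is invariant and the means are zero. That the
  parametrizations determine the Liouville measure requires the orbit to be covered by them: near
  a regular element it is a level set of finitely many functions with independent gradients.\<close>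

subsection \<open>Charts of level sets\<close>

text \<open>The fluxes are cubic, so the map from \<Omega> to -\<Omega> reverses them too, but it
  flips the odd Casimirs and in general leaves the orbit; transposition keeps the trace of every
  power. Regularity is used twice: it makes the Casimir gradients independent, and it makes every
  tangent vector of the orbit a commutator with \<Omega>, the only vectors on which the description
  \<open>kks\<close> has a controlled value. The trace is counted as the lowest Casimir: N functions
  on the anti-Hermitian matrices, of real dimension N * N, leave N * (N - 1) =
  \<open>CARD('d)\<close>. The obstacle is that \<open>liouville_measure\<close> gives the measure
  only on images of charts. A chart followed by \<open>transpose\<close> is again a chart with the
  same absolute density, which compares the measure with its pushforward on one chart; charts are
  therefore built with image exactly a ball intersected with the orbit, and the comparisons on balls
  are glued. On the algebraic side the descriptions hidden in \<open>coeff_L\<close>,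
  \<open>stream_fun\<close> and the derivative within \<open>su\<close> are first replaced by
  formulas that are linear on all matrices.\<close>

lemma local_inverse_near_identity:
  fixes f :: "'a::euclidean_space \<Rightarrow> 'a" and f' :: "'a \<Rightarrow> ('a \<Rightarrow>\<^sub>L 'a)"
  assumes der: "\<And>x. (f has_derivative blinfun_apply (f' x)) (at x)"
    and cont: "continuous_on UNIV f'" and id: "f' x0 = id_blinfun"
  obtains e V g g' where "e > 0" "open V" "homeomorphism (ball x0 e) V f g"
    "\<And>y. y \<in> V \<Longrightarrow> (g has_derivative g' y) (at y)"
    "\<And>y. y \<in> V \<Longrightarrow> inj (g' y)"
    "\<And>h. continuous_on V (\<lambda>y. g' y h)"
proof -
  \<comment> \<open>Within distance 1/2 of the identity the derivative shrinks no vector by more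
    than a factor 2 (\<open>low\<close> below). This uniform bound is what later yields continuity
    of the derivative of the inverse, which \<open>parametrization\<close> demands.\<close>
  define U where "U = {x. norm (f' x - id_blinfun) < 1/2}"
  have "open U"
    unfolding U_def by (intro open_Collect_less continuous_intros cont)
  have "x0 \<in> U" by (simp add: U_def id)
  have "id_blinfun o\<^sub>L f' x0 = id_blinfun" by (simp add: id blinfun_eqI)
  with \<open>open U\<close> \<open>x0 \<in> U\<close> obtain U' V g g' where
    U': "open U'" "U' \<subseteq> U" "x0 \<in> U'" and V: "open V" and hom: "homeomorphism U' V f g"
    and derg: "\<And>y. y \<in> V \<Longrightarrow> (g has_derivative (g' y)) (at y)"
    and g': "\<And>y. y \<in> V \<Longrightarrow> g' y = inv (blinfun_apply (f' (g y)))"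
    and bij: "\<And>y. y \<in> V \<Longrightarrow> bij (blinfun_apply (f' (g y)))"
    using inverse_function_theorem[of U f f' x0 id_blinfun] der cont continuous_on_subset[OF cont, of U]
    by (metis subset_UNIV)
  obtain e where e: "e > 0" "ball x0 e \<subseteq> U'" using U' open_contains_ball by blast
  \<comment> \<open>The domain is cut down to a ball because measures will be compared on balls
    around points of the orbit.\<close>
  define V' where "V' = V \<inter> g -` ball x0 e"
  have contg: "continuous_on V g" using hom by (simp add: homeomorphism_def)
  have "open V'" unfolding V'_def by (rule continuous_open_preimage[OF contg V]) simp
  have sub: "V' \<subseteq> V" by (auto simp: V'_def)
  have hom': "homeomorphism (ball x0 e) V' f g"
  proof -
    have fg: "\<And>x. x \<in> U' \<Longrightarrow> f x \<in> V \<and> g (f x) = x" "\<And>y. y \<in> V \<Longrightarrow> f (g y) = y"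
      using hom by (auto simp: homeomorphism_def)
    have "f ` ball x0 e = V'"
    proof (intro set_eqI iffI)
      fix y assume "y \<in> f ` ball x0 e"
      then show "y \<in> V'" using fg(1) e(2) unfolding V'_def by fastforce
    next
      fix y assume "y \<in> V'"
      then show "y \<in> f ` ball x0 e" using fg(2)[of y] unfolding V'_def by (auto intro!: image_eqI[of _ _ "g y"])
    qed
    then show ?thesis
      using homeomorphism_of_subsets[OF hom e(2) subset_refl] by blast
  qed
  have low: "norm w \<le> 2 * norm (blinfun_apply (f' x) w)" if "x \<in> U" for x w
  proof -
    have "norm w \<le> norm (blinfun_apply (f' x) w) + norm (blinfun_apply (f' x - id_blinfun) w)"
      using norm_triangle_ineq4[of "blinfun_apply (f' x) w" "blinfun_apply (f' x - id_blinfun) w"]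
      by (simp add: blinfun.diff_left)
    also have "norm (blinfun_apply (f' x - id_blinfun) w) \<le> norm (f' x - id_blinfun) * norm w"
      by (rule norm_blinfun)
    also have "\<dots> \<le> 1/2 * norm w" using that by (intro mult_right_mono) (auto simp: U_def)
    finally show ?thesis by simp
  qed
  have "continuous_on V (\<lambda>y. g' y h)" for h
    unfolding continuous_on_eq_continuous_at[OF V]
  proof
    fix y0 assume y0: "y0 \<in> V"
    let ?L = "\<lambda>y. f' (g y)"
    define w where "w = g' y0 h"
    have cf: "continuous_on V ?L"
      using continuous_on_compose2[OF cont contg] by simp
    have app: "blinfun_apply (?L y) (g' y k) = k" if "y \<in> V" for y k
      using g'[OF that] bij[OF that] by (simp add: bij_is_surj surj_f_inv_f)
    have gU: "g y \<in> U" if "y \<in> V" for y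
      using hom that U'(2) by (auto simp: homeomorphism_def)
    \<comment> \<open>\<open>w\<close> solves the linear equation at \<open>y0\<close>; inserted at
      \<open>y\<close> it leaves the residual \<open>(?L y0 - ?L y) w\<close>, and
      \<open>low\<close> bounds the error of the solution by that residual.\<close>
    have bd: "norm (g' y h - w) \<le> 2 * norm (blinfun_apply (?L y0 - ?L y) w)" if "y \<in> V" for y
    proof -
      have "blinfun_apply (?L y) (g' y h - w) = blinfun_apply (?L y0 - ?L y) w"
        using app[OF that, of h] app[OF y0, of h]
        by (simp add: blinfun.diff_right blinfun.diff_left w_def)
      with low[OF gU[OF that], of "g' y h - w"] show ?thesis by simp
    qed
    have "((\<lambda>y. 2 * norm (blinfun_apply (?L y0 - ?L y) w)) \<longlongrightarrow> 2 * norm (blinfun_apply (?L y0 - ?L y0) w)) (at y0)"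
      using cf y0 V by (intro tendsto_intros) (auto simp: continuous_on_eq_continuous_at isCont_def)
    then have lim: "((\<lambda>y. 2 * norm (blinfun_apply (?L y0 - ?L y) w)) \<longlongrightarrow> 0) (at y0)" by simp
    have "((\<lambda>y. g' y h - w) \<longlongrightarrow> 0) (at y0)"
      by (rule Lim_null_comparison[OF _ lim]) (use bd V y0 in \<open>auto intro!: eventually_mono[OF eventually_at_in_open'[OF V y0]]\<close>)
    then show "isCont (\<lambda>y. g' y h) y0"
      unfolding isCont_def w_def by (simp add: LIM_zero_iff)
  qed
  then have "continuous_on V' (\<lambda>y. g' y h)" for h using sub continuous_on_subset by blast
  moreover have "inj (g' y)" if "y \<in> V'" for y
    using g' bij that sub by (metis bij_imp_bij_inv bij_is_inj subsetD)
  ultimately show thesis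
    using that[OF e(1) \<open>open V'\<close> hom', of g'] derg sub by blast
qed

text \<open>The component of \<open>E k\<close> orthogonal to the other vectors, divided by its
  squared length, is dual to the family; independence keeps it nonzero. Membership in the span is
  recorded because it lets the dual vectors inherit the symmetry of the gradients under
  \<sigma>.\<close>

lemma dual_vectors:
  fixes E :: "nat \<Rightarrow> 'a::euclidean_space"
  assumes "inj_on E {..<n}" "independent (E ` {..<n})"
  obtains D where "\<And>k. k < n \<Longrightarrow> D k \<in> span (E ` {..<n})"
    "\<And>j k. j < n \<Longrightarrow> k < n \<Longrightarrow> E j \<bullet> D k = (if j = k then 1 else 0)"
proof -
  have "\<exists>d. d \<in> span (E ` {..<n}) \<and> (\<forall>j<n. E j \<bullet> d = (if j = k then 1 else 0))" if k: "k < n" for k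
  proof -
    let ?S = "span (E ` ({..<n} - {k}))"
    obtain y zz where y: "y \<in> ?S" and z: "\<And>w. w \<in> ?S \<Longrightarrow> orthogonal zz w" and Ek: "E k = y + zz"
      using orthogonal_subspace_decomp_exists[of "E ` ({..<n} - {k})" "E k"] by blast
    have eq: "E ` ({..<n} - {k}) = E ` {..<n} - {E k}"
      using assms(1) k by (auto simp: inj_on_def)
    have "E k \<notin> ?S" using assms(2) k unfolding eq dependent_def by blast
    then have "zz \<noteq> 0" using y Ek by auto
    have yS: "y \<in> span (E ` {..<n})" using y span_mono[of "E ` ({..<n} - {k})" "E ` {..<n}"] by blast
    have zS: "zz \<in> span (E ` {..<n})"
      proof -
      have "E k \<in> span (E ` {..<n})" using k by (auto intro: span_base)
      from span_diff[OF this yS] show ?thesis by (simp add: Ek)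
    qed
    have "E j \<bullet> zz = 0" if "j < n" "j \<noteq> k" for j
      using z[of "E j"] that span_base[of "E j" "E ` ({..<n} - {k})"] by (auto simp: orthogonal_def inner_commute)
    moreover have "E k \<bullet> zz = zz \<bullet> zz"
      using z[OF y] by (simp add: Ek inner_add_left orthogonal_def inner_commute[of y])
    ultimately show ?thesis
      using \<open>zz \<noteq> 0\<close> zS by (intro exI[of _ "zz /\<^sub>R (zz \<bullet> zz)"]) (auto intro: span_scale)
  qed
  then obtain D where "\<And>k. k < n \<Longrightarrow> D k \<in> span (E ` {..<n}) \<and> (\<forall>j<n. E j \<bullet> D k = (if j = k then 1 else 0))"
    by metis
  then show thesis using that[of D] by blast
qed

text \<open>With \<open>D\<close> dual to the gradients \<open>E\<close> at \<open>x0\<close>, the map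
  \<open>G x = x + (\<Sum>k. (h k x - E k \<bullet> x) *\<^sub>R D k)\<close> has derivative \<open>id\<close> at \<open>x0\<close> and straightens the
  level set: \<open>E k \<bullet> G x = h k x\<close>. The isometric involution \<open>\<sigma>\<close> singles out a subspace (below, the
  anti-Hermitian matrices); as \<open>G\<close> commutes with \<open>\<sigma>\<close>, its inverse on a ball around \<open>x0\<close> preserves it.\<close>

lemma level_set_chart:
  fixes h :: "nat \<Rightarrow> 'a::euclidean_space \<Rightarrow> real" and dh :: "nat \<Rightarrow> 'a \<Rightarrow> 'a" and x0 :: 'a
  assumes der: "\<And>k x. k < n \<Longrightarrow> (h k has_derivative (\<lambda>v. dh k x \<bullet> v)) (at x)"
    and cont: "\<And>k. k < n \<Longrightarrow> continuous_on UNIV (dh k)"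
    and inj: "inj_on (\<lambda>k. dh k x0) {..<n}" and indep: "independent ((\<lambda>k. dh k x0) ` {..<n})"
    and \<sigma>: "linear \<sigma>" "\<And>x. \<sigma> (\<sigma> x) = x" "\<And>x. norm (\<sigma> x) = norm x"
    and \<sigma>h: "\<And>k x. k < n \<Longrightarrow> h k (\<sigma> x) = h k x"
    and \<sigma>0: "\<sigma> x0 = x0" and \<sigma>d: "\<And>k. k < n \<Longrightarrow> \<sigma> (dh k x0) = dh k x0"
    and dim: "dim {x. \<sigma> x = x} = CARD('d) + n"
  obtains e U and \<phi> :: "real^'d \<Rightarrow> 'a" and \<phi>'
  where "e > 0" "parametrization {x. \<sigma> x = x \<and> (\<forall>k<n. h k x = h k x0)} U \<phi> \<phi>'"
    "\<phi> ` U = ball x0 e \<inter> {x. \<sigma> x = x \<and> (\<forall>k<n. h k x = h k x0)}"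
proof -
  define E where "E = (\<lambda>k. dh k x0)"
  define Fx where "Fx = {x. \<sigma> x = x}"
  have subF: "subspace Fx"
    unfolding Fx_def by (simp add: subspace_def linear_0[OF \<sigma>(1)] linear_add[OF \<sigma>(1)] linear_scale[OF \<sigma>(1)])
  obtain D where DS: "\<And>k. k < n \<Longrightarrow> D k \<in> span (E ` {..<n})"
    and D: "\<And>j k. j < n \<Longrightarrow> k < n \<Longrightarrow> E j \<bullet> D k = (if j = k then 1 else 0)"
    using dual_vectors[of E n] inj indep unfolding E_def by blast
  have EF: "E ` {..<n} \<subseteq> Fx" using \<sigma>d by (auto simp: E_def Fx_def)
  have DF: "D k \<in> Fx" if "k < n" for k
    using DS[OF that] span_minimal[OF EF subF] by blast
  have \<sigma>D: "\<sigma> (D k) = D k" if "k < n" for k using DF[OF that] by (simp add: Fx_def)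
  have \<sigma>inner: "\<sigma> x \<bullet> \<sigma> y = x \<bullet> y" for x y
    using \<sigma>(3)[of "x + y"] \<sigma>(3)[of x] \<sigma>(3)[of y]
    by (simp add: linear_add[OF \<sigma>(1)] norm_eq_sqrt_inner inner_add_left inner_add_right inner_commute)
  define G where "G = (\<lambda>x. x + (\<Sum>k<n. (h k x - E k \<bullet> x) *\<^sub>R D k))"
  define G' where "G' = (\<lambda>x. Blinfun (\<lambda>v. v + (\<Sum>k<n. (dh k x \<bullet> v - E k \<bullet> v) *\<^sub>R D k)))"
  have bl: "bounded_linear (\<lambda>v. v + (\<Sum>k<n. (dh k x \<bullet> v - E k \<bullet> v) *\<^sub>R D k))" for x
    by (intro bounded_linear_add bounded_linear_ident bounded_linear_sum bounded_linear_scaleR_const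
        bounded_linear_sub bounded_linear_inner_right)
  have G'app: "blinfun_apply (G' x) v = v + (\<Sum>k<n. (dh k x \<bullet> v - E k \<bullet> v) *\<^sub>R D k)" for x v
    unfolding G'_def bounded_linear_Blinfun_apply[OF bl] ..
  have derG: "(G has_derivative blinfun_apply (G' x)) (at x)" for x
    unfolding G_def G'app by (auto intro!: derivative_eq_intros der)
  have contG': "continuous_on UNIV G'"
    by (rule continuous_on_blinfun_componentwise)
      (auto simp: G'app intro!: continuous_intros cont)
  have idG: "G' x0 = id_blinfun" by (rule blinfun_eqI) (simp add: G'app E_def)
  obtain e V g g' where e: "e > 0" and V: "open V" and hom: "homeomorphism (ball x0 e) V G g"
    and derg: "\<And>y. y \<in> V \<Longrightarrow> (g has_derivative g' y) (at y)"
    and injg': "\<And>y. y \<in> V \<Longrightarrow> inj (g' y)"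
    and contg': "\<And>h. continuous_on V (\<lambda>y. g' y h)"
    using local_inverse_near_identity[OF derG contG' idG] by metis
  have gG: "g (G x) = x" if "x \<in> ball x0 e" for x using hom that by (simp add: homeomorphism_def)
  have Gg: "G (g y) = y" "g y \<in> ball x0 e" if "y \<in> V" for y
    using hom that by (auto simp: homeomorphism_def)
  have GV: "G x \<in> V" if "x \<in> ball x0 e" for x using hom that by (auto simp: homeomorphism_def)
  have G\<sigma>: "G (\<sigma> x) = \<sigma> (G x)" for x
  proof -
    have "E k \<bullet> \<sigma> x = E k \<bullet> x" if "k < n" for k
      using \<sigma>inner[of "E k" x] \<sigma>d[OF that] by (simp add: E_def)
    then show ?thesis
      by (simp add: G_def linear_add[OF \<sigma>(1)] linear_sum[OF \<sigma>(1)] linear_scale[OF \<sigma>(1)] \<sigma>h \<sigma>D)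
  qed
  have EG: "E j \<bullet> G x = h j x" if "j < n" for j x
    using that by (simp add: G_def inner_add_right inner_sum_right D if_distrib[of "(*) _"] cong: if_cong)
  \<comment> \<open>The tangent space of the level set at \<open>x0\<close> inside the fixed space
    of \<sigma>. Its dimension is \<open>CARD('d)\<close>, so \<open>real^'d\<close> can serve as
    parameter space.\<close>
  define W where "W = {x \<in> Fx. \<forall>y\<in>span (E ` {..<n}). orthogonal y x}"
  have subW: "subspace W"
    unfolding W_def using subF by (auto simp: subspace_def orthogonal_def inner_add_right)
  have WE: "w \<in> W \<longleftrightarrow> w \<in> Fx \<and> (\<forall>k<n. E k \<bullet> w = 0)" for w
  proof
    assume "w \<in> W" then show "w \<in> Fx \<and> (\<forall>k<n. E k \<bullet> w = 0)"
      unfolding W_def by (auto simp: orthogonal_def span_base)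
  next
    assume *: "w \<in> Fx \<and> (\<forall>k<n. E k \<bullet> w = 0)"
    have "orthogonal w y" if "y \<in> span (E ` {..<n})" for y
      by (rule orthogonal_to_span[OF that]) (use * in \<open>auto simp: orthogonal_def inner_commute\<close>)
    with * show "w \<in> W" by (auto simp: W_def orthogonal_commute)
  qed
  have "dim W + dim (span (E ` {..<n})) = dim Fx"
    unfolding W_def using span_minimal[OF EF subF] subF
    by (intro dim_subspace_orthogonal_to_vectors) auto
  moreover have "dim (span (E ` {..<n})) = n"
    using inj indep by (simp add: E_def dim_eq_card_independent card_image)
  ultimately have "dim W = dim (UNIV :: (real^'d) set)" using dim by (simp add: Fx_def)
  then obtain \<iota> \<pi> where \<iota>: "linear \<iota>" "\<iota> ` (UNIV :: (real^'d) set) = W"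
     "\<And>x. \<pi> (\<iota> x) = x"
    using isometries_subspaces[OF subspace_UNIV subW] by (metis UNIV_I)
  have inj\<iota>: "inj \<iota>" using \<iota>(3) by (metis injI)
  \<comment> \<open>Base point of the plane \<open>c + W\<close>, on which each \<open>E k\<close>
    takes the value \<open>h k x0\<close>; by \<open>EG\<close> the map \<open>G\<close> carries the
    level set near \<open>x0\<close> into this plane.\<close>
  define c where "c = (\<Sum>k<n. h k x0 *\<^sub>R D k)"
  have cF: "\<sigma> c = c" by (simp add: c_def linear_sum[OF \<sigma>(1)] linear_scale[OF \<sigma>(1)] \<sigma>D)
  have Ec: "E k \<bullet> c = h k x0" if "k < n" for k
    using that by (simp add: c_def inner_sum_right D if_distrib[of "(*) _"] cong: if_cong)
  define T where "T = (\<lambda>x. \<iota> x + c)"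
  define U where "U = T -` V"
  have contT: "continuous_on UNIV T"
    unfolding T_def by (intro continuous_intros linear_continuous_on linear_conv_bounded_linear[THEN iffD1] \<iota>)
  have "open U" unfolding U_def using V contT by (simp add: continuous_on_open_vimage)
  define \<phi> where "\<phi> = g \<circ> T"
  define \<phi>' where "\<phi>' = (\<lambda>x. g' (T x) \<circ> \<iota>)"
  let ?S = "{x. \<sigma> x = x \<and> (\<forall>k<n. h k x = h k x0)}"
  have TU: "T x \<in> V" if "x \<in> U" for x using that by (simp add: U_def)
  have der\<phi>: "(\<phi> has_derivative \<phi>' x) (at x)" if "x \<in> U" for x
    unfolding \<phi>_def \<phi>'_def
  proof (rule diff_chain_at)
    show "(T has_derivative \<iota>) (at x)" unfolding T_def
      using \<iota>(1) by (auto intro!: derivative_eq_intros linear_imp_has_derivative)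
  qed (use derg TU that in auto)
  have T\<sigma>: "\<sigma> (T x) = T x" for x
  proof -
    have "\<iota> x \<in> Fx" using \<iota>(2) by (auto simp: W_def)
    then show ?thesis by (simp add: T_def linear_add[OF \<sigma>(1)] cF Fx_def)
  qed
  \<comment> \<open>The ball is stable under \<sigma>, an isometry fixing \<open>x0\<close>. Hence
    \<open>a\<close> and \<open>\<sigma> a\<close> both lie where \<open>G\<close> is injective, and
    equality of their images gives \<open>\<sigma> a = a\<close>.\<close>
  have sb: "\<sigma> x \<in> ball x0 e" if "x \<in> ball x0 e" for x
    using that \<sigma>(3)[of "x0 - x"] by (simp add: linear_diff[OF \<sigma>(1)] \<sigma>0 dist_norm)
  have im: "\<phi> ` U = ball x0 e \<inter> ?S"
  proof (intro set_eqI iffI)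
    fix a assume "a \<in> \<phi> ` U"
    then obtain x where x: "x \<in> U" and a: "a = g (T x)" by (auto simp: \<phi>_def)
    have ab: "a \<in> ball x0 e" and Ga: "G a = T x" using Gg TU[OF x] a by auto
    have "G (\<sigma> a) = G a" by (simp add: G\<sigma> Ga T\<sigma>)
    then have "\<sigma> a = a" using gG[OF ab] gG[OF sb[OF ab]] by simp
    moreover have "h k a = h k x0" if "k < n" for k
    proof -
      have "E k \<bullet> \<iota> x = 0" using \<iota>(2) WE that by blast
      then show ?thesis using EG[OF that, of a] Ec[OF that] by (simp add: Ga T_def inner_add_right)
    qed
    ultimately show "a \<in> ball x0 e \<inter> ?S" using ab by simp
  next
    fix a assume "a \<in> ball x0 e \<inter> ?S"
    then have ab: "a \<in> ball x0 e" and as: "\<sigma> a = a" and ah: "\<And>k. k < n \<Longrightarrow> h k a = h k x0" by auto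
    have "G a - c \<in> W"
      unfolding WE using G\<sigma>[of a] EG ah Ec
      by (simp add: Fx_def linear_diff[OF \<sigma>(1)] cF as inner_diff_right)
    then obtain x where x: "G a - c = \<iota> x" using \<iota>(2) by blast
    then have "T x = G a" by (simp add: T_def algebra_simps flip: x)
    then show "a \<in> \<phi> ` U"
      using GV[OF ab] gG[OF ab] by (force simp: \<phi>_def U_def image_iff)
  qed
  have inj\<phi>: "inj_on \<phi> U"
  proof (rule inj_onI)
    fix x y assume xy: "x \<in> U" "y \<in> U" "\<phi> x = \<phi> y"
    then have "T x = T y" using Gg(1)[OF TU] by (metis \<phi>_def comp_apply)
    then show "x = y" using inj\<iota> by (simp add: T_def inj_eq)
  qed
  have "continuous_on U (\<lambda>x. \<phi>' x v)" for v
    unfolding \<phi>'_def comp_def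
    by (rule continuous_on_compose2[OF contg'[of "\<iota> v"]])
      (use continuous_on_subset[OF contT, of U] TU in auto)
  moreover have "inj (\<phi>' x)" if "x \<in> U" for x
    unfolding \<phi>'_def using injg'[OF TU[OF that]] inj\<iota> by (rule inj_compose)
  ultimately have "parametrization ?S U \<phi> \<phi>'"
    unfolding parametrization_def using \<open>open U\<close> im inj\<phi> der\<phi> by auto
  then show thesis using that[OF e _ im] by blast
qed

text \<open>Lindelof reduces the balls to countably many; made disjoint, they cut \<open>B\<close>
  into pieces that each lie in a single ball, and countable additivity sums the pieces. This is the
  gluing step for a measure that is known only chart by chart.\<close>

lemma measure_eqI_locally:
  fixes S :: "'a::euclidean_space set"
  assumes sets: "sets \<mu> = sets (restrict_space borel S)" "sets \<nu> = sets (restrict_space borel S)"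
    and loc: "\<And>x. x \<in> S \<Longrightarrow> \<exists>e>0. \<forall>B\<in>sets \<mu>. emeasure \<mu> (B \<inter> ball x e) = emeasure \<nu> (B \<inter> ball x e)"
  shows "\<mu> = \<nu>"
proof (rule measure_eqI)
  show "sets \<mu> = sets \<nu>" by (simp add: sets)
  fix B assume B: "B \<in> sets \<mu>"
  obtain e where e: "\<And>x. x \<in> S \<Longrightarrow> e x > 0"
    and eq: "\<And>x B. x \<in> S \<Longrightarrow> B \<in> sets \<mu> \<Longrightarrow> emeasure \<mu> (B \<inter> ball x (e x)) = emeasure \<nu> (B \<inter> ball x (e x))"
    using loc by metis
  obtain \<F> where \<F>: "\<F> \<subseteq> (\<lambda>x. ball x (e x)) ` S" "countable \<F>" "\<Union>\<F> = (\<Union>x\<in>S. ball x (e x))"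
    using Lindelof[of "(\<lambda>x. ball x (e x)) ` S"] by auto
  have BS: "B \<subseteq> S" using B sets by (auto simp: sets_restrict_space)
  have cov: "S \<subseteq> \<Union>\<F>" unfolding \<F>(3) using e by force
  show "emeasure \<mu> B = emeasure \<nu> B"
  proof (cases "\<F> = {}")
    case True then show ?thesis using cov BS by auto
  next
    case False
    define A where "A = from_nat_into \<F>"
    have A: "A i \<in> \<F>" for i using False by (simp add: A_def from_nat_into)
    have rangeA: "range A = \<F>" unfolding A_def using False \<F>(2) by (rule range_from_nat_into)
    have Ab: "A i \<in> sets borel" for i using A[of i] \<F>(1) by auto
    have dA: "disjointed A i \<in> sets borel" for i
      using sets.range_disjointed_sets[of A borel] Ab by auto
    have BA: "B \<inter> disjointed A i \<in> sets \<mu>" for i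
    proof -
      obtain C where C: "C \<in> sets borel" "B = S \<inter> C" using B by (auto simp: sets sets_restrict_space)
      then have "B \<inter> disjointed A i = S \<inter> (C \<inter> disjointed A i)" by blast
      then show ?thesis using C(1) dA[of i] by (auto simp: sets sets_restrict_space)
    qed
    have each: "emeasure \<mu> (B \<inter> disjointed A i) = emeasure \<nu> (B \<inter> disjointed A i)" for i
    proof -
      obtain x where x: "x \<in> S" "A i = ball x (e x)" using A[of i] \<F>(1) by auto
      have "B \<inter> disjointed A i = (B \<inter> disjointed A i) \<inter> ball x (e x)"
        using disjointed_subset[of A i] x by auto
      then show ?thesis using eq[OF x(1) BA[of i]] by simp
    qed
    have dj: "disjoint_family (\<lambda>i. B \<inter> disjointed A i)"
      using disjoint_family_disjointed[of A] by (auto simp: disjoint_family_on_def)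
    have un: "(\<Union>i. B \<inter> disjointed A i) = B"
    proof -
      have "(\<Union>i. B \<inter> disjointed A i) = B \<inter> (\<Union>i. A i)"
        using UN_disjointed_eq[of A] by (simp flip: Int_UN_distrib)
      also have "\<dots> = B" using cov BS rangeA by blast
      finally show ?thesis .
    qed
    have BAr: "range (\<lambda>i. B \<inter> disjointed A i) \<subseteq> sets \<mu>" using BA by blast
    have BAr': "range (\<lambda>i. B \<inter> disjointed A i) \<subseteq> sets \<nu>" using BAr by (simp only: sets)
    have "emeasure \<mu> B = (\<Sum>i. emeasure \<mu> (B \<inter> disjointed A i))"
      using suminf_emeasure[OF BAr dj] by (simp only: un)
    also have "\<dots> = (\<Sum>i. emeasure \<nu> (B \<inter> disjointed A i))" by (simp add: each)
    also have "\<dots> = emeasure \<nu> B"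
      using suminf_emeasure[OF BAr' dj] by (simp only: un)
    finally show ?thesis .
  qed
qed

subsection \<open>Complex matrices and Casimirs\<close>

text \<open>The Hermitian adjoint. Its negative is a real-linear isometric involution whose
  trace-zero fixed points form \<open>su\<close>; it is the \<sigma> to which the chart lemma will
  be applied.\<close>

definition dag :: "'n::finite cmat \<Rightarrow> 'n cmat" where
  "dag A = (\<chi> i j. cnj (A $ j $ i))"

lemma matrix_mult_nth: "(A ** B) $ i $ j = (\<Sum>k\<in>UNIV. A $ i $ k * B $ k $ j)"
  by (simp add: matrix_matrix_mult_def)

lemma dag_nth [simp]: "dag A $ i $ j = cnj (A $ j $ i)"
  by (simp add: dag_def)

lemma cscale_nth [simp]: "cscale c A $ i $ j = c * A $ i $ j"
  by (simp add: cscale_def)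

lemma transpose_nth [simp]: "transpose A $ i $ j = A $ j $ i"
  by (simp add: transpose_def)

lemma dag_dag [simp]: "dag (dag A) = A" by (simp add: vec_eq_iff)
lemma dag_add: "dag (A + B) = dag A + dag B" by (simp add: vec_eq_iff)
lemma dag_diff: "dag (A - B) = dag A - dag B" by (simp add: vec_eq_iff)
lemma dag_minus: "dag (- A) = - dag A" by (simp add: vec_eq_iff)
lemma dag_scaleR: "dag (c *\<^sub>R A) = c *\<^sub>R dag A" by (simp add: vec_eq_iff)
lemma dag_cscale: "dag (cscale c A) = cscale (cnj c) (dag A)" by (simp add: vec_eq_iff)
lemma dag_mult: "dag (A ** B) = dag B ** dag A"
  by (simp add: vec_eq_iff matrix_mult_nth mult.commute)
lemma dag_mat_1 [simp]: "dag (mat 1) = mat 1" by (auto simp: vec_eq_iff mat_def)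

lemma cscale_0 [simp]: "cscale 0 A = 0" by (simp add: vec_eq_iff)
lemma cscale_1 [simp]: "cscale 1 A = A" by (simp add: vec_eq_iff)
lemma cscale_cscale: "cscale a (cscale b A) = cscale (a * b) A" by (simp add: vec_eq_iff)
lemma cscale_mult_left: "cscale c A ** B = cscale c (A ** B)"
  by (simp add: vec_eq_iff matrix_mult_nth sum_distrib_left mult.assoc)
lemma cscale_mult_right: "A ** cscale c B = cscale c (A ** B)"
  by (simp add: vec_eq_iff matrix_mult_nth sum_distrib_left mult_ac)
lemma cscale_add: "cscale c (A + B) = cscale c A + cscale c B" by (simp add: vec_eq_iff algebra_simps)
lemma cscale_minus_left: "cscale (- c) A = - cscale c A" by (simp add: vec_eq_iff)
lemma cscale_minus_right: "cscale c (- A) = - cscale c A" by (simp add: vec_eq_iff)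
lemma cscale_of_real: "cscale (of_real c) A = c *\<^sub>R A" by (simp add: vec_eq_iff scaleR_conv_of_real[where 'a=complex])
lemma cscale_scaleR: "cscale c (a *\<^sub>R A) = a *\<^sub>R cscale c A"
  by (simp add: vec_eq_iff scaleR_conv_of_real[where 'a=complex])
lemma cscale_matrix_vector: "cscale c A *v v = c *s (A *v v)"
  by (simp add: vec_eq_iff matrix_vector_mult_def sum_distrib_left mult_ac)

lemma matrix_diff_ldistrib: "A ** (B - C) = A ** B - A ** (C :: 'a::ring_1^'n^'m)"
  by (simp add: vec_eq_iff matrix_mult_nth algebra_simps sum_subtractf)
lemma matrix_diff_rdistrib: "(A - B) ** C = A ** C - B ** (C :: 'a::ring_1^'n^'m)"
  by (simp add: vec_eq_iff matrix_mult_nth algebra_simps sum_subtractf)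
lemma matrix_add_rdistrib: "(A + B) ** C = A ** C + B ** (C :: 'a::semiring_1^'n^'m)"
  by (simp add: vec_eq_iff matrix_mult_nth algebra_simps sum.distrib)
lemma matrix_minus_left: "(- A) ** B = - (A ** (B :: 'a::ring_1^'n^'m))"
  by (simp add: vec_eq_iff matrix_mult_nth sum_negf)
lemma matrix_minus_right: "A ** (- B) = - (A ** (B :: 'a::ring_1^'n^'m))"
  by (simp add: vec_eq_iff matrix_mult_nth sum_negf)

lemma trace_cscale: "trace (cscale c A) = c * trace A"
  by (simp add: trace_def sum_distrib_left)
lemma trace_minus: "trace (- A) = - trace (A :: 'a::ring_1^'n^'n)"
  by (simp add: trace_def sum_negf)
lemma trace_dag: "trace (dag A) = cnj (trace A)" by (simp add: trace_def)
lemma trace_transpose: "trace (transpose A) = trace A" by (simp add: trace_def)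
lemma trace_scaleR: "trace (c *\<^sub>R A) = c *\<^sub>R trace (A :: 'n::finite cmat)"
  by (simp add: trace_def scaleR_sum_right)

text \<open>The Euclidean product of the matrix type is the real Frobenius product, so gradients can
  be computed through traces; on \<open>su\<close> it agrees with \<open>su_inner\<close>.\<close>

lemma inner_cmat: "A \<bullet> B = Re (trace (dag A ** B))" for A B :: "'n::finite cmat"
proof -
  have "A \<bullet> B = (\<Sum>i\<in>UNIV. \<Sum>j\<in>UNIV. Re (cnj (A $ i $ j) * B $ i $ j))"
    by (simp add: inner_vec_def inner_complex_def)
  also have "\<dots> = (\<Sum>j\<in>UNIV. \<Sum>i\<in>UNIV. Re (cnj (A $ i $ j) * B $ i $ j))" by (rule sum.swap)
  also have "\<dots> = Re (trace (dag A ** B))" by (simp add: trace_def matrix_mult_nth)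
  finally show ?thesis .
qed

lemma mat_pow_0 [simp]: "mat_pow A 0 = mat 1" by (simp add: mat_pow_def)
lemma mat_pow_Suc: "mat_pow A (Suc n) = A ** mat_pow A n" by (simp add: mat_pow_def)
lemma mat_pow_commute: "A ** B = B ** A \<Longrightarrow> mat_pow A n ** B = B ** mat_pow A n"
proof (induction n)
  case (Suc n)
  have "mat_pow A (Suc n) ** B = A ** (mat_pow A n ** B)" by (simp add: mat_pow_Suc matrix_mul_assoc)
  also have "\<dots> = B ** mat_pow A (Suc n)"
    using Suc by (simp add: mat_pow_Suc matrix_mul_assoc)
  finally show ?case .
qed simp
lemma mat_pow_Suc': "mat_pow A (Suc n) = mat_pow A n ** A"
  by (simp add: mat_pow_Suc mat_pow_commute)
lemma mat_pow_add: "mat_pow A (m + n) = mat_pow A m ** mat_pow A n"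
  by (induction m) (simp_all add: mat_pow_Suc matrix_mul_assoc)

lemma dag_mat_pow: "dag (mat_pow A n) = mat_pow (dag A) n"
  by (induction n) (simp_all add: mat_pow_Suc dag_mult flip: mat_pow_Suc')
lemma transpose_mat_pow: "transpose (mat_pow A n) = mat_pow (transpose A) n" for A :: "'n::finite cmat"
  by (induction n) (simp_all add: mat_pow_Suc matrix_transpose_mul flip: mat_pow_Suc')
lemma mat_pow_minus: "mat_pow (- A) n = cscale ((-1) ^ n) (mat_pow A n)"
  by (induction n) (simp_all add: mat_pow_Suc matrix_minus_left cscale_mult_right cscale_minus_left cscale_minus_right)

lemma trace_mat_pow_antihermitian_involution:
  "trace (mat_pow (- dag A) n) = (-1) ^ n * cnj (trace (mat_pow A n))"
  by (simp add: mat_pow_minus trace_cscale trace_dag flip: dag_mat_pow)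

definition diagm :: "('n \<Rightarrow> complex) \<Rightarrow> 'n::finite cmat" where
  "diagm d = (\<chi> i j. if i = j then d i else 0)"

lemma mult_diagm_nth: "(A ** diagm d) $ i $ j = A $ i $ j * d j"
  by (simp add: matrix_mult_nth diagm_def if_distrib[of "(*) _"] cong: if_cong)

lemma diagm_mult_nth: "(diagm d ** A) $ i $ j = d i * A $ i $ j"
  by (simp add: matrix_mult_nth diagm_def if_distrib[of "\<lambda>x. x * _"] cong: if_cong)

lemma mat_pow_diagm: "mat_pow (diagm d) k = diagm (\<lambda>i. d i ^ k)"
proof (induction k)
  case 0 then show ?case by (auto simp: vec_eq_iff diagm_def mat_def)
next
  case (Suc k)
  then show ?case by (auto simp: vec_eq_iff mat_pow_Suc diagm_mult_nth) (auto simp: diagm_def)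
qed

lemma bounded_bilinear_matrix_mult: "bounded_bilinear ((**) :: 'n::finite cmat \<Rightarrow> 'n cmat \<Rightarrow> 'n cmat)"
  unfolding bilinear_conv_bounded_bilinear[symmetric] bilinear_def
  by (auto intro!: linearI simp: matrix_add_ldistrib matrix_add_rdistrib matrix_scalar_ac scalar_matrix_assoc)

lemma bounded_linear_trace: "bounded_linear (trace :: 'n::finite cmat \<Rightarrow> complex)"
  unfolding linear_conv_bounded_linear[symmetric]
  by (auto intro!: linearI simp: trace_add trace_scaleR)

lemma bounded_linear_cscale: "bounded_linear (cscale c :: 'n::finite cmat \<Rightarrow> 'n cmat)"
  unfolding linear_conv_bounded_linear[symmetric]
  by (auto intro!: linearI simp: cscale_add cscale_scaleR)

lemma bounded_linear_dag: "bounded_linear (dag :: 'n::finite cmat \<Rightarrow> 'n cmat)"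
  unfolding linear_conv_bounded_linear[symmetric]
  by (auto intro!: linearI simp: dag_add dag_scaleR)

lemma linear_dag: "linear (dag :: 'n::finite cmat \<Rightarrow> 'n cmat)"
  using bounded_linear_dag linear_conv_bounded_linear by blast

lemma linear_minus_dag: "linear (\<lambda>A :: 'n::finite cmat. - dag A)"
  by (rule linear_compose_neg[OF linear_dag])

lemma bounded_linear_transpose: "bounded_linear (transpose :: 'n::finite cmat \<Rightarrow> 'n cmat)"
  unfolding linear_conv_bounded_linear[symmetric]
  by (auto intro!: linearI simp: vec_eq_iff)

lemmas continuous_on_matrix_mult = bounded_bilinear.continuous_on[OF bounded_bilinear_matrix_mult]

lemma continuous_on_mat_pow: "continuous_on S f \<Longrightarrow> continuous_on S (\<lambda>x. mat_pow (f x) n :: 'n::finite cmat)"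
  by (induction n) (auto simp: mat_pow_Suc intro!: continuous_on_matrix_mult)

section \<open>Derivatives of traces of powers and the real Casimirs\<close>

primrec mat_pow_deriv :: "'n::finite cmat \<Rightarrow> nat \<Rightarrow> 'n cmat \<Rightarrow> 'n cmat" where
  "mat_pow_deriv A 0 B = 0"
| "mat_pow_deriv A (Suc n) B = A ** mat_pow_deriv A n B + B ** mat_pow A n"

lemma has_derivative_mat_pow: "((\<lambda>A. mat_pow A n) has_derivative mat_pow_deriv A n) (at A)"
proof (induction n)
  case 0
  have "mat_pow_deriv A 0 = (\<lambda>_. 0)" by auto
  then show ?case by (simp add: has_derivative_const)
next
  case (Suc n)
  have eq: "mat_pow_deriv A (Suc n) = (\<lambda>B. A ** mat_pow_deriv A n B + B ** mat_pow A n)" by auto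
  show ?case unfolding mat_pow_Suc eq
    by (rule bounded_bilinear.FDERIV[OF bounded_bilinear_matrix_mult has_derivative_ident Suc])
qed

text \<open>The product rule places \<open>B\<close> at every position among the non-commuting
  factors, and cyclicity of the trace makes all \<open>Suc n\<close> contributions equal. The
  prefactor \<open>mat_pow A m\<close> absorbs the factor split off in each induction step; only
  \<open>m = 0\<close> is needed afterwards.\<close>

lemma trace_mat_pow_deriv:
  "trace (mat_pow A m ** mat_pow_deriv A (Suc n) B) = of_nat (Suc n) * trace (mat_pow A (m + n) ** B)"
proof (induction n arbitrary: m)
  case 0 show ?case by simp
next
  case (Suc n)
  have "trace (mat_pow A m ** mat_pow_deriv A (Suc (Suc n)) B)
     = trace (mat_pow A (Suc m) ** mat_pow_deriv A (Suc n) B) + trace (mat_pow A m ** (B ** mat_pow A (Suc n)))"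
    by (simp only: mat_pow_deriv.simps(2)[of A "Suc n"] matrix_add_ldistrib trace_add mat_pow_Suc' matrix_mul_assoc)
  also have "trace (mat_pow A m ** (B ** mat_pow A (Suc n))) = trace ((mat_pow A (Suc n) ** mat_pow A m) ** B)"
    using trace_mul_sym[of "mat_pow A m ** B" "mat_pow A (Suc n)"] by (simp only: matrix_mul_assoc)
  also have "\<dots> = trace (mat_pow A (m + Suc n) ** B)" by (simp only: mat_pow_add[symmetric] add.commute)
  finally show ?case using Suc[of "Suc m"] by (simp add: algebra_simps)
qed

text \<open>For anti-Hermitian \<open>A\<close> the number \<open>\<i>\<^sup>n tr A\<^sup>n\<close> is real, so nothing is lost by taking the real
  part; dividing by \<open>n\<close> makes \<open>casimir_grad\<close> the gradient for the real inner product of matrices.\<close>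

definition casimir_fun :: "nat \<Rightarrow> 'n::finite cmat \<Rightarrow> real" where
  "casimir_fun k A = - Re (\<i> ^ Suc k * trace (mat_pow A (Suc k))) / Suc k"

definition casimir_grad :: "nat \<Rightarrow> 'n::finite cmat \<Rightarrow> 'n cmat" where
  "casimir_grad k A = - dag (cscale (\<i> ^ Suc k) (mat_pow A k))"

lemma inner_casimir_grad: "casimir_grad k A \<bullet> B = - Re (\<i> ^ Suc k * trace (mat_pow A k ** B))"
  by (simp only: inner_cmat casimir_grad_def dag_minus dag_dag matrix_minus_left cscale_mult_left
      trace_minus trace_cscale uminus_complex.simps)

lemma has_derivative_casimir_fun:
  fixes A :: "'n::finite cmat"
  shows "(casimir_fun k has_derivative (\<lambda>B. casimir_grad k A \<bullet> B)) (at A)"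
proof -
  have d: "((\<lambda>A. trace (mat_pow A (Suc k))) has_derivative (\<lambda>B. trace (mat_pow_deriv A (Suc k) B))) (at A)"
    by (rule bounded_linear.has_derivative[OF bounded_linear_trace has_derivative_mat_pow])
  have e: "trace (mat_pow_deriv A (Suc k) B) = of_nat (Suc k) * trace (mat_pow A k ** B)" for B
    using trace_mat_pow_deriv[of A 0 k B] by (simp only: mat_pow_0 matrix_mul_lid add_0)
  have f: "((\<lambda>A. - Re (c * t A) / r) has_derivative (\<lambda>B. - Re (c * t' B) / r)) (at A)"
    if "(t has_derivative t') (at A)" for t t' :: "'n cmat \<Rightarrow> complex" and c r
    unfolding divide_inverse using that by (auto intro!: derivative_eq_intros)
  have g: "- Re (c * (of_nat (Suc k) * y)) / real (Suc k) = - Re (c * y)" for c y :: complex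
  proof -
    have "c * (of_nat (Suc k) * y) = real (Suc k) *\<^sub>R (c * y)" by (simp add: scaleR_conv_of_real)
    then show ?thesis by (simp del: of_nat_Suc)
  qed
  show ?thesis
    using f[OF d, of "\<i> ^ Suc k" "real (Suc k)"]
    unfolding casimir_fun_def[abs_def] inner_casimir_grad e g .
qed

lemma continuous_on_casimir_grad: "continuous_on UNIV (casimir_grad k :: 'n::finite cmat \<Rightarrow> _)"
  unfolding casimir_grad_def[abs_def]
  by (intro continuous_on_minus bounded_linear.continuous_on[OF bounded_linear_dag]
      bounded_linear.continuous_on[OF bounded_linear_cscale] continuous_on_mat_pow continuous_on_id)

lemma mem_su_iff: "A \<in> su \<longleftrightarrow> trace A = 0 \<and> - dag A = A"
proof -
  have "- dag A = A \<longleftrightarrow> (\<forall>i j. - cnj (A $ j $ i) = A $ i $ j)"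
    by (simp add: vec_eq_iff)
  then show ?thesis unfolding su_def mem_Collect_eq by metis
qed

lemma i_power_real_if: "(-1) ^ n * cnj x = x \<Longrightarrow> Im (\<i> ^ n * x) = 0"
proof -
  assume *: "(-1) ^ n * cnj x = x"
  have "cnj (\<i> ^ n * x) = (- \<i>) ^ n * cnj x" by simp
  also have "(- \<i>) ^ n = (-1) ^ n * \<i> ^ n" by (metis mult_minus1 power_mult_distrib)
  also have "(-1) ^ n * \<i> ^ n * cnj x = \<i> ^ n * x" using * by (metis mult.assoc mult.commute)
  finally show ?thesis by (metis Reals_cnj_iff complex_is_Real_iff)
qed

text \<open>The involution conjugates the number whose real part is taken. The chart lemma needs
  this symmetry on all matrices and not just at anti-Hermitian ones.\<close>

lemma casimir_fun_involution: "casimir_fun k (- dag A) = casimir_fun k A"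
proof -
  have "\<i> ^ Suc k * ((-1) ^ Suc k * cnj (trace (mat_pow A (Suc k)))) = cnj (\<i> ^ Suc k * trace (mat_pow A (Suc k)))"
    by (simp only: complex_cnj_mult complex_cnj_power complex_cnj_i mult.assoc[symmetric] power_mult_distrib[symmetric]) simp
  then show ?thesis unfolding casimir_fun_def trace_mat_pow_antihermitian_involution by (simp only: cnj.simps)
qed

lemma trace_mat_pow_eq_iff:
  assumes "- dag A = A" "- dag B = B"
  shows "trace (mat_pow A (Suc k)) = trace (mat_pow B (Suc k)) \<longleftrightarrow> casimir_fun k A = casimir_fun k B"
proof -
  have "Im (\<i> ^ Suc k * trace (mat_pow A (Suc k))) = 0" "Im (\<i> ^ Suc k * trace (mat_pow B (Suc k))) = 0"
    using trace_mat_pow_antihermitian_involution[of A "Suc k"] trace_mat_pow_antihermitian_involution[of B "Suc k"]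
    by (simp_all only: assms i_power_real_if)
  then have "casimir_fun k A = casimir_fun k B \<longleftrightarrow>
     \<i> ^ Suc k * trace (mat_pow A (Suc k)) = \<i> ^ Suc k * trace (mat_pow B (Suc k))"
    by (auto simp: casimir_fun_def complex_eq_iff simp del: power_Suc)
  then show ?thesis by (simp del: power_Suc)
qed

text \<open>The index \<open>k < N\<close> stands for the power \<open>k + 1\<close>: the condition
  that the trace be 0 is absorbed as the case \<open>k = 0\<close>. This gives the shape that
  \<open>level_set_chart\<close> expects, the fixed points of an involution cut out by N
  functions.\<close>

lemma orbit_eq_level_set:
  fixes \<Omega> :: "'n::finite cmat"
  assumes "\<Omega> \<in> orbit z"
  shows "orbit z = {A :: 'n cmat. - dag A = A \<and> (\<forall>k<CARD('n). casimir_fun k A = casimir_fun k \<Omega>)}"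
proof (intro set_eqI)
  fix A :: "'n cmat"
  have O: "trace \<Omega> = 0" "- dag \<Omega> = \<Omega>" and z: "casimirs \<Omega> = z"
    using assms by (auto simp: orbit_def mem_su_iff)
  have "A \<in> orbit z \<longleftrightarrow> - dag A = A \<and> trace A = trace \<Omega> \<and>
      (\<forall>k\<in>{2..CARD('n)}. trace (mat_pow A k) = trace (mat_pow \<Omega> k))"
    unfolding z[symmetric] orbit_def mem_su_iff casimirs_def O(1) by (auto simp: fun_eq_iff)
  also have "\<dots> \<longleftrightarrow> - dag A = A \<and> (\<forall>k<CARD('n). trace (mat_pow A (Suc k)) = trace (mat_pow \<Omega> (Suc k)))"
  proof -
    have "{1..CARD('n)} = Suc ` {..<CARD('n)}" by (simp add: image_Suc_lessThan)
    then have "(\<forall>k<CARD('n). trace (mat_pow A (Suc k)) = trace (mat_pow \<Omega> (Suc k))) \<longleftrightarrow>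
       (\<forall>k\<in>{1..CARD('n)}. trace (mat_pow A k) = trace (mat_pow \<Omega> k))"
      by (simp, simp add: Ball_def)
    also have "{1..CARD('n)} = insert 1 {2..CARD('n)}" by (auto simp: Suc_le_eq)
    finally show ?thesis by (auto simp: mat_pow_def)
  qed
  also have "\<dots> \<longleftrightarrow> - dag A = A \<and> (\<forall>k<CARD('n). casimir_fun k A = casimir_fun k \<Omega>)"
    using trace_mat_pow_eq_iff[OF _ O(2)] by blast
  finally show "A \<in> orbit z \<longleftrightarrow> A \<in> {A. - dag A = A \<and> (\<forall>k<CARD('n). casimir_fun k A = casimir_fun k \<Omega>)}"
    by simp
qed

text \<open>The orthogonal complement consists of the Hermitian matrices, which are \<i> times the
  anti-Hermitian ones. Both spaces thus have half of the real dimension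
  \<open>2 * N * N\<close>.\<close>

lemma dim_antihermitian: "dim {A :: 'n::finite cmat. - dag A = A} = CARD('n) * CARD('n)"
proof -
  let ?F = "{A :: 'n cmat. - dag A = A}"
  have "?F = {A. (\<lambda>A. A + dag A) A = 0}" by (auto simp: add_eq_0_iff2)
  then have subF: "subspace ?F"
    using linear_subspace_kernel[OF linear_compose_add[OF linear_id linear_dag]] by (simp add: id_def)
  let ?H = "{y \<in> UNIV. \<forall>x\<in>?F. orthogonal x y}"
  have d: "dim ?H + dim ?F = dim (UNIV :: 'n cmat set)"
    by (rule dim_subspace_orthogonal_to_vectors[OF subF subspace_UNIV]) simp
  have "?H = cscale \<i> ` ?F"
  proof (intro set_eqI iffI)
    fix y assume y: "y \<in> ?H"
    let ?a = "y - dag y"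
    have a: "- dag ?a = ?a" by (simp add: dag_diff)
    have a': "dag ?a = - ?a" by (simp add: dag_diff)
    from a have "?a \<bullet> y = 0" using y by (auto simp: orthogonal_def)
    have "?a \<bullet> dag y = - (?a \<bullet> y)"
    proof -
      have "trace (dag ?a ** dag y) = cnj (trace (y ** ?a))"
        by (simp only: trace_dag[symmetric] dag_mult)
      also have "Re \<dots> = - Re (trace (dag ?a ** y))"
        unfolding a' by (simp only: cnj.simps trace_mul_sym[of y] matrix_minus_left trace_minus uminus_complex.simps minus_minus)
      finally show ?thesis by (simp add: inner_cmat)
    qed
    then have "?a \<bullet> ?a = 0" using \<open>?a \<bullet> y = 0\<close> by (simp add: inner_diff_right)
    then have "dag y = y" by simp
    then show "y \<in> cscale \<i> ` ?F"
      by (intro image_eqI[of _ _ "cscale (- \<i>) y"]) (simp_all add: cscale_cscale dag_cscale dag_minus cscale_minus_left cscale_minus_right)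
  next
    fix y assume "y \<in> cscale \<i> ` ?F"
    then obtain b where b: "- dag b = b" "y = cscale \<i> b" by auto
    have "x \<bullet> y = 0" if x: "- dag x = x" for x
    proof -
      have "cnj (trace (dag x ** b)) = trace (dag b ** x)" by (simp add: dag_mult flip: trace_dag)
      also have "\<dots> = trace (dag x ** b)"
        using x b(1) by (metis trace_mul_sym matrix_minus_left matrix_minus_right)
      finally have "Im (trace (dag x ** b)) = 0" by (simp add: complex_eq_iff)
      then show ?thesis by (simp add: inner_cmat b(2) cscale_mult_right trace_cscale)
    qed
    then show "y \<in> ?H" by (auto simp: orthogonal_def)
  qed
  moreover have "dim (cscale \<i> ` ?F) = dim ?F"
  proof (rule dim_image_eq)
    show "linear (cscale \<i> :: 'n cmat \<Rightarrow> _)" using bounded_linear_cscale linear_conv_bounded_linear by blast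
    show "inj_on (cscale \<i>) (span ?F)" by (auto simp: inj_on_def vec_eq_iff)
  qed
  ultimately show ?thesis using d by simp
qed

section \<open>Transposition and commutators on su(N)\<close>

lemma transpose_minus: "transpose (- A) = - transpose (A :: 'n::finite cmat)"
  by (simp add: vec_eq_iff)

lemma transpose_diff: "transpose (A - B) = transpose A - transpose (B :: 'n::finite cmat)"
  by (simp add: vec_eq_iff)

lemma transpose_comm: "transpose (comm A B) = - comm (transpose A) (transpose B)"
  by (simp add: comm_def transpose_diff matrix_transpose_mul)

lemma comm_minus_left: "comm (- A) B = - comm A B"
  by (simp add: comm_def matrix_minus_left matrix_minus_right)

lemma comm_minus_right: "comm A (- B) = - comm A B"
  by (simp add: comm_def matrix_minus_left matrix_minus_right)

lemma transpose_dag: "transpose (dag A) = dag (transpose A)"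
  by (simp add: vec_eq_iff)

lemma transpose_mem_su: "A \<in> su \<Longrightarrow> transpose A \<in> su"
  unfolding mem_su_iff by (metis transpose_dag transpose_minus trace_transpose)

lemma minus_mem_su: "A \<in> su \<Longrightarrow> - A \<in> su"
  by (auto simp: mem_su_iff dag_minus trace_minus)

lemma transpose_mem_orbit: "A \<in> orbit z \<Longrightarrow> transpose A \<in> orbit z"
  by (auto simp: orbit_def transpose_mem_su casimirs_def trace_transpose simp flip: transpose_mat_pow)

lemma comm_mem_su: "A \<in> su \<Longrightarrow> B \<in> su \<Longrightarrow> comm A B \<in> su"
proof -
  assume "A \<in> su" "B \<in> su"
  then have "dag A = - A" "dag B = - B" unfolding mem_su_iff by (metis minus_minus)+
  then show "comm A B \<in> su"
    by (simp add: mem_su_iff comm_def trace_sub trace_mul_sym[of A] dag_diff dag_mult matrix_minus_left matrix_minus_right)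
qed

lemma subspace_su: "subspace (su :: 'n::finite cmat set)"
proof -
  have su_eq: "su = {A :: 'n cmat. trace A = 0} \<inter> {A. A + dag A = 0}"
    by (auto simp: mem_su_iff add_eq_0_iff2)
  have s1: "subspace {A :: 'n cmat. trace A = 0}"
    using linear_subspace_kernel bounded_linear_trace linear_conv_bounded_linear by blast
  have s2: "subspace {A :: 'n cmat. A + dag A = 0}"
    using linear_subspace_kernel[OF linear_compose_add[OF linear_id linear_dag]] by (simp add: id_def)
  show ?thesis unfolding su_eq by (rule subspace_inter[OF s1 s2])
qed

subsection \<open>Regular orbits and the Liouville measure\<close>

text \<open>The inner product of the type is only the real part of this sesquilinear form, which is
  too little to conclude unitarity over the complex numbers.\<close>

definition herm_prod :: "complex^'n \<Rightarrow> complex^'n::finite \<Rightarrow> complex" where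
  "herm_prod u v = (\<Sum>i\<in>UNIV. cnj (u $ i) * v $ i)"

lemma herm_prod_smult_left: "herm_prod (c *s u) v = cnj c * herm_prod u v"
  by (simp add: herm_prod_def sum_distrib_left mult.assoc)
lemma herm_prod_smult_right: "herm_prod u (c *s v) = c * herm_prod u v"
  by (simp add: herm_prod_def sum_distrib_left mult_ac)

lemma herm_prod_self: "herm_prod v v = of_real ((norm v)\<^sup>2)"
proof -
  have "(norm v)\<^sup>2 = (\<Sum>i\<in>UNIV. (cmod (v $ i))\<^sup>2)"
    unfolding norm_vec_def L2_set_def by (rule real_sqrt_pow2) (simp add: sum_nonneg)
  then show ?thesis by (simp only: herm_prod_def of_real_sum complex_norm_square mult.commute)
qed

lemma herm_prod_matrix: "herm_prod u (A *v v) = herm_prod (dag A *v u) v"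
proof -
  have "herm_prod u (A *v v) = (\<Sum>i\<in>UNIV. \<Sum>j\<in>UNIV. cnj (u $ i) * (A $ i $ j * v $ j))"
    by (simp add: herm_prod_def matrix_vector_mult_def sum_distrib_left)
  also have "\<dots> = (\<Sum>j\<in>UNIV. \<Sum>i\<in>UNIV. cnj (u $ i) * (A $ i $ j * v $ j))" by (rule sum.swap)
  also have "\<dots> = herm_prod (dag A *v u) v"
    by (simp add: herm_prod_def matrix_vector_mult_def sum_distrib_right sum_distrib_left mult_ac)
  finally show ?thesis .
qed

text \<open>With N distinct eigenvalues, one normalized eigenvector for each already gives a unitary
  matrix, since anti-Hermitian symmetry makes eigenvectors of different eigenvalues
  orthogonal.\<close>

lemma antihermitian_regular_diagonalize:
  fixes \<Omega> :: "'n::finite cmat"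
  assumes ah: "- dag \<Omega> = \<Omega>" and reg: "card (eigenvalues \<Omega>) = CARD('n)"
  obtains P l where "dag P ** P = mat 1" "P ** dag P = mat 1" "inj l" "\<And>i. cnj (l i) = - l i"
    "\<Omega> = P ** diagm l ** dag P"
proof -
  have "finite (eigenvalues \<Omega>)" using reg by (metis card.infinite zero_less_card_finite less_irrefl)
  then obtain l where l: "bij_betw l (UNIV :: 'n set) (eigenvalues \<Omega>)"
    using reg by (metis finite finite_same_card_bij)
  have "inj l" using l by (simp add: bij_betw_def)
  have "\<forall>i. \<exists>v. v \<noteq> 0 \<and> \<Omega> *v v = l i *s v"
    using l by (auto simp: bij_betw_def eigenvalues_def)
  then obtain v where v: "\<And>i. v i \<noteq> 0" "\<And>i. \<Omega> *v v i = l i *s v i" by metis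
  define w where "w = (\<lambda>i. of_real (inverse (norm (v i))) *s v i)"
  have w: "\<Omega> *v w i = l i *s w i" for i
    by (simp add: w_def vec.scale v(2) vector_smult_assoc mult.commute)
  have w1: "herm_prod (w i) (w i) = 1" for i
  proof -
    have "herm_prod (w i) (w i) = of_real (inverse (norm (v i))) * (of_real (inverse (norm (v i))) * herm_prod (v i) (v i))"
      by (simp only: w_def herm_prod_smult_left herm_prod_smult_right complex_cnj_complex_of_real)
    moreover have "inverse n * (inverse n * (n * n)) = 1" if "n \<noteq> 0" for n :: complex
      using that by (simp add: field_simps)
    ultimately show ?thesis using v(1)[of i] by (simp only: herm_prod_self power2_eq_square of_real_mult of_real_inverse) simp
  qed
  have dag: "dag \<Omega> = - \<Omega>" using ah by (metis minus_minus)
  \<comment> \<open>Both values of the Hermitian product of \<open>w i\<close> with the image of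
    \<open>w j\<close>. For \<open>i = j\<close> this makes the eigenvalue imaginary, for
    \<open>i \<noteq> j\<close> it makes the vectors orthogonal.\<close>
  have adj: "- (cnj (l i)) * herm_prod (w i) (w j) = l j * herm_prod (w i) (w j)" for i j
  proof -
    have "dag \<Omega> *v w i = (- l i) *s w i"
    proof -
      have "dag \<Omega> = cscale (- 1) \<Omega>" by (simp add: dag cscale_minus_left)
      then show ?thesis by (simp add: cscale_matrix_vector w vector_smult_assoc)
    qed
    then show ?thesis using herm_prod_matrix[of "w i" \<Omega> "w j"]
      by (simp only: w herm_prod_smult_left herm_prod_smult_right complex_cnj_minus)
  qed
  have im: "cnj (l i) = - l i" for i using adj[of i i] by (simp add: w1) (metis minus_minus)
  have orth: "herm_prod (w i) (w j) = (if i = j then 1 else 0)" for i j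
    using adj[of i j] \<open>inj l\<close> by (auto simp: w1 im inj_eq)
  define P :: "'n cmat" where "P = (\<chi> a i. w i $ a)"
  have PP: "dag P ** P = mat 1"
    by (simp add: vec_eq_iff matrix_mult_nth P_def mat_def flip: herm_prod_def) (simp add: orth)
  then have PP': "P ** dag P = mat 1" using matrix_left_right_inverse by blast
  have "\<Omega> ** P = P ** diagm l"
  proof -
    have "(\<Omega> ** P) $ a $ i = (\<Omega> *v w i) $ a" for a i
      by (simp add: matrix_mult_nth P_def matrix_vector_mult_def)
    then show ?thesis by (simp add: vec_eq_iff mult_diagm_nth w) (simp add: P_def mult.commute)
  qed
  then have "\<Omega> = P ** diagm l ** dag P" by (metis PP' matrix_mul_assoc matrix_mul_rid)
  then show thesis using that[OF PP PP' \<open>inj l\<close> im] by blast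
qed

lemma mat_pow_conjugate:
  assumes "dag P ** P = mat 1" "P ** dag P = mat 1"
  shows "mat_pow (P ** A ** dag P) k = P ** mat_pow A k ** dag P"
proof (induction k)
  case 0 show ?case using assms by simp
next
  case (Suc k)
  have "P ** A ** dag P ** (P ** mat_pow A k ** dag P) = P ** A ** (dag P ** P) ** mat_pow A k ** dag P"
    by (simp only: matrix_mul_assoc)
  with Suc assms show ?case by (simp add: mat_pow_Suc matrix_mul_assoc)
qed

text \<open>Vandermonde in polynomial form: a nonzero polynomial of degree below N cannot have N
  distinct roots.\<close>

lemma poly_coeffs_eq_0_if_roots:
  fixes l :: "'n::finite \<Rightarrow> complex"
  assumes "inj l" "\<And>i. (\<Sum>k<CARD('n). a k * l i ^ k) = 0" "k < CARD('n)"
  shows "a k = 0"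
proof -
  define p where "p = (\<Sum>k<CARD('n). monom (a k) k)"
  have ev: "poly p x = (\<Sum>k<CARD('n). a k * x ^ k)" for x by (simp add: p_def poly_sum poly_monom)
  have co: "coeff p j = (if j < CARD('n) then a j else 0)" for j
    by (auto simp: p_def coeff_sum)
  have "p = 0"
  proof (rule ccontr)
    assume p: "p \<noteq> 0"
    have "degree p < CARD('n)"
      using coeff_0_degree_minus_1[of p] leading_coeff_0_iff[of p] p co[of "degree p"] by (metis)
    moreover have "card (range l) \<le> card {x. poly p x = 0}"
      by (rule card_mono[OF poly_roots_finite[OF p]]) (auto simp: ev assms(2))
    moreover have "card (range l) = CARD('n)" using assms(1) by (simp add: card_image)
    ultimately show False using card_poly_roots_bound[OF p] by linarith
  qed
  then show ?thesis using co[of k] assms(3) by simp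
qed

lemma independent_family:
  fixes E :: "nat \<Rightarrow> 'a::euclidean_space"
  assumes "\<And>c. (\<Sum>k<n. c k *\<^sub>R E k) = 0 \<Longrightarrow> \<forall>k<n. c k = 0"
  shows "inj_on E {..<n}" "independent (E ` {..<n})"
proof -
  show inj: "inj_on E {..<n}"
  proof (rule inj_onI, rule ccontr)
    fix i j assume ij: "i \<in> {..<n}" "j \<in> {..<n}" "E i = E j" "i \<noteq> j"
    let ?c = "\<lambda>k. (if k = i then 1 else 0) - (if k = j then 1 else (0::real))"
    have "(\<Sum>k<n. ?c k *\<^sub>R E k) = 0"
      using ij by (simp add: scaleR_diff_left sum_subtractf if_distrib[of "\<lambda>x. x *\<^sub>R _"] cong: if_cong)
    from assms[OF this] ij show False by auto
  qed
  show "independent (E ` {..<n})"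
    unfolding dependent_finite[OF finite_imageI[OF finite_lessThan]]
  proof
    assume "\<exists>u. (\<exists>v\<in>E ` {..<n}. u v \<noteq> 0) \<and> (\<Sum>v\<in>E ` {..<n}. u v *\<^sub>R v) = 0"
    then obtain u v where u: "v \<in> E ` {..<n}" "u v \<noteq> 0" "(\<Sum>v\<in>E ` {..<n}. u v *\<^sub>R v) = 0" by blast
    have "(\<Sum>k<n. u (E k) *\<^sub>R E k) = 0" using u(3) by (simp add: sum.reindex[OF inj])
    from assms[OF this] u show False by auto
  qed
qed

text \<open>Up to adjoint and sign, a real relation between the gradients is a complex polynomial of
  degree below N that annihilates \<Omega>. Diagonalized, it vanishes at N distinct eigenvalues and
  so has no nonzero coefficient.\<close>

lemma casimir_grad_independent:
  fixes \<Omega> :: "'n::finite cmat"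
  assumes ah: "- dag \<Omega> = \<Omega>" and reg: "card (eigenvalues \<Omega>) = CARD('n)"
  shows "inj_on (\<lambda>k. casimir_grad k \<Omega>) {..<CARD('n)}"
    "independent ((\<lambda>k. casimir_grad k \<Omega>) ` {..<CARD('n)})"
proof -
  obtain P l where P: "dag P ** P = mat 1" "P ** dag P = mat 1" and l: "inj l" "\<And>i. cnj (l i) = - l i"
    and O: "\<Omega> = P ** diagm l ** dag P"
    using antihermitian_regular_diagonalize[OF assms] by metis
  have *: "\<forall>k<CARD('n). c k = 0" if "(\<Sum>k<CARD('n). c k *\<^sub>R casimir_grad k \<Omega>) = 0" for c
  proof -
    define a where "a = (\<lambda>k. of_real (c k) * \<i> ^ Suc k)"
    have "0 = dag (\<Sum>k<CARD('n). c k *\<^sub>R casimir_grad k \<Omega>)"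
      by (simp add: that) (simp add: vec_eq_iff)
    also have "\<dots> = - (\<Sum>k<CARD('n). cscale (a k) (mat_pow \<Omega> k))"
      by (simp add: linear_sum[OF linear_dag] dag_scaleR casimir_grad_def dag_minus dag_cscale cscale_minus_right a_def sum_negf
          flip: cscale_of_real cscale_cscale)
    finally have s: "(\<Sum>k<CARD('n). cscale (a k) (mat_pow \<Omega> k)) = 0" by simp
    have "(\<Sum>k<CARD('n). a k * l i ^ k) = 0" for i
    proof -
      have d: "dag P ** (cscale (a k) (mat_pow \<Omega> k)) ** P = cscale (a k) (diagm (\<lambda>i. l i ^ k))" for k
      proof -
        have "dag P ** mat_pow \<Omega> k ** P = (dag P ** P) ** mat_pow (diagm l) k ** (dag P ** P)"
          unfolding O mat_pow_conjugate[OF P] by (simp only: matrix_mul_assoc)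
        then show ?thesis by (simp add: cscale_mult_left cscale_mult_right P mat_pow_diagm)
      qed
      have "bounded_linear (\<lambda>A. dag P ** A ** P)"
        by (intro bounded_linear_compose[OF bounded_bilinear.bounded_linear_left[OF bounded_bilinear_matrix_mult]]
           bounded_bilinear.bounded_linear_right[OF bounded_bilinear_matrix_mult])
      then have "linear (\<lambda>A. dag P ** A ** P)" by (simp add: linear_conv_bounded_linear)
      from linear_sum[OF this, of "\<lambda>k. cscale (a k) (mat_pow \<Omega> k)" "{..<CARD('n)}"]
      have "(\<Sum>k<CARD('n). cscale (a k) (diagm (\<lambda>i. l i ^ k))) = 0"
        by (simp add: s d)
      from arg_cong[OF this, of "\<lambda>A. A $ i $ i"] show ?thesis by (simp add: diagm_def)
    qed
    from poly_coeffs_eq_0_if_roots[OF l(1) this]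
    show ?thesis by (simp add: a_def)
  qed
  show "inj_on (\<lambda>k. casimir_grad k \<Omega>) {..<CARD('n)}"
    by (rule independent_family(1)) (rule *)
  show "independent ((\<lambda>k. casimir_grad k \<Omega>) ` {..<CARD('n)})"
    by (rule independent_family(2)) (rule *)
qed

text \<open>The transposed Vandermonde statement: the moments are combined with the coefficients of
  the polynomial that vanishes at every \<open>l i\<close> except \<open>l j\<close>, which isolates
  \<open>b j\<close>.\<close>

lemma sum_powers_eq_0:
  fixes l b :: "'n::finite \<Rightarrow> complex"
  assumes "inj l" "\<And>k. k < CARD('n) \<Longrightarrow> (\<Sum>i\<in>UNIV. l i ^ k * b i) = 0"
  shows "b j = 0"
proof -
  define p where "p = (\<Prod>i\<in>UNIV - {j}. [:- l i, 1:])"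
  have "degree p \<le> (\<Sum>i\<in>UNIV - {j}. 1)"
    unfolding p_def by (rule order_trans[OF degree_prod_sum_le]) auto
  then have deg: "degree p < CARD('n)" by (simp add: card_Diff_singleton)
    (metis Suc_pred finite_UNIV_card_ge_0 finite less_Suc_eq_le)
  have "(\<Sum>i\<in>UNIV. poly p (l i) * b i) = (\<Sum>i\<in>UNIV. \<Sum>k\<le>degree p. coeff p k * (l i ^ k * b i))"
    by (simp add: poly_altdef sum_distrib_right mult.assoc)
  also have "\<dots> = (\<Sum>k\<le>degree p. coeff p k * (\<Sum>i\<in>UNIV. l i ^ k * b i))"
    by (subst sum.swap) (simp add: sum_distrib_left)
  also have "\<dots> = 0" using deg assms(2) by (intro sum.neutral) auto
  finally have "(\<Sum>i\<in>UNIV. poly p (l i) * b i) = 0" .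
  moreover have "poly p (l i) = 0" if "i \<noteq> j" for i
    using that by (auto simp: p_def poly_prod intro!: prod_zero)
  then have "(\<Sum>i\<in>UNIV. poly p (l i) * b i) = (\<Sum>i\<in>UNIV. if i = j then poly p (l j) * b j else 0)"
    by (intro sum.cong) auto
  ultimately have "poly p (l j) * b j = 0" by simp
  moreover have "poly p (l j) \<noteq> 0"
    using assms(1) by (auto simp: p_def poly_prod inj_eq)
  ultimately show ?thesis by simp
qed

text \<open>In an eigenbasis of \<open>\<Omega>\<close> the hypothesis says, by Lagrange interpolation, that the diagonal of
  \<open>V\<close> vanishes; then \<open>[X, \<Omega>] = V\<close> is solved entrywise.\<close>

lemma mem_tangent_if:
  fixes \<Omega> :: "'n::finite cmat"
  assumes ah: "- dag \<Omega> = \<Omega>" and reg: "card (eigenvalues \<Omega>) = CARD('n)"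
    and V: "- dag V = V" and g: "\<And>k. k < CARD('n) \<Longrightarrow> casimir_grad k \<Omega> \<bullet> V = 0"
  shows "V \<in> tangent \<Omega>"
proof -
  obtain P l where P: "dag P ** P = mat 1" "P ** dag P = mat 1" and l: "inj l" "\<And>i. cnj (l i) = - l i"
    and O: "\<Omega> = P ** diagm l ** dag P"
    using antihermitian_regular_diagonalize[OF ah reg] by metis
  have dO: "dag \<Omega> = - \<Omega>" and dV: "dag V = - V" using ah V by (metis minus_minus)+
  define V' where "V' = dag P ** V ** P"
  have VV': "V = P ** V' ** dag P"
  proof -
    have "P ** V' ** dag P = (P ** dag P) ** V ** (P ** dag P)" by (simp only: V'_def matrix_mul_assoc)
    then show ?thesis by (simp add: P)
  qed
  have dV': "dag V' = - V'"
    by (simp add: V'_def dag_mult dV matrix_minus_left matrix_minus_right matrix_mul_assoc)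
  \<comment> \<open>Orthogonality to the gradient controls only a real part; for anti-Hermitian
    \<Omega> and \<open>V\<close> the number inside is real, so the whole trace vanishes.\<close>
  have tr0: "trace (mat_pow \<Omega> k ** V) = 0" if "k < CARD('n)" for k
  proof -
    have "cnj (trace (mat_pow \<Omega> k ** V)) = (-1) ^ Suc k * trace (mat_pow \<Omega> k ** V)"
      by (simp add: dag_mult dag_mat_pow dO dV mat_pow_minus matrix_minus_left cscale_mult_right trace_minus
         trace_cscale trace_mul_sym[of V] flip: trace_dag)
    then have "(-1) ^ Suc k * cnj (trace (mat_pow \<Omega> k ** V)) = trace (mat_pow \<Omega> k ** V)"
      by (simp flip: power_add mult.assoc power_mult_distrib)
    from i_power_real_if[OF this] g[OF that] have "\<i> ^ Suc k * trace (mat_pow \<Omega> k ** V) = 0"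
      unfolding inner_casimir_grad by (intro complex_eqI) (simp_all del: power_Suc times_complex.simps)
    then show ?thesis by simp
  qed
  have diag0: "V' $ i $ i = 0" for i
  proof (rule sum_powers_eq_0[OF l(1)])
    fix k assume k: "k < CARD('n)"
    have "trace (mat_pow \<Omega> k ** V) = trace (P ** (mat_pow (diagm l) k ** (dag P ** V)))"
      by (simp only: O mat_pow_conjugate[OF P] matrix_mul_assoc)
    also have "\<dots> = trace ((mat_pow (diagm l) k ** (dag P ** V)) ** P)" by (rule trace_mul_sym)
    also have "\<dots> = trace (diagm (\<lambda>i. l i ^ k) ** V')"
      by (simp only: V'_def mat_pow_diagm matrix_mul_assoc)
    also have "\<dots> = (\<Sum>i\<in>UNIV. l i ^ k * V' $ i $ i)" by (simp add: trace_def diagm_mult_nth)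
    finally show "(\<Sum>i\<in>UNIV. l i ^ k * V' $ i $ i) = 0" using tr0[OF k] by simp
  qed
  \<comment> \<open>On the diagonal the denominator is 0 and the quotient is 0 by convention; this
    is what makes \<open>X\<close> trace-free.\<close>
  define X' :: "'n cmat" where "X' = (\<chi> a b. V' $ a $ b / (l b - l a))"
  have cX: "X' ** diagm l - diagm l ** X' = V'"
  proof -
    have "(X' ** diagm l - diagm l ** X') $ a $ b = V' $ a $ b" for a b
    proof (cases "a = b")
      case True then show ?thesis by (simp add: mult_diagm_nth diagm_mult_nth X'_def diag0)
    next
      case False
      then have "l b - l a \<noteq> 0" using l(1) by (auto simp: inj_eq)
      moreover have "(X' ** diagm l - diagm l ** X') $ a $ b = V' $ a $ b / (l b - l a) * (l b - l a)"
        by (simp add: mult_diagm_nth diagm_mult_nth X'_def right_diff_distrib mult.commute diff_divide_distrib)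
      ultimately show ?thesis by simp
    qed
    then show ?thesis by (simp add: vec_eq_iff)
  qed
  have dX': "dag X' = - X'"
  proof -
    have "cnj (V' $ b $ a) = - V' $ a $ b" for a b
      using arg_cong[OF dV', of "\<lambda>A. A $ a $ b"] by simp
    moreover have "- l a + l b = l b - l a" for a b by simp
    ultimately show ?thesis by (simp add: vec_eq_iff X'_def l(2))
  qed
  define X where "X = P ** X' ** dag P"
  have "trace X = trace (X' ** (dag P ** P))"
    unfolding X_def matrix_mul_assoc[symmetric] trace_mul_sym[of P] by (simp only: matrix_mul_assoc)
  also have "\<dots> = 0" by (simp add: P) (simp add: trace_def X'_def)
  finally have "X \<in> su"
    by (simp add: mem_su_iff X_def dag_mult dX' matrix_minus_left matrix_minus_right matrix_mul_assoc)
  have "comm X \<Omega> = P ** X' ** (dag P ** P) ** diagm l ** dag P - P ** diagm l ** (dag P ** P) ** X' ** dag P"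
    by (simp only: comm_def X_def O matrix_mul_assoc)
  also have "\<dots> = P ** (X' ** diagm l - diagm l ** X') ** dag P"
    by (simp add: P matrix_diff_ldistrib matrix_diff_rdistrib matrix_mul_assoc)
  also have "\<dots> = V" by (simp only: cX VV'[symmetric])
  finally show ?thesis using \<open>X \<in> su\<close> unfolding tangent_def by blast
qed

text \<open>Along a chart the point stays anti-Hermitian and its Casimirs stay constant;
  differentiating both facts gives the hypotheses of \<open>mem_tangent_if\<close>. The KKS form can
  then be evaluated on the coordinate frame of any chart.\<close>

lemma parametrization_tangent:
  fixes z :: "nat \<Rightarrow> complex" and \<phi> :: "real^'d \<Rightarrow> 'n::finite cmat"
  assumes par: "parametrization (orbit z) U \<phi> \<phi>'" and x: "x \<in> U"
    and reg: "\<And>\<Omega>. \<Omega> \<in> (orbit z :: 'n cmat set) \<Longrightarrow> card (eigenvalues \<Omega>) = CARD('n)"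
  shows "\<phi>' x h \<in> tangent (\<phi> x)"
proof -
  have U: "open U" "\<phi> ` U \<subseteq> orbit z" and d: "(\<phi> has_derivative \<phi>' x) (at x)"
    using par x by (auto simp: parametrization_def)
  have in_orb: "\<phi> y \<in> orbit z" if "y \<in> U" for y using U that by auto
  have ah: "- dag (\<phi> y) = \<phi> y" if "y \<in> U" for y
    using in_orb[OF that] by (auto simp: orbit_def mem_su_iff)
  show ?thesis
  proof (rule mem_tangent_if[OF ah[OF x] reg[OF in_orb[OF x]]])
    have "((\<lambda>y. - dag (\<phi> y)) has_derivative (\<lambda>h. - dag (\<phi>' x h))) (at x)"
      by (intro has_derivative_minus bounded_linear.has_derivative[OF bounded_linear_dag] d)
    then have "(\<phi> has_derivative (\<lambda>h. - dag (\<phi>' x h))) (at x)"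
      by (rule has_derivative_transform_within_open[OF _ U(1) x]) (simp add: ah)
    from fun_cong[OF has_derivative_unique[OF this d], of h] show "- dag (\<phi>' x h) = \<phi>' x h" .
    fix k assume k: "k < CARD('n)"
    have "((\<lambda>y. casimir_fun k (\<phi> y)) has_derivative (\<lambda>h. casimir_grad k (\<phi> x) \<bullet> \<phi>' x h)) (at x)"
      using has_derivative_compose[OF d has_derivative_casimir_fun] by simp
    moreover have "((\<lambda>y. casimir_fun k (\<phi> y)) has_derivative (\<lambda>h. 0)) (at x)"
    proof (rule has_derivative_transform_within_open[OF has_derivative_const U(1) x])
      show "casimir_fun k (\<phi> x) = casimir_fun k (\<phi> y)" if "y \<in> U" for y
        using orbit_eq_level_set[OF in_orb[OF x]] in_orb[OF that] k by auto
    qed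
    ultimately show "casimir_grad k (\<phi> x) \<bullet> \<phi>' x h = 0"
      using fun_cong[OF has_derivative_unique, of "\<lambda>y. casimir_fun k (\<phi> y)" _ x "\<lambda>h. 0" h] by blast
  qed
qed

text \<open>The hypothesis on \<open>'d\<close> is the dimension count: N independent gradients in
  the space of anti-Hermitian matrices, of dimension N * N, leave N * (N - 1) parameters.\<close>

lemma orbit_chart:
  fixes \<Omega> :: "'n::finite cmat"
  assumes dim: "CARD('d::finite) = CARD('n) * (CARD('n) - 1)"
    and O: "\<Omega> \<in> orbit z" and reg: "card (eigenvalues \<Omega>) = CARD('n)"
  obtains e U and \<phi> :: "real^'d \<Rightarrow> 'n cmat" and \<phi>'
  where "e > 0" "parametrization (orbit z) U \<phi> \<phi>'" "\<phi> ` U = ball \<Omega> e \<inter> orbit z"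
proof -
  have ah: "- dag \<Omega> = \<Omega>" using O by (auto simp: orbit_def mem_su_iff)
  have nd: "norm (dag A) = norm A" for A :: "'n cmat"
    by (simp add: norm_eq_sqrt_inner inner_cmat trace_mul_sym[of A])
  have dm: "dim {A :: 'n cmat. - dag A = A} = CARD('d) + CARD('n)"
    unfolding dim_antihermitian dim by (cases "CARD('n)") auto
  have \<sigma>d: "- dag (casimir_grad k \<Omega>) = casimir_grad k \<Omega>" for k
  proof -
    have "dag \<Omega> = - \<Omega>" using ah by (metis minus_minus)
    then have "dag (cscale (\<i> ^ Suc k) (mat_pow \<Omega> k)) = cscale ((- \<i>) ^ Suc k * (-1) ^ k) (mat_pow \<Omega> k)"
      by (simp add: dag_cscale dag_mat_pow mat_pow_minus cscale_cscale)
    also have "(- \<i>) ^ Suc k * (-1) ^ k = - (\<i> ^ Suc k)"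
      by (simp add: power_mult_distrib[symmetric] mult.assoc)
    finally show ?thesis by (simp add: casimir_grad_def dag_minus cscale_minus_left)
  qed
  show thesis
    by (rule level_set_chart[OF has_derivative_casimir_fun continuous_on_casimir_grad
          casimir_grad_independent[OF ah reg] linear_minus_dag _ _ casimir_fun_involution ah \<sigma>d dm])
      (use that orbit_eq_level_set[OF O] in \<open>auto simp: dag_minus nd\<close>)
qed

section \<open>The KKS form and its volume under transposition\<close>

lemma kks_comm:
  fixes X Y \<Omega> :: "'n::finite cmat"
  assumes "X \<in> su" "Y \<in> su"
  shows "kks \<Omega> (comm X \<Omega>) (comm Y \<Omega>) = su_inner \<Omega> (comm X Y)"
proof -
  \<comment> \<open>Cyclicity of the trace shows that the pairing depends on the first matrix only
    through its commutator with \<Omega>, and \<open>right\<close> shows the same for the second.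
    Hence the description in \<open>kks\<close> is independent of the representatives.\<close>
  have left: "su_inner \<Omega> (comm A B) = Re (trace (comm A \<Omega> ** B))" for A B :: "'n cmat"
  proof -
    have "trace (\<Omega> ** (B ** A)) = trace (A ** \<Omega> ** B)"
      using trace_mul_sym[of "\<Omega> ** B" A] by (simp only: matrix_mul_assoc)
    then show ?thesis
      by (simp add: su_inner_def comm_def matrix_diff_ldistrib matrix_diff_rdistrib trace_sub matrix_mul_assoc)
  qed
  have right: "su_inner \<Omega> (comm A B) = - Re (trace (comm B \<Omega> ** A))" for A B :: "'n cmat"
  proof -
    have "comm A B = - comm B A" by (simp add: comm_def)
    then have "su_inner \<Omega> (comm A B) = - su_inner \<Omega> (comm B A)"
      by (simp add: su_inner_def matrix_minus_right trace_minus)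
    then show ?thesis by (simp add: left)
  qed
  show ?thesis
    unfolding kks_def
  proof (rule the_equality)
    show "\<exists>X'\<in>su. \<exists>Y'\<in>su. comm X \<Omega> = comm X' \<Omega> \<and> comm Y \<Omega> = comm Y' \<Omega> \<and>
        su_inner \<Omega> (comm X Y) = su_inner \<Omega> (comm X' Y')" using assms by blast
    fix r assume "\<exists>X'\<in>su. \<exists>Y'\<in>su. comm X \<Omega> = comm X' \<Omega> \<and> comm Y \<Omega> = comm Y' \<Omega> \<and> r = su_inner \<Omega> (comm X' Y')"
    then obtain X' Y' where *: "comm X \<Omega> = comm X' \<Omega>" "comm Y \<Omega> = comm Y' \<Omega>" "r = su_inner \<Omega> (comm X' Y')"
      by blast
    have "r = su_inner \<Omega> (comm X Y')" using *(1,3) by (simp add: left)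
    then show "r = su_inner \<Omega> (comm X Y)" using *(2) by (simp add: right)
  qed
qed

text \<open>Transposition turns the generator \<open>X\<close> of a tangent vector into
  \<open>- transpose X\<close>. The two signs cancel in the bracket of the generators, but
  transposing that bracket reverses its factors, and this leaves one sign.\<close>

lemma kks_transpose:
  assumes "u \<in> tangent \<Omega>" "v \<in> tangent \<Omega>"
  shows "kks (transpose \<Omega>) (transpose u) (transpose v) = - kks \<Omega> u v"
proof -
  obtain X Y where X: "X \<in> su" "u = comm X \<Omega>" and Y: "Y \<in> su" "v = comm Y \<Omega>"
    using assms by (auto simp: tangent_def)
  have tr: "transpose (comm A \<Omega>) = comm (- transpose A) (transpose \<Omega>)" for A
    by (simp add: transpose_comm comm_minus_left)
  have "kks (transpose \<Omega>) (transpose u) (transpose v)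
      = su_inner (transpose \<Omega>) (comm (- transpose X) (- transpose Y))"
    unfolding X Y tr by (intro kks_comm minus_mem_su transpose_mem_su X Y)
  also have "comm (- transpose X) (- transpose Y) = - transpose (comm X Y)"
    by (simp add: transpose_comm comm_minus_left comm_minus_right)
  also have "su_inner (transpose \<Omega>) \<dots> = - su_inner \<Omega> (comm X Y)"
    by (simp add: su_inner_def matrix_minus_right trace_minus trace_mul_sym[of \<Omega>] trace_transpose
        flip: matrix_transpose_mul)
  also have "\<dots> = - kks \<Omega> u v" using kks_comm[OF X(1) Y(1), of \<Omega>] by (simp add: X Y)
  finally show ?thesis .
qed

text \<open>Every term of the top form is a product of \<open>CARD('d) div 2\<close> values of the
  form, so the sign change is one global factor that the absolute value removes.\<close>

lemma abs_wedge_top_neg: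
  fixes v :: "'d::{finite,linorder} \<Rightarrow> 'v"
  assumes "\<And>i j. w' (v' i) (v' j) = - w (v i) (v j)"
  shows "\<bar>wedge_top w' v'\<bar> = \<bar>wedge_top w v\<bar>"
proof -
  have "wedge_top w' v' = (-1) ^ (CARD('d) div 2) * wedge_top w v"
    by (simp add: wedge_top_def Let_def assms prod_uminus sum_distrib_left mult.left_commute)
  then show ?thesis by (simp add: abs_mult power_abs)
qed

text \<open>The defining formula is applied to a chart and to the chart followed by
  \<open>transpose\<close>; the two densities have equal absolute value, so the measure and its
  pushforward agree on the image of the chart.\<close>

lemma liouville_measure_transpose_invariant:
  fixes \<mu> :: "'n::finite cmat measure"
  assumes dim: "CARD('d::{finite,linorder}) = CARD('n) * (CARD('n) - 1)"
    and reg: "\<And>\<Omega>. \<Omega> \<in> (orbit z :: 'n cmat set) \<Longrightarrow> card (eigenvalues \<Omega>) = CARD('n)"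
    and \<mu>: "liouville_measure TYPE('d) z \<mu>"
  shows "transpose \<in> measurable \<mu> \<mu>" "distr \<mu> \<mu> transpose = \<mu>"
proof -
  have sets: "sets \<mu> = sets (restrict_space borel (orbit z))" using \<mu> by (simp add: liouville_measure_def)
  then have space: "space \<mu> = orbit z" by (metis sets_eq_imp_space_eq space_restrict_space2 space_restrict_space space_borel Int_UNIV_right)
  have cont: "continuous_on UNIV (transpose :: 'n cmat \<Rightarrow> 'n cmat)"
    by (rule linear_continuous_on[OF bounded_linear_transpose])
  have "transpose \<in> measurable (restrict_space borel (orbit z)) (restrict_space borel (orbit z :: 'n cmat set))"
    by (intro measurable_restrict_space3 borel_measurable_continuous_onI cont) (auto simp: transpose_mem_orbit)
  then show meas: "transpose \<in> measurable \<mu> \<mu>" using measurable_cong_sets[OF sets sets] by blast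
  have formula: "emeasure \<mu> (B \<inter> \<phi> ` U) =
      (\<integral>\<^sup>+x\<in>U. ennreal \<bar>wedge_top (kks (\<phi> x)) (\<lambda>i. \<phi>' x (axis i 1))\<bar> * indicator B (\<phi> x) \<partial>lborel)"
    if "parametrization (orbit z) U \<phi> \<phi>'" "B \<in> sets \<mu>" for U B and \<phi> :: "(real, 'd) vec \<Rightarrow> 'n cmat" and \<phi>'
    using \<mu> that unfolding liouville_measure_def by blast
  show "distr \<mu> \<mu> transpose = \<mu>"
  proof (rule measure_eqI_locally[of _ "orbit z"])
    fix \<Omega> :: "'n cmat" assume O: "\<Omega> \<in> orbit z"
    obtain e U and \<phi> :: "(real, 'd) vec \<Rightarrow> 'n cmat" and \<phi>'
      where e: "e > 0" and par: "parametrization (orbit z) U \<phi> \<phi>'" and im: "\<phi> ` U = ball \<Omega> e \<inter> orbit z"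
      using orbit_chart[OF dim O reg[OF O]] by blast
    have parT: "parametrization (orbit z) U (transpose \<circ> \<phi>) (\<lambda>x. transpose \<circ> \<phi>' x)"
      unfolding parametrization_def
    proof (intro conjI ballI allI)
      show "open U" using par by (simp add: parametrization_def)
      show "(transpose \<circ> \<phi>) ` U \<subseteq> orbit z"
        using par transpose_mem_orbit by (auto simp: parametrization_def)
      have injT: "inj (transpose :: 'n cmat \<Rightarrow> 'n cmat)" by (auto simp: inj_def)
      show "inj_on (transpose \<circ> \<phi>) U"
        using par inj_on_subset[OF injT] by (auto simp: parametrization_def intro!: comp_inj_on)
      fix x assume x: "x \<in> U"
      have d: "(\<phi> has_derivative \<phi>' x) (at x)" "inj (\<phi>' x)" using par x by (auto simp: parametrization_def)
      show "(transpose \<circ> \<phi> has_derivative transpose \<circ> \<phi>' x) (at x)"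
        using bounded_linear.has_derivative[OF bounded_linear_transpose d(1)] by (simp add: comp_def)
      show "inj (transpose \<circ> \<phi>' x)" by (rule inj_compose[OF injT d(2)])
    next
      fix h
      have "continuous_on U (\<lambda>x. \<phi>' x h)" using par by (simp add: parametrization_def)
      then show "continuous_on U (\<lambda>x. (transpose \<circ> \<phi>' x) h)"
        unfolding comp_def by (rule bounded_linear.continuous_on[OF bounded_linear_transpose])
    qed
    have eq: "emeasure (distr \<mu> \<mu> transpose) (B \<inter> ball \<Omega> e) = emeasure \<mu> (B \<inter> ball \<Omega> e)"
      if B: "B \<in> sets \<mu>" for B
    proof -
      have BO: "B \<subseteq> orbit z" using sets.sets_into_space[OF B] space by simp
      have Bb: "B \<inter> ball \<Omega> e \<in> sets \<mu>"
      proof -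
        have "ball \<Omega> e \<inter> orbit z \<in> sets \<mu>" unfolding sets by (auto simp: sets_restrict_space)
        then have "B \<inter> (ball \<Omega> e \<inter> orbit z) \<in> sets \<mu>" using B by blast
        also have "B \<inter> (ball \<Omega> e \<inter> orbit z) = B \<inter> ball \<Omega> e" using BO by blast
        finally show ?thesis .
      qed
      define B' where "B' = transpose -` B \<inter> space \<mu>"
      have B': "B' \<in> sets \<mu>" unfolding B'_def using meas B by (rule measurable_sets)
      \<comment> \<open>As \<open>transpose\<close> is its own inverse, the preimage of the piece
        covered by the chart is the piece covered by the transposed chart.\<close>
      have pre: "transpose -` (B \<inter> ball \<Omega> e) \<inter> space \<mu> = B' \<inter> (transpose \<circ> \<phi>) ` U"
      proof -
        have "(transpose \<circ> \<phi>) ` U = transpose ` (ball \<Omega> e \<inter> orbit z)" by (simp only: image_comp[symmetric] im)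
        also have "\<dots> = transpose -` (ball \<Omega> e \<inter> orbit z)"
        proof (intro set_eqI iffI)
          fix A assume "A \<in> transpose -` (ball \<Omega> e \<inter> orbit z)"
          then show "A \<in> transpose ` (ball \<Omega> e \<inter> orbit z)"
            by (intro image_eqI[of _ _ "transpose A"]) auto
        qed auto
        finally show ?thesis using BO by (auto simp: B'_def)
      qed
      have "emeasure (distr \<mu> \<mu> transpose) (B \<inter> ball \<Omega> e) = emeasure \<mu> (B' \<inter> (transpose \<circ> \<phi>) ` U)"
        by (simp only: emeasure_distr[OF meas Bb] pre)
      also have "\<dots> = (\<integral>\<^sup>+x\<in>U. ennreal \<bar>wedge_top (kks ((transpose \<circ> \<phi>) x)) (\<lambda>i. (transpose \<circ> \<phi>' x) (axis i 1))\<bar>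
           * indicator B' ((transpose \<circ> \<phi>) x) \<partial>lborel)"
        by (rule formula[OF parT B'])
      also have "\<dots> = (\<integral>\<^sup>+x\<in>U. ennreal \<bar>wedge_top (kks (\<phi> x)) (\<lambda>i. \<phi>' x (axis i 1))\<bar> * indicator B (\<phi> x) \<partial>lborel)"
      proof (rule nn_integral_cong)
        fix x :: "(real, 'd) vec"
        show "ennreal \<bar>wedge_top (kks ((transpose \<circ> \<phi>) x)) (\<lambda>i. (transpose \<circ> \<phi>' x) (axis i 1))\<bar>
              * indicator B' ((transpose \<circ> \<phi>) x) * indicator U x =
            ennreal \<bar>wedge_top (kks (\<phi> x)) (\<lambda>i. \<phi>' x (axis i 1))\<bar> * indicator B (\<phi> x) * indicator U x"
        proof (cases "x \<in> U")
          case True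
          have "\<phi> x \<in> orbit z" using True par by (auto simp: parametrization_def)
          then have "indicator B' ((transpose \<circ> \<phi>) x) = (indicator B (\<phi> x) :: ennreal)"
            by (auto simp: B'_def space transpose_mem_orbit indicator_def)
          moreover have "\<bar>wedge_top (kks ((transpose \<circ> \<phi>) x)) (\<lambda>i. (transpose \<circ> \<phi>' x) (axis i 1))\<bar>
              = \<bar>wedge_top (kks (\<phi> x)) (\<lambda>i. \<phi>' x (axis i 1))\<bar>"
            by (rule abs_wedge_top_neg)
              (simp add: kks_transpose parametrization_tangent[OF par True reg])
          ultimately show ?thesis by simp
        qed simp
      qed
      also have "\<dots> = emeasure \<mu> (B \<inter> \<phi> ` U)" using formula[OF par B] by simp
      also have "B \<inter> \<phi> ` U = B \<inter> ball \<Omega> e" using BO im by auto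
      finally show ?thesis .
    qed
    show "\<exists>e>0. \<forall>B\<in>sets (distr \<mu> \<mu> transpose).
        emeasure (distr \<mu> \<mu> transpose) (B \<inter> ball \<Omega> e) = emeasure \<mu> (B \<inter> ball \<Omega> e)"
      using e eq by auto
  qed (simp_all add: sets)
qed

lemma kks_probability_transpose_invariant:
  fixes m :: "'n::finite cmat measure"
  assumes dim: "CARD('d::{finite,linorder}) = CARD('n) * (CARD('n) - 1)"
    and reg: "\<And>\<Omega>. \<Omega> \<in> (orbit z :: 'n cmat set) \<Longrightarrow> card (eigenvalues \<Omega>) = CARD('n)"
    and m: "kks_probability TYPE('d) z m"
  shows "prob_space m" "sets m = sets (restrict_space borel (orbit z))"
    "transpose \<in> measurable m m" "distr m m transpose = m"
proof -
  show "prob_space m" using m by (simp add: kks_probability_def)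
  obtain \<mu> c where \<mu>: "liouville_measure TYPE('d) z \<mu>" and mc: "m = scale_measure c \<mu>"
    using m by (auto simp: kks_probability_def)
  note inv = liouville_measure_transpose_invariant[OF dim reg \<mu>]
  show "sets m = sets (restrict_space borel (orbit z))"
    using \<mu> by (simp add: mc liouville_measure_def)
  show T: "transpose \<in> measurable m m" using inv(1) by (simp add: mc measurable_def space_scale_measure)
  show "distr m m transpose = m"
  proof (rule measure_eqI)
    fix B assume "B \<in> sets (distr m m transpose)"
    then have B: "B \<in> sets m" "B \<in> sets \<mu>" by (simp_all add: mc)
    have "emeasure (distr m m transpose) B = c * emeasure (distr \<mu> \<mu> transpose) B"
      using T inv(1) B by (simp add: emeasure_distr) (simp add: mc space_scale_measure)
    then show "emeasure (distr m m transpose) B = emeasure m B" by (simp add: inv(2) mc)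
  qed simp
qed

subsection \<open>The basis L and the fluxes\<close>

lemma pos_less: "pos (i :: 'n::{finite,linorder}) < CARD('n)"
  unfolding pos_def by (rule psubset_card_mono) auto

lemma inj_pos: "inj (pos :: 'n::{finite,linorder} \<Rightarrow> nat)"
proof -
  have "pos i < pos j" if "i < j" for i j :: 'n
    unfolding pos_def using that by (intro psubset_card_mono) (auto simp: psubset_eq intro: less_trans)
  then show ?thesis by (metis injI linorder_neqE less_irrefl)
qed

lemma bij_betw_pos: "bij_betw pos (UNIV :: 'n::{finite,linorder} set) {..<CARD('n)}"
proof -
  have "range (pos :: 'n \<Rightarrow> nat) = {..<CARD('n)}"
    by (rule card_subset_eq) (auto simp: pos_less card_image[OF inj_pos])
  then show ?thesis using inj_pos by (simp add: bij_betw_def)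
qed

lemma pos_eq_iff [simp]: "pos i = pos j \<longleftrightarrow> i = (j :: 'n::{finite,linorder})"
  using inj_pos by (rule inj_eq)

text \<open>Positions are residues modulo N, so index identities in matrix products can be decided
  by divisibility.\<close>

lemma pos_eq_iff_dvd: "pos (i :: 'n) = pos (j :: 'n::{finite,linorder}) \<longleftrightarrow> int CARD('n) dvd int (pos i) - int (pos j)"
proof
  assume "int CARD('n) dvd int (pos i) - int (pos j)"
  then have "int (pos i) mod int CARD('n) = int (pos j) mod int CARD('n)" by (simp add: mod_eq_dvd_iff)
  then have "int (pos i mod CARD('n)) = int (pos j mod CARD('n))" by (simp only: zmod_int)
  then show "pos i = pos j" using pos_less[of i] pos_less[of j] by (simp only: of_nat_eq_iff mod_less)
qed simp

lemma ex_pos_dvd: "\<exists>j :: 'n::{finite,linorder}. int CARD('n) dvd int (pos j) - a"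
proof -
  have "nat (a mod int CARD('n)) < CARD('n)" by (simp add: nat_less_iff)
  then obtain j :: 'n where "pos j = nat (a mod int CARD('n))"
    using bij_betw_pos unfolding bij_betw_def by (metis imageE lessThan_iff)
  then have "int (pos j) = a mod int CARD('n)" by simp
  then have "int (pos j) mod int CARD('n) = a mod int CARD('n)" by simp
  then show ?thesis by (auto simp: mod_eq_dvd_iff)
qed

section \<open>Powers of the root of unity and character sums\<close>

lemma omega_powi: "omega N powi a = exp (of_int a * (- (4 * of_real pi * \<i>) / of_nat N))"
  unfolding omega_def by (rule exp_power_int)

lemma omega_neq_0 [simp]: "omega N \<noteq> 0" by (simp add: omega_def)

lemma omega_powi_add: "omega N powi (a + b) = omega N powi a * omega N powi b"
  by (simp add: power_int_add)

lemma cnj_omega_powi: "cnj (omega N powi a) = omega N powi (- a)"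
  by (simp add: omega_powi exp_cnj)

text \<open>The exponent in \<open>omega\<close> carries 4 pi, so \<open>omega N\<close> is the
  square of a primitive N-th root of unity. It is itself primitive because 2 is invertible modulo
  the odd number N.\<close>

lemma omega_powi_eq_1_iff:
  assumes "odd N"
  shows "omega N powi a = 1 \<longleftrightarrow> int N dvd a"
proof -
  have N: "N \<noteq> 0" using assms by (metis even_zero)
  have Re0: "Re (of_int a * (- (4 * of_real pi * \<i>) / of_nat N)) = 0" by (simp add: Re_divide_of_nat)
  have Im: "Im (of_int a * (- (4 * of_real pi * \<i>) / of_nat N)) = - (4 * pi * of_int a) / N"
    by (simp add: Im_divide_of_nat)
  have "omega N powi a = 1 \<longleftrightarrow> (\<exists>n::int. - (4 * pi * of_int a) / N = of_int (2 * n) * pi)"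
    unfolding omega_powi exp_eq_1 Re0 Im by simp
  also have "\<dots> \<longleftrightarrow> (\<exists>n::int. - (2 * a) = n * int N)"
  proof -
    have "- (4 * pi * of_int a) / N = of_int (2 * n) * pi \<longleftrightarrow> - (2 * a) = n * int N" for n :: int
    proof -
      have "- (4 * pi * of_int a) / N = of_int (2 * n) * pi
          \<longleftrightarrow> 2 * pi * real_of_int (- (2 * a)) = 2 * pi * real_of_int (n * int N)"
        using N by (simp add: field_simps)
      also have "\<dots> \<longleftrightarrow> real_of_int (- (2 * a)) = real_of_int (n * int N)"
        by (simp only: mult_cancel_left) simp
      finally have "- (4 * pi * of_int a) / N = of_int (2 * n) * pi
          \<longleftrightarrow> real_of_int (- (2 * a)) = real_of_int (n * int N)" .
      then show ?thesis by (simp only: of_int_eq_iff)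
    qed
    then show ?thesis by simp
  qed
  also have "\<dots> \<longleftrightarrow> int N dvd - (2 * a)" by (auto simp: dvd_def mult.commute)
  also have "\<dots> \<longleftrightarrow> int N dvd a"
  proof -
    have "coprime (int N) 2" using assms by simp
    then show ?thesis by (simp add: coprime_dvd_mult_right_iff)
  qed
  finally show ?thesis .
qed

lemma omega_powi_cong:
  assumes "odd N" "int N dvd a - b"
  shows "omega N powi a = omega N powi b"
proof -
  have "omega N powi a = omega N powi (a - b) * omega N powi b" by (simp flip: omega_powi_add)
  then show ?thesis using omega_powi_eq_1_iff[OF assms(1)] assms(2) by simp
qed

lemma sum_omega_powi:
  assumes "odd N"
  shows "(\<Sum>t<N. omega N powi (int t * a)) = (if int N dvd a then of_nat N else 0)"
proof -
  have pw: "omega N powi (int t * a) = (omega N powi a) ^ t" for t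
    by (simp add: power_int_mult mult.commute[of "int t"])
  show ?thesis
  proof (cases "int N dvd a")
    case True
    then have "omega N powi a = 1" using omega_powi_eq_1_iff[OF assms] by simp
    then show ?thesis using True by (simp add: pw)
  next
    case False
    then have ne: "omega N powi a \<noteq> 1" using omega_powi_eq_1_iff[OF assms] by simp
    have "(omega N powi a) ^ N = 1"
      using omega_powi_eq_1_iff[OF assms, of "int N * a"] by (simp flip: pw)
    then show ?thesis using False ne by (simp add: pw sum_gp_strict)
  qed
qed

lemma sum_omega_powi_pos:
  assumes "odd CARD('n::{finite,linorder})"
  shows "(\<Sum>i\<in>(UNIV :: 'n set). omega CARD('n) powi (int (pos i) * a)) = (if int CARD('n) dvd a then of_nat CARD('n) else 0)"
  using sum.reindex_bij_betw[OF bij_betw_pos[where 'n='n], of "\<lambda>t. omega CARD('n) powi (int t * a)"]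
    sum_omega_powi[OF assms] by simp

definition half_range :: "nat \<Rightarrow> int set" where
  "half_range N = {- ((int N - 1) div 2)..(int N - 1) div 2}"

lemma half_range_eq_iff:
  assumes "odd N" "a \<in> half_range N" "b \<in> half_range N"
  shows "a = b \<longleftrightarrow> int N dvd a - b"
proof
  assume "int N dvd a - b"
  moreover have "\<bar>a - b\<bar> < int N" using assms by (auto simp: half_range_def elim!: oddE)
  ultimately show "a = b" using zdvd_not_zless[of "\<bar>a - b\<bar>" "int N"] by fastforce
qed simp

lemma ex_half_range:
  assumes "odd N"
  shows "\<exists>b\<in>half_range N. int N dvd b - a"
proof -
  obtain H where H: "N = 2 * H + 1" using assms by (auto elim: oddE)
  have "(a + int H) mod int N - int H \<in> half_range N"
  proof -
    have "0 \<le> (a + int H) mod int N" "(a + int H) mod int N < int N" using H by simp_all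
    moreover have "(int N - 1) div 2 = int H" using H by simp
    moreover have "int N = 2 * int H + 1" using H by simp
    ultimately show ?thesis unfolding half_range_def by simp
  qed
  moreover have "int N dvd (a + int H) mod int N - int H - a"
  proof -
    have "(a + int H) mod int N - int H - a = - (int N * ((a + int H) div int N))"
      by (simp add: minus_div_mult_eq_mod[symmetric] mult.commute)
    then show ?thesis by simp
  qed
  ultimately show ?thesis by blast
qed

lemma sum_omega_powi_half_range:
  assumes "odd N"
  shows "(\<Sum>t\<in>half_range N. omega N powi (t * a)) = (if int N dvd a then of_nat N else 0)"
proof -
  obtain H where H: "N = 2 * H + 1" using assms by (auto elim: oddE)
  have bij: "bij_betw (\<lambda>t. int t - int H) {..<N} (half_range N)"
    by (rule bij_betw_byWitness[where f' = "\<lambda>t. nat (t + int H)"]) (auto simp: half_range_def H)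
  have "(\<Sum>t\<in>half_range N. omega N powi (t * a)) = (\<Sum>t<N. omega N powi ((int t - int H) * a))"
    by (rule sum.reindex_bij_betw[OF bij, symmetric])
  also have "\<dots> = (\<Sum>t<N. omega N powi (- int H * a) * omega N powi (int t * a))"
    by (simp add: algebra_simps flip: omega_powi_add)
  also have "\<dots> = omega N powi (- int H * a) * (if int N dvd a then of_nat N else 0)"
    by (simp only: sum_omega_powi[OF assms] flip: sum_distrib_left)
  also have "\<dots> = (if int N dvd a then of_nat N else 0)"
    using omega_powi_eq_1_iff[OF assms, of "- int H * a"] by auto
  finally show ?thesis .
qed

section \<open>Clock and shift matrices, entry by entry\<close>

lemma matrix_inv_eqI:
  fixes A :: "'a::semiring_1^'n^'n"
  assumes "A ** B = mat 1" "B ** A = mat 1"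
  shows "matrix_inv A = B"
proof -
  have "A ** matrix_inv A = mat 1 \<and> matrix_inv A ** A = mat 1"
    unfolding matrix_inv_def by (rule someI[of _ B]) (use assms in blast)
  then show ?thesis by (metis assms(2) matrix_mul_assoc matrix_mul_lid matrix_mul_rid)
qed

lemma diagm_mult_diagm: "diagm a ** diagm b = diagm (\<lambda>i. a i * b i)"
  by (auto simp: vec_eq_iff diagm_mult_nth) (auto simp: diagm_def)

lemma diagm_1: "diagm (\<lambda>_. 1) = mat 1"
  by (auto simp: vec_eq_iff diagm_def mat_def)

lemma mat_powi_clock:
  "mat_powi clock_mat k = (diagm (\<lambda>i. omega CARD('n) powi (k * int (pos i))) :: 'n::{finite,linorder} cmat)"
proof -
  have c: "clock_mat = (diagm (\<lambda>i. omega CARD('n) ^ pos i) :: 'n cmat)"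
    by (simp add: clock_mat_def diagm_def)
  have i: "matrix_inv clock_mat = (diagm (\<lambda>i. inverse (omega CARD('n) ^ pos i)) :: 'n cmat)"
    by (rule matrix_inv_eqI) (simp_all add: c diagm_mult_diagm diagm_1)
  show ?thesis
  proof (cases "k \<ge> 0")
    case True
    then obtain n where "k = int n" by (metis nonneg_int_cases)
    then show ?thesis
      by (simp add: mat_powi_def c mat_pow_diagm power_int_mult mult.commute[of "int n"] flip: power_mult)
  next
    case False
    define n where "n = nat (- k)"
    have "k = - int n" "n > 0" using False by (simp_all add: n_def)
    moreover have "inverse (omega CARD('n) ^ p) ^ n = omega CARD('n) powi (- int n * int p)" for p
    proof -
      have "omega CARD('n) powi (- int n * int p) = omega CARD('n) powi (- int (p * n))"
        by (simp add: mult.commute)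
      also have "\<dots> = inverse (omega CARD('n) ^ (p * n))" by (metis power_int_minus power_int_of_nat)
      also have "\<dots> = inverse (omega CARD('n) ^ p) ^ n" by (metis power_mult power_inverse)
      finally show ?thesis by (rule sym)
    qed
    ultimately show ?thesis by (simp add: mat_powi_def i mat_pow_diagm)
  qed
qed

text \<open>Cyclic shift by an arbitrary integer. Phrased as a congruence it is additive in
  \<open>a\<close>, which treats positive and negative powers of the shift matrix alike.\<close>

definition shiftm :: "int \<Rightarrow> 'n::{finite,linorder} cmat" where
  "shiftm a = (\<chi> i j. if int CARD('n) dvd int (pos j) - int (pos i) - a then 1 else 0)"

lemma shiftm_0: "shiftm 0 = (mat 1 :: 'n::{finite,linorder} cmat)"
proof -
  have "int CARD('n) dvd int (pos j) - int (pos i) - 0 \<longleftrightarrow> i = j" for i j :: 'n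
    using pos_eq_iff_dvd[of j i] by auto
  then show ?thesis by (simp add: shiftm_def mat_def)
qed

lemma shiftm_add: "shiftm a ** shiftm b = (shiftm (a + b) :: 'n::{finite,linorder} cmat)"
proof -
  have "(shiftm a ** shiftm b :: 'n cmat) $ i $ j = shiftm (a + b) $ i $ j" for i j
  proof -
    obtain l :: 'n where l: "int CARD('n) dvd int (pos l) - (int (pos i) + a)" using ex_pos_dvd by blast
    have u: "int CARD('n) dvd int (pos l') - int (pos i) - a \<longleftrightarrow> l' = l" for l'
    proof
      assume "int CARD('n) dvd int (pos l') - int (pos i) - a"
      from dvd_diff[OF this l] show "l' = l" unfolding pos_eq_iff[symmetric] pos_eq_iff_dvd by simp
    qed (use l in \<open>simp add: algebra_simps\<close>)
    have "(shiftm a ** shiftm b :: 'n cmat) $ i $ j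
        = (\<Sum>l'\<in>UNIV. if l' = l then (if int CARD('n) dvd int (pos j) - int (pos l) - b then 1 else 0) else 0)"
      unfolding matrix_mult_nth by (rule sum.cong) (auto simp: shiftm_def u)
    also have "\<dots> = (if int CARD('n) dvd int (pos j) - int (pos l) - b then 1 else 0)" by simp
    also have "int CARD('n) dvd int (pos j) - int (pos l) - b \<longleftrightarrow> int CARD('n) dvd int (pos j) - int (pos i) - (a + b)"
    proof -
      have "int (pos j) - int (pos i) - (a + b) = (int (pos j) - int (pos l) - b) + (int (pos l) - (int (pos i) + a))"
        by simp
      then show ?thesis using l by (metis dvd_add_left_iff)
    qed
    finally show ?thesis by (simp add: shiftm_def)
  qed
  then show ?thesis by (simp add: vec_eq_iff)
qed

lemma mat_pow_shiftm: "mat_pow (shiftm a) n = shiftm (int n * a)"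
  by (induction n) (simp_all add: shiftm_0 mat_pow_Suc shiftm_add algebra_simps)

lemma mat_powi_shift: "mat_powi shift_mat k = (shiftm k :: 'n::{finite,linorder} cmat)"
proof -
  have s: "shift_mat = (shiftm 1 :: 'n cmat)"
  proof -
    have "pos j = (pos i + 1) mod CARD('n) \<longleftrightarrow> int CARD('n) dvd int (pos j) - int (pos i) - 1" for i j :: 'n
    proof -
      have "pos j = (pos i + 1) mod CARD('n) \<longleftrightarrow> int (pos j mod CARD('n)) = int ((pos i + 1) mod CARD('n))"
        using pos_less[of j] by (simp only: of_nat_eq_iff mod_less)
      also have "\<dots> \<longleftrightarrow> int CARD('n) dvd int (pos j) - int (pos i + 1)"
        by (simp only: zmod_int mod_eq_dvd_iff)
      finally show ?thesis by (simp add: algebra_simps)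
    qed
    then show ?thesis by (simp add: shift_mat_def shiftm_def)
  qed
  have i: "matrix_inv shift_mat = (shiftm (- 1) :: 'n cmat)"
    by (rule matrix_inv_eqI) (simp_all add: s shiftm_add shiftm_0)
  show ?thesis unfolding mat_powi_def s i[unfolded s] by (simp add: mat_pow_shiftm)
qed

text \<open>The clock power contributes a phase depending on the row, the shift power one nonzero
  entry per row. Adjoints, transposes and both orthogonality relations are read off from this
  formula.\<close>

lemma Jmat_nth: "(Jmat k :: 'n::{finite,linorder} cmat) $ i $ j =
    omega CARD('n) powi ((int CARD('n) + 1) div 2 * fst k * snd k + fst k * int (pos i)) *
      (if int CARD('n) dvd int (pos j) - int (pos i) - snd k then 1 else 0)"
  by (simp add: Jmat_def mat_powi_clock mat_powi_shift diagm_mult_nth shiftm_def omega_powi_add)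

lemma Jmat_0: "Jmat (0, 0) = mat 1"
proof -
  have "Jmat (0, 0) = (shiftm 0 :: 'n::{finite,linorder} cmat)" by (simp add: vec_eq_iff Jmat_nth shiftm_def)
  then show ?thesis by (simp only: shiftm_0)
qed

lemma twice_half: "odd N \<Longrightarrow> 2 * ((int N + 1) div 2) = int N + 1" by (auto elim!: oddE)

text \<open>This is what the phase with \<open>k1 * k2 / 2\<close> in the definition of
  \<open>Jmat\<close> achieves: since twice the half is \<open>N + 1\<close>, replacing row
  \<open>i\<close> by column \<open>j = i + b\<close> modulo N just flips the sign of the
  half-phase.\<close>

lemma omega_powi_half_cong:
  assumes "odd N" "int N dvd j - i - b"
  shows "omega N powi (- ((int N + 1) div 2 * a * b) + - (a * i)) = omega N powi ((int N + 1) div 2 * a * b - a * j)"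
proof (rule omega_powi_cong[OF assms(1)])
  have "2 * ((int N + 1) div 2) * a * b = (int N + 1) * a * b" by (simp add: twice_half[OF assms(1)])
  then have e: "- ((int N + 1) div 2 * a * b) + - (a * i) - ((int N + 1) div 2 * a * b - a * j)
      = a * (j - i - b) - int N * (a * b)" by (simp add: algebra_simps)
  show "int N dvd - ((int N + 1) div 2 * a * b) + - (a * i) - ((int N + 1) div 2 * a * b - a * j)"
    unfolding e using assms(2) by simp
qed

lemma dvd_diff_swap: "n dvd i - j - k \<longleftrightarrow> n dvd j - i + (k :: int)"
  using dvd_minus_iff[of n "i - j - k"] by (simp add: algebra_simps)

lemma dag_Jmat:
  assumes "odd CARD('n::{finite,linorder})"
  shows "dag (Jmat k) = (Jmat (- fst k, - snd k) :: 'n cmat)"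
proof -
  have "cnj ((Jmat k :: 'n cmat) $ j $ i) = Jmat (- fst k, - snd k) $ i $ j" for i j
  proof (cases "int CARD('n) dvd int (pos i) - int (pos j) - snd k")
    case True
    then have d: "int CARD('n) dvd int (pos j) - int (pos i) + snd k" 
      by (simp add: dvd_diff_swap)
    have "cnj (omega CARD('n) powi ((int CARD('n) + 1) div 2 * fst k * snd k + fst k * int (pos j)))
        = omega CARD('n) powi ((int CARD('n) + 1) div 2 * fst k * snd k - fst k * int (pos i))"
      using omega_powi_half_cong[OF assms True, of "fst k"] unfolding cnj_omega_powi by (simp add: algebra_simps)
    then show ?thesis using True d by (simp add: Jmat_nth)
  next
    case False
    then have "\<not> int CARD('n) dvd int (pos j) - int (pos i) + snd k"
      by (simp add: dvd_diff_swap)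
    with False show ?thesis by (simp add: Jmat_nth)
  qed
  then show ?thesis by (simp add: vec_eq_iff)
qed

text \<open>The shift is reversed while the clock exponent stays, since no conjugation takes place.
  The congruence behind \<open>dag_Jmat\<close> serves again, with the sign of the first component
  flipped.\<close>

lemma transpose_Jmat:
  assumes "odd CARD('n::{finite,linorder})"
  shows "transpose (Jmat k) = (Jmat (fst k, - snd k) :: 'n cmat)"
proof -
  have "(Jmat k :: 'n cmat) $ j $ i = Jmat (fst k, - snd k) $ i $ j" for i j
  proof (cases "int CARD('n) dvd int (pos i) - int (pos j) - snd k")
    case True
    then have d: "int CARD('n) dvd int (pos j) - int (pos i) + snd k"
      by (simp add: dvd_diff_swap)
    have "omega CARD('n) powi ((int CARD('n) + 1) div 2 * fst k * snd k + fst k * int (pos j))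
        = omega CARD('n) powi (- ((int CARD('n) + 1) div 2 * fst k * snd k) + fst k * int (pos i))"
      using omega_powi_half_cong[OF assms True, of "- fst k"] by (simp add: algebra_simps)
    then show ?thesis using True d by (simp add: Jmat_nth)
  next
    case False
    then have "\<not> int CARD('n) dvd int (pos j) - int (pos i) + snd k"
      by (simp add: dvd_diff_swap)
    with False show ?thesis by (simp add: Jmat_nth)
  qed
  then show ?thesis by (simp add: vec_eq_iff)
qed

section \<open>Completeness and orthogonality of the matrices J\<close>

lemma trace_mult_dag: "trace (A ** dag B) = (\<Sum>c\<in>UNIV. \<Sum>d\<in>UNIV. A $ c $ d * cnj (B $ c $ d))"
  by (simp add: trace_def matrix_mult_nth)

lemma modes_eq: "modes N = half_range N \<times> half_range N - {(0, 0)}"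
  by (auto simp: modes_def half_range_def)

lemma finite_modes [simp]: "finite (modes N)"
  by (simp add: modes_eq half_range_def)

lemma finite_half_range [simp]: "finite (half_range N)"
  by (simp add: half_range_def)

lemma zero_half_range: "odd N \<Longrightarrow> 0 \<in> half_range N"
  by (auto simp: half_range_def elim!: oddE)

lemma full_modes: "odd N \<Longrightarrow> half_range N \<times> half_range N = insert (0, 0) (modes N)"
  using zero_half_range by (auto simp: modes_eq)

text \<open>Exactly one representative \<open>t\<close> is the displacement from \<open>c\<close> to
  \<open>d\<close>, and it is also the displacement from \<open>c\<close> to \<open>b\<close> only
  if \<open>b = d\<close>.\<close>

lemma sum_dvd_pair:
  assumes N: "odd CARD('n)"
  shows "(\<Sum>t\<in>half_range CARD('n). (if int CARD('n) dvd int (pos (d :: 'n::{finite,linorder})) - int (pos c) - t then 1 else 0) *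
      (if int CARD('n) dvd int (pos (b :: 'n)) - int (pos c) - t then 1 else (0::complex))) = (if d = b then 1 else 0)"
proof -
  obtain u where u: "u \<in> half_range CARD('n)" "int CARD('n) dvd u - (int (pos d) - int (pos c))"
    using ex_half_range[OF N] by blast
  have iff: "int CARD('n) dvd int (pos d) - int (pos c) - t \<longleftrightarrow> t = u" if "t \<in> half_range CARD('n)" for t
  proof
    assume "int CARD('n) dvd int (pos d) - int (pos c) - t"
    from dvd_add[OF this u(2)] have "int CARD('n) dvd u - t" by simp
    then show "t = u" using half_range_eq_iff[OF N u(1) that] by simp
  next
    assume "t = u" then show "int CARD('n) dvd int (pos d) - int (pos c) - t"
      using u(2) dvd_minus_iff[of "int CARD('n)" "u - (int (pos d) - int (pos c))"] by simp
  qed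
  have "int CARD('n) dvd int (pos b) - int (pos c) - u \<longleftrightarrow> d = b"
  proof -
    have "int (pos b) - int (pos c) - u = (int (pos b) - int (pos d)) - (u - (int (pos d) - int (pos c)))" by simp
    then have "int CARD('n) dvd int (pos b) - int (pos c) - u \<longleftrightarrow> int CARD('n) dvd int (pos b) - int (pos d)"
      using u(2) by (metis dvd_diff_left_iff)
    then show ?thesis using pos_eq_iff_dvd[of b d] by auto
  qed
  then have "(\<Sum>t\<in>half_range CARD('n). (if int CARD('n) dvd int (pos d) - int (pos c) - t then 1 else 0) *
      (if int CARD('n) dvd int (pos b) - int (pos c) - t then 1 else (0::complex)))
     = (\<Sum>t\<in>half_range CARD('n). if t = u then (if d = b then 1 else 0) else 0)"
    by (intro sum.cong refl) (auto simp: iff)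
  also have "\<dots> = (if d = b then 1 else 0)" using u(1) by simp
  finally show ?thesis .
qed

text \<open>The half-phases cancel in the product of one entry with the conjugate of another. The
  double sum then factors into a character sum that forces \<open>a = c\<close> and a count of
  shifts that forces \<open>b = d\<close>.\<close>

lemma Jmat_complete:
  assumes N: "odd CARD('n::{finite,linorder})"
  shows "(\<Sum>k\<in>half_range CARD('n) \<times> half_range CARD('n). cnj ((Jmat k :: 'n cmat) $ c $ d) * (Jmat k :: 'n cmat) $ a $ b)
    = (if a = c \<and> b = d then of_nat CARD('n) else 0)"
proof -
  let ?H = "half_range CARD('n)" and ?w = "omega CARD('n)"
  let ?h = "(int CARD('n) + 1) div 2"
  let ?D = "\<lambda>i j t. if int CARD('n) dvd int (pos (j :: 'n)) - int (pos (i :: 'n)) - t then 1 else (0::complex)"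
  have each: "cnj ((Jmat (s, t) :: 'n cmat) $ c $ d) * (Jmat (s, t) :: 'n cmat) $ a $ b
     = ?w powi (s * (int (pos a) - int (pos c))) * (?D c d t * ?D a b t)" for s t
  proof -
    have "cnj (?w powi (?h * s * t + s * int (pos c))) * ?w powi (?h * s * t + s * int (pos a))
        = ?w powi (s * (int (pos a) - int (pos c)))"
      unfolding cnj_omega_powi omega_powi_add[symmetric] by (simp add: algebra_simps)
    then show ?thesis by (simp add: Jmat_nth)
  qed
  have "(\<Sum>k\<in>?H \<times> ?H. cnj ((Jmat k :: 'n cmat) $ c $ d) * (Jmat k :: 'n cmat) $ a $ b)
     = (\<Sum>s\<in>?H. \<Sum>t\<in>?H. ?w powi (s * (int (pos a) - int (pos c))) * (?D c d t * ?D a b t))"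
    unfolding sum.cartesian_product by (intro sum.cong refl, clarify) (simp only: each case_prod_conv)
  also have "\<dots> = (\<Sum>s\<in>?H. ?w powi (s * (int (pos a) - int (pos c)))) * (\<Sum>t\<in>?H. ?D c d t * ?D a b t)"
    by (simp only: sum_product)
  also have "\<dots> = (if a = c then of_nat CARD('n) else 0) * (\<Sum>t\<in>?H. ?D c d t * ?D a b t)"
    unfolding sum_omega_powi_half_range[OF N] using pos_eq_iff_dvd[of a c] by simp
  also have "\<dots> = (if a = c \<and> b = d then of_nat CARD('n) else 0)"
    using sum_dvd_pair[OF N, of d c b] by auto
  finally show ?thesis .
qed

text \<open>Completeness runs over all pairs including (0, 0); that extra mode contributes the trace
  of \<open>A\<close> times the identity, which is 0.\<close>

lemma Jmat_expansion:
  fixes A :: "'n::{finite,linorder} cmat"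
  assumes N: "odd CARD('n)" and A: "trace A = 0"
  shows "(\<Sum>k\<in>modes CARD('n). cscale (trace (A ** dag (Jmat k))) (Jmat k)) = cscale (of_nat CARD('n)) A"
proof -
  let ?F = "half_range CARD('n) \<times> half_range CARD('n)"
  have "(\<Sum>k\<in>modes CARD('n). cscale (trace (A ** dag (Jmat k))) (Jmat k))
    = (\<Sum>k\<in>?F. cscale (trace (A ** dag (Jmat k))) (Jmat k))"
    unfolding full_modes[OF N]
    by (subst sum.insert) (simp_all add: modes_eq Jmat_0 A half_range_def)
  also have "\<dots> = cscale (of_nat CARD('n)) A"
  proof -
    have "(\<Sum>k\<in>?F. cscale (trace (A ** dag (Jmat k))) (Jmat k)) $ a $ b = of_nat CARD('n) * A $ a $ b" for a b
    proof -
      have "(\<Sum>k\<in>?F. cscale (trace (A ** dag (Jmat k))) (Jmat k)) $ a $ b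
        = (\<Sum>k\<in>?F. \<Sum>c\<in>UNIV. \<Sum>d\<in>UNIV. A $ c $ d * (cnj ((Jmat k :: 'n cmat) $ c $ d) * (Jmat k :: 'n cmat) $ a $ b))"
        by (simp only: sum_component cscale_nth trace_mult_dag sum_distrib_right mult.assoc)
      also have "\<dots> = (\<Sum>c\<in>UNIV. \<Sum>k\<in>?F. \<Sum>d\<in>UNIV. A $ c $ d * (cnj ((Jmat k :: 'n cmat) $ c $ d) * (Jmat k :: 'n cmat) $ a $ b))"
        by (rule sum.swap)
      also have "\<dots> = (\<Sum>c\<in>UNIV. \<Sum>d\<in>UNIV. \<Sum>k\<in>?F. A $ c $ d * (cnj ((Jmat k :: 'n cmat) $ c $ d) * (Jmat k :: 'n cmat) $ a $ b))"
        by (intro sum.cong refl) (rule sum.swap)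
      also have "\<dots> = (\<Sum>c\<in>UNIV. \<Sum>d\<in>UNIV. A $ c $ d * (if a = c \<and> b = d then of_nat CARD('n) else 0))"
        by (simp only: sum_distrib_left[symmetric] Jmat_complete[OF N])
      also have "\<dots> = (\<Sum>c\<in>UNIV. if a = c then (\<Sum>d\<in>UNIV. if b = d then A $ c $ d * of_nat CARD('n) else 0) else 0)"
        by (intro sum.cong refl) (auto simp: if_distrib[of "(*) _"] cong: if_cong)
      also have "\<dots> = of_nat CARD('n) * A $ a $ b" by simp
      finally show ?thesis .
    qed
    then show ?thesis by (simp add: vec_eq_iff)
  qed
  finally show ?thesis .
qed

text \<open>Each row has its nonzero entries in a common column exactly when the shifts agree; the
  remaining sum over rows is a character sum in the difference of the clock exponents.
  Representatives in \<open>half_range\<close> turn the congruences into equalities.\<close>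

lemma Jmat_orthogonal:
  assumes N: "odd CARD('n::{finite,linorder})"
    and k: "k \<in> half_range CARD('n) \<times> half_range CARD('n)" and l: "l \<in> half_range CARD('n) \<times> half_range CARD('n)"
  shows "trace (Jmat k ** dag (Jmat l :: 'n cmat)) = (if k = l then of_nat CARD('n) else 0)"
proof -
  let ?w = "omega CARD('n)"
  let ?h = "(int CARD('n) + 1) div 2"
  let ?D = "\<lambda>i t j. if int CARD('n) dvd int (pos (j :: 'n)) - int (pos (i :: 'n)) - t then 1 else (0::complex)"
  define ph where "ph = ?w powi (?h * fst k * snd k - ?h * fst l * snd l)"
  have row: "(\<Sum>j\<in>UNIV. ?D i (snd k) j * ?D i (snd l) j) = (if snd k = snd l then 1 else 0)" for i
  proof -
    obtain m :: 'n where m: "int CARD('n) dvd int (pos m) - (int (pos i) + snd k)" using ex_pos_dvd by blast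
    have iff: "int CARD('n) dvd int (pos j) - int (pos i) - snd k \<longleftrightarrow> j = m" for j
    proof
      assume "int CARD('n) dvd int (pos j) - int (pos i) - snd k"
      from dvd_diff[OF this m] show "j = m" unfolding pos_eq_iff[symmetric] pos_eq_iff_dvd by simp
    qed (use m in \<open>simp add: algebra_simps\<close>)
    have "int CARD('n) dvd int (pos m) - int (pos i) - snd l \<longleftrightarrow> int CARD('n) dvd snd k - snd l"
    proof -
      have "int (pos m) - int (pos i) - snd l = (snd k - snd l) + (int (pos m) - (int (pos i) + snd k))" by simp
      then show ?thesis using m by (metis dvd_add_left_iff)
    qed
    also have "\<dots> \<longleftrightarrow> snd k = snd l" using half_range_eq_iff[OF N, of "snd k" "snd l"] k l by auto
    finally have ml: "int CARD('n) dvd int (pos m) - int (pos i) - snd l \<longleftrightarrow> snd k = snd l" .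
    have "(\<Sum>j\<in>UNIV. ?D i (snd k) j * ?D i (snd l) j) = (\<Sum>j\<in>UNIV. if j = m then (if snd k = snd l then 1 else 0) else 0)"
      by (intro sum.cong refl) (auto simp: iff ml)
    then show ?thesis by simp
  qed
  have "trace (Jmat k ** dag (Jmat l :: 'n cmat))
      = (\<Sum>i\<in>UNIV. \<Sum>j\<in>UNIV. ph * ?w powi (int (pos (i :: 'n)) * (fst k - fst l)) * (?D i (snd k) j * ?D i (snd l) j))"
  proof -
    have "(Jmat k :: 'n cmat) $ i $ j * cnj ((Jmat l :: 'n cmat) $ i $ j)
      = ph * ?w powi (int (pos i) * (fst k - fst l)) * (?D i (snd k) j * ?D i (snd l) j)" for i j
    proof -
      have "?w powi (?h * fst k * snd k + fst k * int (pos i)) * cnj (?w powi (?h * fst l * snd l + fst l * int (pos i)))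
        = ph * ?w powi (int (pos i) * (fst k - fst l))"
        unfolding ph_def cnj_omega_powi omega_powi_add[symmetric] by (simp add: algebra_simps)
      then show ?thesis by (simp add: Jmat_nth)
    qed
    then show ?thesis by (simp only: trace_mult_dag)
  qed
  also have "\<dots> = (\<Sum>i\<in>UNIV. ph * ?w powi (int (pos (i :: 'n)) * (fst k - fst l)) * (if snd k = snd l then 1 else 0))"
    by (simp only: sum_distrib_left[symmetric] row)
  also have "\<dots> = ph * (\<Sum>i\<in>UNIV. ?w powi (int (pos (i :: 'n)) * (fst k - fst l))) * (if snd k = snd l then 1 else 0)"
    by (simp only: sum_distrib_left[symmetric] sum_distrib_right[symmetric])
  also have "\<dots> = (if k = l then of_nat CARD('n) else 0)"
  proof -
    have "int CARD('n) dvd fst k - fst l \<longleftrightarrow> fst k = fst l"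
      using half_range_eq_iff[OF N, of "fst k" "fst l"] k l by auto
    moreover have "ph = 1" if "k = l" using that by (simp add: ph_def)
    ultimately show ?thesis unfolding sum_omega_powi_pos[OF N] by (auto simp: prod_eq_iff)
  qed
  finally show ?thesis .
qed

section \<open>Mode coefficients and the stream function\<close>

definition Lscale :: "nat \<Rightarrow> complex" where
  "Lscale N = of_nat N / (4 * of_real pi * \<i>)"

lemma Lmat_eq: "Lmat k = cscale (Lscale CARD('n)) (Jmat k :: 'n::{finite,linorder} cmat)"
  by (simp add: Lmat_def Lscale_def)

lemma Lscale_neq_0: "odd N \<Longrightarrow> Lscale N \<noteq> 0"
  by (auto simp: Lscale_def elim: oddE)

lemma cnj_Lscale: "cnj (Lscale N) = - Lscale N"
  by (simp add: Lscale_def)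

text \<open>In contrast to \<^const>\<open>coeff_L\<close>, which is a junk value off the trace-zero matrices, this is
  linear on all matrices.\<close>

definition coefL :: "'n::{finite,linorder} cmat \<Rightarrow> int \<times> int \<Rightarrow> complex" where
  "coefL A k = trace (A ** dag (Jmat k)) / (of_nat CARD('n) * Lscale CARD('n))"

definition Lsum :: "(int \<times> int \<Rightarrow> complex) \<Rightarrow> 'n::{finite,linorder} cmat" where
  "Lsum c = (\<Sum>k\<in>modes CARD('n). cscale (c k) (Lmat k))"

lemma linear_cscale: "linear (cscale c :: 'n::finite cmat \<Rightarrow> 'n cmat)"
  using bounded_linear_cscale linear_conv_bounded_linear by blast

lemma linear_coefL: "linear (\<lambda>A :: 'n::{finite,linorder} cmat. coefL A k)"
  by (rule linearI) (simp_all add: coefL_def matrix_add_rdistrib trace_add add_divide_distrib trace_scaleR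
      scaleR_conv_of_real[where 'a=complex]
      flip: scalar_matrix_assoc)

lemma bounded_linear_coefL: "bounded_linear (\<lambda>A :: 'n::{finite,linorder} cmat. coefL A k)"
  using linear_coefL linear_conv_bounded_linear by blast

lemma coefL_cscale: "coefL (cscale c A) k = c * coefL A k"
  by (simp add: coefL_def cscale_mult_left trace_cscale)

lemma Lsum_coefL:
  fixes A :: "'n::{finite,linorder} cmat"
  assumes N: "odd CARD('n)" and A: "trace A = 0"
  shows "Lsum (coefL A) = A"
proof -
  have "(Lsum (coefL A) :: 'n cmat) = (\<Sum>k\<in>modes CARD('n). cscale (inverse (of_nat CARD('n))) (cscale (trace (A ** dag (Jmat k))) (Jmat k)))"
    unfolding Lsum_def using Lscale_neq_0[OF N]
    by (intro sum.cong refl) (simp add: Lmat_eq cscale_cscale coefL_def field_simps)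
  also have "\<dots> = cscale (inverse (of_nat CARD('n))) (cscale (of_nat CARD('n)) A)"
    by (simp only: linear_sum[OF linear_cscale, symmetric] Jmat_expansion[OF N A])
  also have "\<dots> = A" by (simp add: cscale_cscale)
  finally show ?thesis .
qed

lemma coefL_Lsum:
  assumes N: "odd CARD('n::{finite,linorder})" and k: "k \<in> modes CARD('n)"
  shows "coefL (Lsum c :: 'n cmat) k = c k"
proof -
  have k': "k \<in> half_range CARD('n) \<times> half_range CARD('n)" using k by (simp add: modes_eq)
  have "coefL (Lsum c :: 'n cmat) k = (\<Sum>l\<in>modes CARD('n). c l * coefL (Lmat l :: 'n cmat) k)"
    unfolding Lsum_def linear_sum[OF linear_coefL] coefL_cscale ..
  also have "\<dots> = (\<Sum>l\<in>modes CARD('n). if l = k then c k else 0)"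
  proof (intro sum.cong refl)
    fix l assume "l \<in> modes CARD('n)"
    then have "l \<in> half_range CARD('n) \<times> half_range CARD('n)" by (simp add: modes_eq)
    from Jmat_orthogonal[OF N this k'] have "coefL (Lmat l :: 'n cmat) k = (if l = k then 1 else 0)"
      unfolding coefL_def Lmat_eq cscale_mult_left trace_cscale using Lscale_neq_0[OF N] by simp
    then show "c l * coefL (Lmat l :: 'n cmat) k = (if l = k then c k else 0)" by simp
  qed
  also have "\<dots> = c k" using k by simp
  finally show ?thesis .
qed

lemma trace_Lsum:
  assumes N: "odd CARD('n::{finite,linorder})"
  shows "trace (Lsum c :: 'n cmat) = 0"
proof -
  have "trace (Jmat l :: 'n cmat) = 0" if "l \<in> modes CARD('n)" for l
    using Jmat_orthogonal[OF N, of l "(0, 0)"] that zero_half_range[OF N] by (auto simp: modes_eq Jmat_0)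
  moreover have "linear (trace :: 'n cmat \<Rightarrow> complex)" using bounded_linear_trace linear_conv_bounded_linear by blast
  ultimately show ?thesis
    unfolding Lsum_def by (simp add: linear_sum Lmat_eq trace_cscale)
qed

lemma cmat_eqI_coefL:
  fixes A B :: "'n::{finite,linorder} cmat"
  assumes N: "odd CARD('n)" and "trace A = 0" "trace B = 0" "\<And>k. k \<in> modes CARD('n) \<Longrightarrow> coefL A k = coefL B k"
  shows "A = B"
proof -
  have "Lsum (coefL A) = (Lsum (coefL B) :: 'n cmat)" unfolding Lsum_def using assms(4) by (intro sum.cong) auto
  then show ?thesis using assms by (simp add: Lsum_coefL)
qed

text \<open>The description in \<open>coeff_L\<close> is resolved by completeness for existence and
  orthogonality for uniqueness; its requirement of zeros off \<open>modes\<close> fixes the function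
  at the remaining arguments.\<close>

lemma coeff_L_eq:
  fixes A :: "'n::{finite,linorder} cmat"
  assumes N: "odd CARD('n)" and A: "trace A = 0" and k: "k \<in> modes CARD('n)"
  shows "coeff_L A k = coefL A k"
proof -
  have "coeff_L A = (\<lambda>k. if k \<in> modes CARD('n) then coefL A k else 0)"
    unfolding coeff_L_def
  proof (rule the_equality)
    have "(\<Sum>k\<in>modes CARD('n). cscale (if k \<in> modes CARD('n) then coefL A k else 0) (Lmat k)) = (Lsum (coefL A) :: 'n cmat)"
      unfolding Lsum_def by (intro sum.cong) auto
    then show "(\<forall>k. k \<notin> modes CARD('n) \<longrightarrow> (if k \<in> modes CARD('n) then coefL A k else 0) = 0) \<and>
       A = (\<Sum>k\<in>modes CARD('n). cscale (if k \<in> modes CARD('n) then coefL A k else 0) (Lmat k))"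
      by (simp add: Lsum_coefL[OF N A])
    fix c assume c: "(\<forall>k. k \<notin> modes CARD('n) \<longrightarrow> c k = 0) \<and> A = (\<Sum>k\<in>modes CARD('n). cscale (c k) (Lmat k))"
    then have "A = Lsum c" by (simp add: Lsum_def)
    then show "c = (\<lambda>k. if k \<in> modes CARD('n) then coefL A k else 0)"
      using c coefL_Lsum[OF N, of _ c] by auto
  qed
  then show ?thesis using k by simp
qed

lemma modes_uminus: "k \<in> modes N \<Longrightarrow> (- fst k, - snd k) \<in> modes N"
  by (auto simp: modes_def)

text \<open>The minus sign of the involution cancels against the one from conjugating the imaginary
  factor \<open>Lscale\<close>. What remains is the reality condition that characterizes
  anti-Hermitian matrices in terms of modes.\<close>

lemma coefL_involution:
  assumes N: "odd CARD('n::{finite,linorder})"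
  shows "coefL (- dag A :: 'n cmat) k = cnj (coefL A (- fst k, - snd k))"
proof -
  have "trace (- dag A ** dag (Jmat k)) = - cnj (trace (Jmat k ** A))"
    by (simp add: matrix_minus_left trace_minus dag_mult flip: trace_dag)
  also have "trace (Jmat k ** A) = trace (A ** dag (Jmat (- fst k, - snd k)))"
    by (simp add: dag_Jmat[OF N] trace_mul_sym[of A])
  finally show ?thesis by (simp add: coefL_def cnj_Lscale)
qed

lemma Lsum_mem_su:
  assumes N: "odd CARD('n::{finite,linorder})"
    and c: "\<And>k. k \<in> modes CARD('n) \<Longrightarrow> c (- fst k, - snd k) = cnj (c k)"
  shows "(Lsum c :: 'n cmat) \<in> su"
proof -
  have "- dag (Lsum c) = (Lsum c :: 'n cmat)"
    by (rule cmat_eqI_coefL[OF N])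
      (simp_all add: trace_minus trace_dag trace_Lsum[OF N] coefL_involution[OF N] coefL_Lsum[OF N] modes_uminus c)
  then show ?thesis by (simp add: mem_su_iff trace_Lsum[OF N])
qed

lemma coefL_su:
  assumes N: "odd CARD('n::{finite,linorder})" and A: "(A :: 'n cmat) \<in> su"
  shows "coefL A (- fst k, - snd k) = cnj (coefL A k)"
  using coefL_involution[OF N, of A k] A by (simp add: mem_su_iff)

lemma knorm_uminus: "knorm (- fst k, - snd k) = knorm k"
  by (simp add: knorm_def norm_Pair)

lemma knorm_neq_0: "k \<in> modes N \<Longrightarrow> knorm k \<noteq> 0"
  by (auto simp: knorm_def modes_def prod_eq_iff)

text \<open>An explicit, everywhere linear formula for the negative inverse of \<open>A_op\<close>;
  it agrees with \<open>stream_fun\<close> on \<open>su\<close>, where that inverse is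
  meaningful.\<close>

definition streamL :: "'n::{finite,linorder} cmat \<Rightarrow> 'n cmat" where
  "streamL A = - Lsum (\<lambda>k. coefL A k / of_real ((knorm k)\<^sup>2))"

lemma A_op_eq:
  fixes A :: "'n::{finite,linorder} cmat"
  assumes N: "odd CARD('n)" and A: "trace A = 0"
  shows "A_op A = Lsum (\<lambda>k. of_real ((knorm k)\<^sup>2) * coefL A k)"
  unfolding A_op_def Lsum_def using coeff_L_eq[OF N A] by (intro sum.cong) auto

text \<open>Evaluating \<open>inv_into\<close> takes a preimage that itself lies in
  \<open>su\<close>, which the reality condition provides, and injectivity of \<open>A_op\<close> on
  \<open>su\<close>, where every factor \<open>(knorm k)\<^sup>2\<close> is nonzero.\<close>

lemma stream_fun_eq:
  fixes A :: "'n::{finite,linorder} cmat"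
  assumes N: "odd CARD('n)" and A: "A \<in> su"
  shows "stream_fun A = streamL A" "streamL A \<in> su"
proof -
  let ?S = "Lsum (\<lambda>k. coefL A k / of_real ((knorm k)\<^sup>2)) :: 'n cmat"
  have S: "?S \<in> su"
    by (rule Lsum_mem_su[OF N]) (simp add: coefL_su[OF N A] knorm_uminus)
  have AS: "A_op ?S = A"
    by (rule cmat_eqI_coefL[OF N])
      (use A S in \<open>simp_all add: A_op_eq[OF N] trace_Lsum[OF N] mem_su_iff coefL_Lsum[OF N] knorm_neq_0\<close>)
  have "inj_on A_op (su :: 'n cmat set)"
  proof (rule inj_onI)
    fix B C :: "'n cmat" assume BC: "B \<in> su" "C \<in> su" "A_op B = A_op C"
    then have tr: "trace B = 0" "trace C = 0" by (simp_all add: mem_su_iff)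
    show "B = C"
    proof (rule cmat_eqI_coefL[OF N tr])
      fix k assume k: "k \<in> modes CARD('n)"
      from arg_cong[OF BC(3), of "\<lambda>X. coefL X k"] show "coefL B k = coefL C k"
        using k knorm_neq_0[OF k] by (simp add: A_op_eq[OF N] tr coefL_Lsum[OF N])
    qed
  qed
  then have "inv_into su A_op A = ?S" using S AS by (rule inv_into_f_eq)
  then show "stream_fun A = streamL A" by (simp add: stream_fun_def streamL_def)
  show "streamL A \<in> su" unfolding streamL_def by (rule minus_mem_su[OF S])
qed

section \<open>The fluxes as explicit forms in the coefficients\<close>

lemma frechet_derivative_within_subspace:
  fixes f :: "'a::real_normed_vector \<Rightarrow> 'b::real_normed_vector"
  assumes f: "(f has_derivative f') (at x within S)" and S: "subspace S" "x \<in> S" "v \<in> S"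
  shows "frechet_derivative f (at x within S) v = f' v"
proof -
  have "(f has_derivative frechet_derivative f (at x within S)) (at x within S)"
    using f frechet_derivative_works differentiable_def by blast
  \<comment> \<open>Within a subspace the derivative need not be unique as a map on the whole space.
    Restriction to the line through \<open>x\<close> in direction \<open>v\<close>, which stays in
    \<open>S\<close>, reduces the claim to uniqueness of a one-variable derivative.\<close>
  moreover have along: "((\<lambda>t. f (x + t *\<^sub>R v)) has_derivative (\<lambda>t. g (t *\<^sub>R v))) (at 0)"
    if "(f has_derivative g) (at x within S)" for g
  proof -
    have c: "((\<lambda>t::real. x + t *\<^sub>R v) has_derivative (\<lambda>t. t *\<^sub>R v)) (at 0)"
      by (auto intro!: derivative_eq_intros)
    have r: "range (\<lambda>t::real. x + t *\<^sub>R v) \<subseteq> S"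
      using S by (auto intro: subspace_add subspace_scale)
    have "(f has_derivative g) (at (x + 0 *\<^sub>R v) within range (\<lambda>t::real. x + t *\<^sub>R v))"
      using has_derivative_subset[OF that r] by simp
    from has_derivative_in_compose[OF c this] show ?thesis .
  qed
  ultimately have "(\<lambda>t. frechet_derivative f (at x within S) (t *\<^sub>R v)) = (\<lambda>t. f' (t *\<^sub>R v))"
    using has_derivative_unique[OF along along] f by blast
  from fun_cong[OF this, of 1] show ?thesis by simp
qed

text \<open>Since the derivative is taken within \<open>su\<close>, the linear \<open>coefL\<close>
  may replace \<open>coeff_L\<close>; the factor 1/2 cancels the two equal terms of the product
  rule. The weight \<open>g\<close> lets one lemma serve energy and enstrophy.\<close>

lemma frechet_derivative_quadratic:
  fixes \<Omega> V :: "'n::{finite,linorder} cmat"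
  assumes N: "odd CARD('n)" and S: "S \<subseteq> modes CARD('n)" and O: "\<Omega> \<in> su" and V: "V \<in> su"
    and Q: "\<And>A :: 'n cmat. A \<in> su \<Longrightarrow> Q A = 1/2 * (\<Sum>k\<in>S. g k * (cmod (coeff_L A k))\<^sup>2)"
  shows "frechet_derivative Q (at \<Omega> within su) V = (\<Sum>k\<in>S. g k * (coefL \<Omega> k \<bullet> coefL V k))"
proof (rule frechet_derivative_within_subspace[OF _ subspace_su O V])
  let ?Q = "\<lambda>A :: 'n cmat. 1/2 * (\<Sum>k\<in>S. g k * (coefL A k \<bullet> coefL A k))"
  have eq: "?Q A = Q A" if "A \<in> su" for A
    unfolding Q[OF that] using that S
    by (intro arg_cong[of _ _ "(*) (1/2)"] sum.cong refl)
      (auto simp: coeff_L_eq[OF N] mem_su_iff power2_norm_eq_inner)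
  have d: "((\<lambda>A. coefL A k) has_derivative (\<lambda>V. coefL V k)) (at \<Omega> within su)" for k
    by (rule bounded_linear_imp_has_derivative[OF bounded_linear_coefL])
  have "(?Q has_derivative (\<lambda>V. 1/2 * (\<Sum>k\<in>S. g k * (coefL \<Omega> k \<bullet> coefL V k + coefL V k \<bullet> coefL \<Omega> k)))) (at \<Omega> within su)"
    by (intro has_derivative_mult_right has_derivative_sum has_derivative_inner d)
  then have "(?Q has_derivative (\<lambda>V. \<Sum>k\<in>S. g k * (coefL \<Omega> k \<bullet> coefL V k))) (at \<Omega> within su)"
    by (simp add: inner_commute[of "coefL _ _" "coefL \<Omega> _"] sum_distrib_left)
  then show "(Q has_derivative (\<lambda>V. \<Sum>k\<in>S. g k * (coefL \<Omega> k \<bullet> coefL V k))) (at \<Omega> within su)"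
    by (rule has_derivative_transform_within[OF _ zero_less_one O]) (rule eq)
qed

text \<open>Common form of both fluxes: the weight \<open>1 / (knorm k)\<^sup>2\<close> gives the
  energy flux, the weight 1 the enstrophy flux.\<close>

definition quad_flux :: "(int \<times> int) set \<Rightarrow> (int \<times> int \<Rightarrow> real) \<Rightarrow> 'n::{finite,linorder} cmat \<Rightarrow> real" where
  "quad_flux S g A = - (\<Sum>k\<in>S. g k * (coefL A k \<bullet> coefL (comm (streamL A) A) k))"

lemma flux_E_eq:
  fixes A :: "'n::{finite,linorder} cmat"
  assumes N: "odd CARD('n)" and A: "A \<in> su"
  shows "flux_E K A = quad_flux {k \<in> modes CARD('n). knorm k \<le> K} (\<lambda>k. 1 / (knorm k)\<^sup>2) A"
proof -
  note V = comm_mem_su[OF stream_fun_eq(2)[OF N A] A]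
  have "frechet_derivative (energy_le K) (at A within su) (comm (streamL A) A) =
      (\<Sum>k\<in>{k \<in> modes CARD('n). knorm k \<le> K}. (\<lambda>k. 1 / (knorm k)\<^sup>2) k * (coefL A k \<bullet> coefL (comm (streamL A) A) k))"
    by (rule frechet_derivative_quadratic[OF N _ A V]) (auto simp: energy_le_def)
  then show ?thesis by (simp only: flux_E_def quad_flux_def stream_fun_eq(1)[OF N A])
qed

lemma flux_Z_eq:
  fixes A :: "'n::{finite,linorder} cmat"
  assumes N: "odd CARD('n)" and A: "A \<in> su"
  shows "flux_Z K A = quad_flux {k \<in> modes CARD('n). knorm k \<le> K} (\<lambda>_. 1) A"
proof -
  note V = comm_mem_su[OF stream_fun_eq(2)[OF N A] A]
  have "frechet_derivative (enstrophy_le K) (at A within su) (comm (streamL A) A) =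
      (\<Sum>k\<in>{k \<in> modes CARD('n). knorm k \<le> K}. (\<lambda>_. 1) k * (coefL A k \<bullet> coefL (comm (streamL A) A) k))"
    by (rule frechet_derivative_quadratic[OF N _ A V]) (auto simp: enstrophy_le_def)
  then show ?thesis by (simp only: flux_Z_def quad_flux_def stream_fun_eq(1)[OF N A])
qed

lemma continuous_on_quad_flux: "continuous_on UNIV (quad_flux S g :: 'n::{finite,linorder} cmat \<Rightarrow> real)"
proof -
  have c: "continuous_on UNIV (\<lambda>A :: 'n cmat. coefL (f A) k)" if "continuous_on UNIV f" for f k
    by (rule bounded_linear.continuous_on[OF bounded_linear_coefL that])
  have "continuous_on UNIV (\<lambda>A :: 'n cmat. cscale (coefL A k / of_real ((knorm k)\<^sup>2)) (Lmat k) :: 'n cmat)" for k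
    unfolding cscale_def divide_inverse by (intro continuous_intros c)
  then have "continuous_on UNIV (streamL :: 'n cmat \<Rightarrow> 'n cmat)"
    unfolding streamL_def[abs_def] Lsum_def by (intro continuous_intros)
  then have "continuous_on UNIV (\<lambda>A :: 'n cmat. comm (streamL A) A)"
    unfolding comm_def by (intro continuous_intros continuous_on_matrix_mult)
  then show ?thesis
    unfolding quad_flux_def[abs_def] by (intro continuous_intros c)
qed

section \<open>The fluxes are odd under transposition\<close>

lemma modes_reflect: "(fst k, - snd k) \<in> modes N \<longleftrightarrow> k \<in> modes N"
  by (cases k) (auto simp: modes_def)

lemma coefL_transpose:
  assumes N: "odd CARD('n::{finite,linorder})"
  shows "coefL (transpose A :: 'n cmat) k = coefL A (fst k, - snd k)"
proof -
  have "trace (transpose A ** dag (Jmat k)) = trace (transpose (transpose A ** dag (Jmat k)))"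
    by (simp add: trace_transpose)
  also have "\<dots> = trace (A ** dag (Jmat (fst k, - snd k)))"
    by (simp add: matrix_transpose_mul transpose_dag transpose_Jmat[OF N] trace_mul_sym[of A])
  finally show ?thesis by (simp add: coefL_def)
qed

lemma streamL_transpose:
  assumes N: "odd CARD('n::{finite,linorder})"
  shows "streamL (transpose A :: 'n cmat) = transpose (streamL A)"
proof -
  have kn: "knorm (fst k, - snd k) = knorm k" for k by (simp add: knorm_def norm_Pair)
  have "Lsum (\<lambda>k. coefL (transpose A) k / of_real ((knorm k)\<^sup>2))
      = transpose (Lsum (\<lambda>k. coefL A k / of_real ((knorm k)\<^sup>2)) :: 'n cmat)"
    by (rule cmat_eqI_coefL[OF N])
      (simp_all add: trace_transpose trace_Lsum[OF N] coefL_transpose[OF N] coefL_Lsum[OF N] modes_reflect kn)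
  then show ?thesis by (simp add: streamL_def transpose_minus)
qed

text \<open>The stream function is compatible with transposition, and reflecting the modes only
  permutes the summands; the sign comes solely from reversing the commutator.\<close>

lemma quad_flux_transpose:
  assumes N: "odd CARD('n::{finite,linorder})"
    and S: "\<And>k. (fst k, - snd k) \<in> S \<longleftrightarrow> k \<in> S" and g: "\<And>k. g (fst k, - snd k) = g k"
  shows "quad_flux S g (transpose A :: 'n cmat) = - quad_flux S g A"
proof -
  let ?r = "\<lambda>k :: int \<times> int. (fst k, - snd k)"
  let ?t = "\<lambda>k. g k * (coefL A k \<bullet> coefL (comm (streamL A) A) k)"
  have bij: "bij_betw ?r S S"
    by (rule bij_betw_byWitness[where f' = ?r]) (use S in auto)
  have "comm (streamL (transpose A)) (transpose A) = - transpose (comm (streamL A) A)"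
    by (simp add: streamL_transpose[OF N] transpose_comm)
  then have "quad_flux S g (transpose A) = (\<Sum>k\<in>S. ?t (?r k))"
    by (simp add: quad_flux_def coefL_transpose[OF N] g linear_neg[OF linear_coefL] sum_negf)
  also have "\<dots> = (\<Sum>k\<in>S. ?t k)" by (rule sum.reindex_bij_betw[OF bij])
  finally show ?thesis by (simp add: quad_flux_def)
qed

subsection \<open>Expansion of the averaged fluxes\<close>

text \<open>An orbit is closed as a level set and bounded because the second Casimir fixes the norm;
  this is why N must be at least 2.\<close>

lemma compact_orbit:
  assumes "CARD('n::finite) \<ge> 2"
  shows "compact (orbit z :: 'n cmat set)"
proof (cases "orbit z = ({} :: 'n cmat set)")
  case False
  then obtain \<Omega> :: "'n cmat" where "\<Omega> \<in> orbit z" by blast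
  note level = orbit_eq_level_set[OF this]
  have "closed {A :: 'n cmat. - dag A = A}"
    by (intro closed_Collect_eq continuous_on_minus bounded_linear.continuous_on[OF bounded_linear_dag] continuous_on_id)
  moreover have "closed {A :: 'n cmat. casimir_fun k A = casimir_fun k \<Omega>}" for k
    by (intro closed_Collect_eq continuous_on_const continuous_at_imp_continuous_on ballI
        has_derivative_continuous[OF has_derivative_casimir_fun])
  moreover have "orbit z = {A :: 'n cmat. - dag A = A} \<inter> (\<Inter>k\<in>{..<CARD('n)}. {A. casimir_fun k A = casimir_fun k \<Omega>})"
    unfolding level by blast
  ultimately have "closed (orbit z :: 'n cmat set)" by (simp add: closed_INT closed_Int)
  moreover have "norm A \<le> sqrt (- 2 * casimir_fun 1 \<Omega>)" if "A \<in> orbit z" for A :: "'n cmat"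
  proof -
    have A: "- dag A = A" "casimir_fun 1 A = casimir_fun 1 \<Omega>" using that assms unfolding level by auto
    then have "dag A = - A" by (metis minus_minus)
    then have "A \<bullet> A = - 2 * casimir_fun 1 A"
      by (simp add: inner_cmat casimir_fun_def mat_pow_Suc numeral_2_eq_2 matrix_minus_left trace_minus)
    then show ?thesis by (simp only: norm_eq_sqrt_inner A(2) order_refl)
  qed
  then have "bounded (orbit z :: 'n cmat set)" unfolding bounded_iff by blast
  ultimately show ?thesis by (simp add: compact_eq_bounded_closed)
qed simp

lemma C_on_Suc_imp_continuous_on:
  assumes "C_on (Suc k) S f"
  shows "continuous_on S f"
  unfolding continuous_on_eq_continuous_within
proof
  fix x assume x: "x \<in> S"
  then obtain V g where V: "open V" "x \<in> V" "C_open (Suc k) V g" "\<And>y. y \<in> V \<inter> S \<Longrightarrow> g y = f y"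
    using assms unfolding C_on_def by meson
  then obtain g' where "(g has_derivative g' x) (at x)" by auto
  then have cont_g: "continuous (at x within S) g"
    using has_derivative_continuous continuous_at_imp_continuous_at_within by blast
  obtain d where d: "d > 0" "ball x d \<subseteq> V" using V(1,2) open_contains_ball by blast
  show "continuous (at x within S) f"
    by (rule continuous_transform_within[OF cont_g d(1) x]) (use V(4) d in \<open>auto simp: dist_commute subset_iff\<close>)
qed

text \<open>A zero of \<open>a\<close> at \<open>x > 0\<close> would force
  \<open>\<bar>L\<bar> \<le> c * x\<close>, which fails for small \<open>x\<close>.\<close>

lemma nonzero_if_linear_leading_term:
  fixes a :: "real \<Rightarrow> real"
  assumes O: "(\<lambda>x. a x - x * L) \<in> O[at_right 0](\<lambda>x. x\<^sup>2)" and L: "L \<noteq> 0"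
  shows "\<forall>\<^sub>F x in at_right 0. a x \<noteq> 0"
proof -
  obtain c where c: "c > 0" "\<forall>\<^sub>F x in at_right 0. norm (a x - x * L) \<le> c * norm (x\<^sup>2)"
    using O by (elim landau_o.bigE)
  have "((\<lambda>x::real. c * x) \<longlongrightarrow> 0) (at_right 0)" by (auto intro!: tendsto_eq_intros)
  then have "\<forall>\<^sub>F x in at_right 0. c * x < \<bar>L\<bar>" using L by (intro order_tendstoD) auto
  moreover have "\<forall>\<^sub>F x in at_right (0::real). 0 < x" by (rule eventually_at_right_less)
  ultimately show ?thesis
    using c(2)
  proof eventually_elim
    case (elim x)
    show ?case
    proof
      assume "a x = 0"
      then have "x * \<bar>L\<bar> \<le> x * (c * x)" using elim by (simp add: abs_mult power2_eq_square mult_ac)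
      then show False using elim by simp
    qed
  qed
qed

text \<open>The zeroth-order term is the mean of \<open>f\<close>, which is 0, so the error is
  exactly the integral of \<open>r x * f\<close>; compactness bounds \<open>f\<close> and leaves a
  constant times \<open>x\<^sup>2\<close>.\<close>

lemma tilted_integral_bigo:
  fixes m :: "'a::euclidean_space measure" and f q :: "'a \<Rightarrow> real"
  assumes m: "prob_space m" "sets m = sets (restrict_space borel S)" and S: "compact S"
    and f: "continuous_on S f" "(\<integral>x. f x \<partial>m) = 0" and q: "continuous_on S q" and e: "e > 0"
    and r: "\<And>x. x \<in> {0<..<e} \<Longrightarrow> r x \<in> borel_measurable m"
      "\<And>x y. x \<in> {0<..<e} \<Longrightarrow> y \<in> S \<Longrightarrow> \<bar>r x y\<bar> \<le> C * x\<^sup>2"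
    and tilt: "\<And>x. x \<in> {0<..<e} \<Longrightarrow> mx x = density m (\<lambda>y. ennreal (1 + x * q y + r x y))"
  shows "(\<lambda>x. (\<integral>y. f y \<partial>mx x) - x * (\<integral>y. f y * q y \<partial>m)) \<in> O[at_right 0](\<lambda>x. x\<^sup>2)"
proof -
  interpret prob_space m by (rule m)
  have space: "space m = S"
    using sets_eq_imp_space_eq[OF m(2)] by (simp add: space_restrict_space)
  have meas: "g \<in> borel_measurable m" if "continuous_on S g" for g :: "'a \<Rightarrow> real"
    using borel_measurable_continuous_on_restrict[OF that] measurable_cong_sets[OF m(2) refl] by blast
  have bdd: "\<exists>b. \<forall>y\<in>S. \<bar>g y\<bar> \<le> b" if "continuous_on S g" for g :: "'a \<Rightarrow> real"
    using compact_imp_bounded[OF compact_continuous_image[OF that S]] by (auto simp: bounded_iff)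
  obtain bf bq where bf: "\<And>y. y \<in> S \<Longrightarrow> \<bar>f y\<bar> \<le> bf" and bq: "\<And>y. y \<in> S \<Longrightarrow> \<bar>q y\<bar> \<le> bq"
    using bdd[OF f(1)] bdd[OF q] by blast
  have S0: "S \<noteq> {}" using not_empty space by simp
  then have bf0: "bf \<ge> 0" using bf by fastforce
  \<comment> \<open>\<open>ennreal\<close> cuts negative numbers off at 0, so the density may be
    expanded only where \<open>1 + x * q y + r x y\<close> is nonnegative; smallness of this bound
    on the correction ensures that on all of \<open>S\<close>.\<close>
  have lim: "((\<lambda>x. x * bq + C * x\<^sup>2) \<longlongrightarrow> 0) (at_right 0)" by (auto intro!: tendsto_eq_intros)
  have "\<forall>\<^sub>F x in at_right 0. x * bq + C * x\<^sup>2 < 1" using order_tendstoD(2)[OF lim] by simp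
  moreover have "\<forall>\<^sub>F x in at_right 0. x \<in> {0<..<e}" by (rule eventually_at_right_real[OF e])
  ultimately have "\<forall>\<^sub>F x in at_right 0. norm ((\<integral>y. f y \<partial>mx x) - x * (\<integral>y. f y * q y \<partial>m)) \<le> C * bf * norm (x\<^sup>2)"
  proof eventually_elim
    case (elim x)
    have rm: "r x \<in> borel_measurable m" by (rule r(1)[OF elim(2)])
    have fm: "f \<in> borel_measurable m" and qm: "q \<in> borel_measurable m" using meas f q by auto
    have nn: "0 \<le> 1 + x * q y + r x y" if "y \<in> S" for y
    proof -
      have "\<bar>x * q y\<bar> \<le> x * bq" using elim(2) bq[OF that] by (simp add: abs_mult)
      then show ?thesis using r(2)[OF elim(2) that] elim(1) by linarith
    qed
    have i1: "integrable m f"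
      by (rule integrable_const_bound[of _ bf]) (auto simp: bf space fm)
    have i2: "integrable m (\<lambda>y. f y * q y)"
      by (rule integrable_const_bound[of _ "bf * bq"])
        (auto simp: space abs_mult intro!: AE_I2 mult_mono bf bq bf0 borel_measurable_times fm qm)
    have rb: "\<bar>r x y * f y\<bar> \<le> C * x\<^sup>2 * bf" if "y \<in> S" for y
      unfolding abs_mult using r(2)[OF elim(2) that] bf[OF that] by (intro mult_mono) auto
    have i3: "integrable m (\<lambda>y. r x y * f y)"
      by (rule integrable_const_bound[of _ "C * x\<^sup>2 * bf"])
        (auto simp: space intro!: AE_I2 rb borel_measurable_times fm rm)
    have "(\<integral>y. f y \<partial>mx x) = (\<integral>y. (1 + x * q y + r x y) *\<^sub>R f y \<partial>m)"
      unfolding tilt[OF elim(2)]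
      by (rule integral_density) (use fm qm rm in \<open>auto simp: space nn intro!: AE_I2\<close>)
    also have "\<dots> = (\<integral>y. f y + (x * (f y * q y) + r x y * f y) \<partial>m)"
      by (rule Bochner_Integration.integral_cong) (auto simp: algebra_simps)
    also have "\<dots> = (\<integral>y. f y \<partial>m) + (x * (\<integral>y. f y * q y \<partial>m) + (\<integral>y. r x y * f y \<partial>m))"
      using i1 i2 i3 by simp
    finally have "(\<integral>y. f y \<partial>mx x) - x * (\<integral>y. f y * q y \<partial>m) = (\<integral>y. r x y * f y \<partial>m)" by (simp add: f(2))
    also have "norm \<dots> \<le> C * x\<^sup>2 * bf"
    proof -
      have "norm (\<integral>y. r x y * f y \<partial>m) \<le> (\<integral>y. norm (r x y * f y) \<partial>m)" by (rule integral_norm_bound)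
      also have "\<dots> \<le> (\<integral>y. C * x\<^sup>2 * bf \<partial>m)"
        by (rule integral_mono) (use i3 rb in \<open>auto simp: space\<close>)
      also have "\<dots> = C * x\<^sup>2 * bf" by (simp add: prob_space)
      finally show ?thesis .
    qed
    finally show ?case by (simp add: mult_ac)
  qed
  then show ?thesis by (rule bigoI)
qed

lemma integral_eq_0_if_odd:
  fixes f :: "'a \<Rightarrow> real"
  assumes T: "T \<in> measurable m m" "distr m m T = m" and f: "f \<in> borel_measurable m"
    and odd: "\<And>x. x \<in> space m \<Longrightarrow> f (T x) = - f x"
  shows "(\<integral>x. f x \<partial>m) = 0"
proof -
  have "(\<integral>x. f x \<partial>m) = (\<integral>x. f (T x) \<partial>m)"
    using integral_distr[OF T(1) f] by (simp add: T(2))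
  also have "\<dots> = (\<integral>x. - f x \<partial>m)" by (rule Bochner_Integration.integral_cong) (auto simp: odd)
  finally show ?thesis by simp
qed

lemma flux_transpose:
  fixes A :: "'n::{finite,linorder} cmat"
  assumes N: "odd CARD('n)" and A: "A \<in> su"
  shows "flux_E K (transpose A) = - flux_E K A" "flux_Z K (transpose A) = - flux_Z K A"
proof -
  have kn: "knorm (fst k, - snd k) = knorm k" for k by (simp add: knorm_def norm_Pair)
  show "flux_E K (transpose A) = - flux_E K A"
    unfolding flux_E_eq[OF N A] flux_E_eq[OF N transpose_mem_su[OF A]]
    by (rule quad_flux_transpose[OF N]) (simp_all add: modes_reflect kn)
  show "flux_Z K (transpose A) = - flux_Z K A"
    unfolding flux_Z_eq[OF N A] flux_Z_eq[OF N transpose_mem_su[OF A]]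
    by (rule quad_flux_transpose[OF N]) (simp_all add: modes_reflect kn)
qed

lemma continuous_on_flux:
  assumes N: "odd CARD('n::{finite,linorder})"
  shows "continuous_on (orbit z :: 'n cmat set) (flux_E K)" "continuous_on (orbit z :: 'n cmat set) (flux_Z K)"
proof -
  have "continuous_on (orbit z :: 'n cmat set) (quad_flux S g)" for S g
    using continuous_on_subset[OF continuous_on_quad_flux] by blast
  then show "continuous_on (orbit z :: 'n cmat set) (flux_E K)" "continuous_on (orbit z :: 'n cmat set) (flux_Z K)"
    by (subst continuous_on_cong[OF refl]; fastforce simp: orbit_def flux_E_eq[OF N] flux_Z_eq[OF N])+
qed

theorem lemma6p1:
  fixes z :: "nat \<Rightarrow> complex" and K \<kappa>\<^sub>0 C :: real
    and M :: "'w measure" and F :: "real \<Rightarrow> 'w measure"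
    and m :: nat and W :: "nat \<Rightarrow> real \<Rightarrow> 'w \<Rightarrow> real"
    and X :: "real \<Rightarrow> nat \<Rightarrow> 'n::{finite,linorder} cmat \<Rightarrow> 'n cmat"
    and Z :: "real \<Rightarrow> 'n cmat \<Rightarrow> real \<Rightarrow> 'w \<Rightarrow> 'n cmat"
    and m_KKS :: "'n cmat measure" and m\<^sub>\<kappa> :: "real \<Rightarrow> 'n cmat measure"
    and q :: "'n cmat \<Rightarrow> real" and r :: "real \<Rightarrow> 'n cmat \<Rightarrow> real"
  assumes N: "CARD('n) \<ge> 3" "odd CARD('n)"
    and dim: "CARD('d::{finite,linorder}) = CARD('n) * (CARD('n) - 1)"
    and K: "K > 0"
    and z: "z \<in> top_of_set (casimir_space CARD('n)) interior_of A_regular TYPE('n)"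
    and kks: "kks_probability TYPE('d) z m_KKS"
    and kappa0: "\<kappa>\<^sub>0 > 0"
    and space: "filtered_prob_space M F"
    and BM: "indep_brownian_motions M F m W"
    and fast: "\<And>\<kappa>. \<kappa> \<in> {0<..<\<kappa>\<^sub>0} \<Longrightarrow> fast_process M F m W (X \<kappa>) z (Z \<kappa>)"
    and inv: "\<And>\<kappa>. \<kappa> \<in> {0<..<\<kappa>\<^sub>0} \<Longrightarrow> invariant_probability M z (Z \<kappa>) (m\<^sub>\<kappa> \<kappa>)"
    and uniq: "\<And>\<kappa> \<nu>. \<kappa> \<in> {0<..<\<kappa>\<^sub>0} \<Longrightarrow> invariant_probability M z (Z \<kappa>) \<nu> \<Longrightarrow> \<nu> = m\<^sub>\<kappa> \<kappa>"
    and q_C2: "C_on 2 (orbit z) q"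
    and q_nonzero: "\<exists>\<Omega>\<in>orbit z. q \<Omega> \<noteq> 0"
    and q_mean: "(\<integral>\<Omega>. q \<Omega> \<partial>m_KKS) = 0"
    and r_meas: "\<And>\<kappa>. \<kappa> \<in> {0<..<\<kappa>\<^sub>0} \<Longrightarrow> r \<kappa> \<in> borel_measurable m_KKS"
    and r_bound: "\<And>\<kappa> \<Omega>. \<kappa> \<in> {0<..<\<kappa>\<^sub>0} \<Longrightarrow> \<Omega> \<in> orbit z \<Longrightarrow> \<bar>r \<kappa> \<Omega>\<bar> \<le> C * \<kappa>\<^sup>2"
    and tilt: "\<And>\<kappa>. \<kappa> \<in> {0<..<\<kappa>\<^sub>0} \<Longrightarrow>
      m\<^sub>\<kappa> \<kappa> = density m_KKS (\<lambda>\<Omega>. ennreal (1 + \<kappa> * q \<Omega> + r \<kappa> \<Omega>))"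
  shows "((\<lambda>\<kappa>. (\<integral>\<Omega>. flux_E K \<Omega> \<partial>m\<^sub>\<kappa> \<kappa>) - \<kappa> * (\<integral>\<Omega>. flux_E K \<Omega> * q \<Omega> \<partial>m_KKS))
            \<in> O[at_right 0](\<lambda>\<kappa>. \<kappa>\<^sup>2)) \<and>
         ((\<lambda>\<kappa>. (\<integral>\<Omega>. flux_Z K \<Omega> \<partial>m\<^sub>\<kappa> \<kappa>) - \<kappa> * (\<integral>\<Omega>. flux_Z K \<Omega> * q \<Omega> \<partial>m_KKS))
            \<in> O[at_right 0](\<lambda>\<kappa>. \<kappa>\<^sup>2)) \<and>
         ((\<integral>\<Omega>. flux_E K \<Omega> * q \<Omega> \<partial>m_KKS) \<noteq> 0 \<longrightarrow>
            (\<forall>\<^sub>F \<kappa> in at_right 0. (\<integral>\<Omega>. flux_E K \<Omega> \<partial>m\<^sub>\<kappa> \<kappa>) \<noteq> 0)) \<and>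
         ((\<integral>\<Omega>. flux_Z K \<Omega> * q \<Omega> \<partial>m_KKS) \<noteq> 0 \<longrightarrow>
            (\<forall>\<^sub>F \<kappa> in at_right 0. (\<integral>\<Omega>. flux_Z K \<Omega> \<partial>m\<^sub>\<kappa> \<kappa>) \<noteq> 0))"
proof -
  have reg: "card (eigenvalues \<Omega>) = CARD('n)" if "\<Omega> \<in> (orbit z :: 'n cmat set)" for \<Omega>
    using z interior_of_subset[of "top_of_set (casimir_space CARD('n))" "A_regular TYPE('n)"] that
    by (auto simp: A_regular_def)
  note m = kks_probability_transpose_invariant[OF dim reg kks]
  have space_m: "space m_KKS = orbit z"
    using sets_eq_imp_space_eq[OF m(2)] by (simp add: space_restrict_space)
  have orbit_compact: "compact (orbit z :: 'n cmat set)" using N(1) by (intro compact_orbit) simp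
  have q: "continuous_on (orbit z) q"
    using q_C2 by (intro C_on_Suc_imp_continuous_on[of 1]) (simp add: numeral_2_eq_2)
  \<comment> \<open>Energy and enstrophy flux enter only as continuous functions that are odd under
    transposition: oddness removes the mean under \<open>m_KKS\<close>, continuity gives bounds on
    the compact orbit.\<close>
  have bigo: "(\<lambda>\<kappa>. (\<integral>\<Omega>. f \<Omega> \<partial>m\<^sub>\<kappa> \<kappa>) - \<kappa> * (\<integral>\<Omega>. f \<Omega> * q \<Omega> \<partial>m_KKS)) \<in> O[at_right 0](\<lambda>\<kappa>. \<kappa>\<^sup>2)"
    if f: "continuous_on (orbit z) f" and odd: "\<And>A. A \<in> su \<Longrightarrow> f (transpose A) = - f A" for f :: "'n cmat \<Rightarrow> real"
  proof (rule tilted_integral_bigo[OF m(1,2) orbit_compact f _ q kappa0 r_meas r_bound tilt])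
    have fm: "f \<in> borel_measurable m_KKS"
      using borel_measurable_continuous_on_restrict[OF f] measurable_cong_sets[OF m(2) refl] by blast
    show "(\<integral>\<Omega>. f \<Omega> \<partial>m_KKS) = 0"
    proof (rule integral_eq_0_if_odd[OF m(3,4) fm])
      fix A assume "A \<in> space m_KKS"
      then have "A \<in> su" unfolding space_m by (auto simp: orbit_def)
      then show "f (transpose A) = - f A" by (rule odd)
    qed
  qed
  note E = bigo[OF continuous_on_flux(1)[OF N(2)] flux_transpose(1)[OF N(2)]]
  note Z = bigo[OF continuous_on_flux(2)[OF N(2)] flux_transpose(2)[OF N(2)]]
  show ?thesis
    using E Z nonzero_if_linear_leading_term[OF E] nonzero_if_linear_leading_term[OF Z] by blast
qed

end
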